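(* Let $W$ be a graphon such that $W$ and $x\mapsto W(x,x)$ are Riemann integrable and $\int_{[0,1]^2}W(x,y)\,dx\,dy>0$. Let $\theta_N\in(0,1)$ satisfy $N^{2/3}\theta_N\gtrsim1$ and $\theta_N\to0$, let $\beta_0\in(0,1/\|W\|_{\mathrm{op}})$ be fixed, let $\delta_N>0$ be a sequence with $\delta_N\ll1$, and let $G_N\sim G(N,\theta_N,W)$. Consider testing $H_0:\beta=\beta_0$ versus $H_1:|\beta-\beta_0|\ge\delta_N$ with conditional worst-case risk $\mathcal R(\phi_N)$ of a test $\phi_N$. Then, as $N\to\infty$: (1) If $\delta_N\ll\sqrt{\theta_N}$, then $\inf_{\phi_N}\mathcal R(\phi_N)\xrightarrow{P}1$. (2) If $\delta_N\gg\sqrt{\theta_N}$, then for every fixed $\alpha\in(0,1)$ the test $\phi_N^\alpha=\mathbf 1\{H_N(\vec\sigma)<\hat c_\alpha\text{ or }H_N(\vec\sigma)>\hat d_\alpha\}$ satisfies $\mathcal R(\phi_N^\alpha)\xrightarrow{P}\alpha$. Consequently, $\inf_{\phi_N}\mathcal R(\phi_N)\xrightarrow{P}0$, where the infimum is taken over all tests (not necessarily of fixed asymptotic level).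
   Context: A graphon is a symmetric measurable function $W:[0,1]^2\to[0,1]$; $\|W\|_{\mathrm{op}}$ is the operator norm of $T_W:L^2[0,1]\to L^2[0,1]$, $(T_Wf)(x)=\int_0^1W(x,y)f(y)\,dy$. $G_N\sim G(N,\theta_N,W)$ is the random graph (self-loops allowed) on $\{1,\dots,N\}$ with symmetric adjacency matrix $A_{G_N}$ whose entries $A_{G_N}(i,j)$, $1\le i\le j\le N$, are independent Bernoulli with parameters $\theta_NW(\frac iN,\frac jN)$. For $\vec\sigma\in\{-1,1\}^N$, $H_N(\vec\sigma)=-\frac{1}{2N\theta_N}\sum_{1\le i,j\le N}A_{G_N}(i,j)\sigma_i\sigma_j$. Given $G_N$, the Ising model is $\mathbb P_\beta(\vec\sigma\,|\,A_{G_N})=\frac{1}{2^NZ_N(\beta)}e^{-\beta H_N(\vec\sigma)}$, $Z_N(\beta)=2^{-N}\sum_{\vec\sigma\in\{-1,1\}^N}e^{-\beta H_N(\vec\sigma)}$. A test is a function $\phi_N:\{-1,1\}^N\to\{0,1\}$ (it may depend on the observed graph $G_N$). Its conditional worst-case risk is the random variable $$\mathcal R(\phi_N):=\mathbb P_{\beta_0}(\phi_N(\vec\sigma)=1\,|\,A_{G_N})+\sup_{\beta\in\Theta(\beta_0,\delta_N)}\mathbb P_\beta(\phi_N(\vec\sigma)=0\,|\,A_{G_N}),$$ where $\Theta(\beta_0,\delta_N):=\{\beta\in(0,1/\|W\|_{\mathrm{op}}):|\beta-\beta_0|\ge\delta_N\}$. $\xrightarrow{P}$ is convergence in probability over the randomness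 of $G_N$. The thresholds are $$\hat c_\alpha:=-z_{\alpha/2}\sqrt{\tfrac{1}{2N^2\theta_N^2}\textstyle\sum_{1\le i,j\le N}A_{G_N}(i,j)}-\tfrac{\beta_0}{2N^2\theta_N^2}\sum_{1\le i,j\le N}A_{G_N}(i,j),$$ $$\hat d_\alpha:=z_{\alpha/2}\sqrt{\tfrac{1}{2N^2\theta_N^2}\textstyle\sum_{1\le i,j\le N}A_{G_N}(i,j)}-\tfrac{\beta_0}{2N^2\theta_N^2}\sum_{1\le i,j\le N}A_{G_N}(i,j),$$ with $z_a$ the $(1-a)$-th quantile of $\mathcal N(0,1)$. $a_N\ll b_N$ (or $b_N\gg a_N$) means $a_N/b_N\to0$; $a_N\gtrsim b_N$ means $a_N\ge Cb_N$ for some constant $C>0$ and all large $N$. *)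

theory Defs
  imports "HOL-Probability.Probability"
begin

definition graphon :: "(real \<Rightarrow> real \<Rightarrow> real) \<Rightarrow> bool" where
  "graphon W \<longleftrightarrow>
     (\<lambda>(x, y). W x y) \<in> borel_measurable (lebesgue_on ({0..1} \<times> {0..1})) \<and>
     (\<forall>x\<in>{0..1}. \<forall>y\<in>{0..1}. W x y = W y x \<and> 0 \<le> W x y \<and> W x y \<le> 1)"

text \<open>
  Riemann integrability on the box with corners \<open>a\<close>, \<open>b\<close>. This is the condition of
  the lemma \<open>has_integral\<close>, with the gauge required to be constant: convergence of the
  Riemann sums as the mesh of the tagged division tends to zero.
\<close>

definition riemann_integrable ::
    "('n::euclidean_space \<Rightarrow> real) \<Rightarrow> 'n \<Rightarrow> 'n \<Rightarrow> bool" where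
  "riemann_integrable f a b \<longleftrightarrow>
     (\<exists>I. \<forall>e>0. \<exists>d>0. \<forall>p. p tagged_division_of cbox a b \<and> (\<lambda>x. ball x d) fine p \<longrightarrow>
        \<bar>(\<Sum>(x, k)\<in>p. measure lborel k * f x) - I\<bar> < e)"

definition L2 :: "(real \<Rightarrow> real) set" where
  "L2 = {f \<in> borel_measurable (lebesgue_on {0..1}).
           integrable (lebesgue_on {0..1}) (\<lambda>x. (f x)\<^sup>2)}"

definition L2_norm :: "(real \<Rightarrow> real) \<Rightarrow> real" where
  "L2_norm f = sqrt (LINT x|lebesgue_on {0..1}. (f x)\<^sup>2)"

definition graphon_op :: "(real \<Rightarrow> real \<Rightarrow> real) \<Rightarrow> (real \<Rightarrow> real) \<Rightarrow> real \<Rightarrow> real" where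
  "graphon_op W f x = (LINT y|lebesgue_on {0..1}. W x y * f y)"

text \<open>
  The same expression as in the library's \<open>onorm\<close>, which is not applicable because
  \<open>L2\<close> is not a type of class \<open>real_normed_vector\<close>. Functions of norm zero contribute
  the value 0.
\<close>

definition op_norm :: "(real \<Rightarrow> real \<Rightarrow> real) \<Rightarrow> real" where
  "op_norm W = (SUP f\<in>L2. L2_norm (graphon_op W f) / L2_norm f)"

text \<open>
  The law of the adjacency matrix of a random graph on the vertices \<open>1, \<dots>, N\<close>. The
  independent edge indicators are indexed by the pairs \<open>i \<le> j\<close>; entries of the matrix
  with an index outside \<open>{1..N}\<close> are 0.
\<close>

definition random_graph :: "nat \<Rightarrow> real \<Rightarrow> (real \<Rightarrow> real \<Rightarrow> real) \<Rightarrow> (nat \<Rightarrow> nat \<Rightarrow> real) pmf" where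
  "random_graph N t W =
     map_pmf (\<lambda>g i j. of_bool (g (min i j, max i j)))
       (Pi_pmf {(i, j). 1 \<le> i \<and> i \<le> j \<and> j \<le> N} False
         (\<lambda>(i, j). bernoulli_pmf (t * W (real i / real N) (real j / real N))))"

definition converges_in_prob :: "(nat \<Rightarrow> 'a pmf) \<Rightarrow> (nat \<Rightarrow> 'a \<Rightarrow> real) \<Rightarrow> real \<Rightarrow> bool" where
  "converges_in_prob M X c \<longleftrightarrow>
     (\<forall>\<epsilon>>0. (\<lambda>N. measure_pmf.prob (M N) {\<omega>. \<bar>X N \<omega> - c\<bar> > \<epsilon>}) \<longlonglongrightarrow> 0)"

definition spins :: "nat \<Rightarrow> (nat \<Rightarrow> real) set" where
  "spins N = {1..N} \<rightarrow>\<^sub>E {-1, 1}"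

definition hamiltonian :: "nat \<Rightarrow> real \<Rightarrow> (nat \<Rightarrow> nat \<Rightarrow> real) \<Rightarrow> (nat \<Rightarrow> real) \<Rightarrow> real" where
  "hamiltonian N t A \<sigma> =
     - (1 / (2 * real N * t)) * (\<Sum>i=1..N. \<Sum>j=1..N. A i j * \<sigma> i * \<sigma> j)"

definition partition_function :: "nat \<Rightarrow> real \<Rightarrow> (nat \<Rightarrow> nat \<Rightarrow> real) \<Rightarrow> real \<Rightarrow> real" where
  "partition_function N t A \<beta> =
     (1 / 2 ^ N) * (\<Sum>\<sigma>\<in>spins N. exp (- \<beta> * hamiltonian N t A \<sigma>))"

definition ising :: "nat \<Rightarrow> real \<Rightarrow> (nat \<Rightarrow> nat \<Rightarrow> real) \<Rightarrow> real \<Rightarrow> (nat \<Rightarrow> real) measure" where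
  "ising N t A \<beta> =
     point_measure (spins N)
       (\<lambda>\<sigma>. ennreal (1 / (2 ^ N * partition_function N t A \<beta>) * exp (- \<beta> * hamiltonian N t A \<sigma>)))"

text \<open>Tests may depend on the observed graph, which is the first argument.\<close>

definition tests :: "nat \<Rightarrow> ((nat \<Rightarrow> nat \<Rightarrow> real) \<Rightarrow> (nat \<Rightarrow> real) \<Rightarrow> nat) set" where
  "tests N = {\<phi>. \<forall>A. \<phi> A \<in> spins N \<rightarrow> {0, 1}}"

definition alternatives :: "(real \<Rightarrow> real \<Rightarrow> real) \<Rightarrow> real \<Rightarrow> real \<Rightarrow> real set" where
  "alternatives W \<beta>\<^sub>0 d = {\<beta>. 0 < \<beta> \<and> \<beta> < 1 / op_norm W \<and> \<bar>\<beta> - \<beta>\<^sub>0\<bar> \<ge> d}"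

definition risk :: "(real \<Rightarrow> real \<Rightarrow> real) \<Rightarrow> real \<Rightarrow> real \<Rightarrow> real \<Rightarrow> nat \<Rightarrow>
    ((nat \<Rightarrow> nat \<Rightarrow> real) \<Rightarrow> (nat \<Rightarrow> real) \<Rightarrow> nat) \<Rightarrow> (nat \<Rightarrow> nat \<Rightarrow> real) \<Rightarrow> real" where
  "risk W \<beta>\<^sub>0 t d N \<phi> A =
     measure (ising N t A \<beta>\<^sub>0) {\<sigma> \<in> spins N. \<phi> A \<sigma> = 1} +
     (SUP \<beta>\<in>alternatives W \<beta>\<^sub>0 d. measure (ising N t A \<beta>) {\<sigma> \<in> spins N. \<phi> A \<sigma> = 0})"

definition min_risk :: "(real \<Rightarrow> real \<Rightarrow> real) \<Rightarrow> real \<Rightarrow> real \<Rightarrow> real \<Rightarrow> nat \<Rightarrow>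
    (nat \<Rightarrow> nat \<Rightarrow> real) \<Rightarrow> real" where
  "min_risk W \<beta>\<^sub>0 t d N A = (INF \<phi>\<in>tests N. risk W \<beta>\<^sub>0 t d N \<phi> A)"

text \<open>\<open>normal_z a\<close> is the \<open>(1 - a)\<close>-quantile of the standard normal law.\<close>

definition normal_z :: "real \<Rightarrow> real" where
  "normal_z a = Inf {x. cdf std_normal_distribution x \<ge> 1 - a}"

definition scaled_edge_sum :: "nat \<Rightarrow> real \<Rightarrow> (nat \<Rightarrow> nat \<Rightarrow> real) \<Rightarrow> real" where
  "scaled_edge_sum N t A = 1 / (2 * (real N)\<^sup>2 * t\<^sup>2) * (\<Sum>i=1..N. \<Sum>j=1..N. A i j)"

definition c_hat :: "real \<Rightarrow> real \<Rightarrow> nat \<Rightarrow> real \<Rightarrow> (nat \<Rightarrow> nat \<Rightarrow> real) \<Rightarrow> real" where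
  "c_hat \<alpha> \<beta>\<^sub>0 N t A =
     - normal_z (\<alpha> / 2) * sqrt (scaled_edge_sum N t A) - \<beta>\<^sub>0 * scaled_edge_sum N t A"

definition d_hat :: "real \<Rightarrow> real \<Rightarrow> nat \<Rightarrow> real \<Rightarrow> (nat \<Rightarrow> nat \<Rightarrow> real) \<Rightarrow> real" where
  "d_hat \<alpha> \<beta>\<^sub>0 N t A =
     normal_z (\<alpha> / 2) * sqrt (scaled_edge_sum N t A) - \<beta>\<^sub>0 * scaled_edge_sum N t A"

definition hamiltonian_test :: "real \<Rightarrow> real \<Rightarrow> nat \<Rightarrow> real \<Rightarrow>
    (nat \<Rightarrow> nat \<Rightarrow> real) \<Rightarrow> (nat \<Rightarrow> real) \<Rightarrow> nat" where
  "hamiltonian_test \<alpha> \<beta>\<^sub>0 N t A \<sigma> =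
     of_bool (hamiltonian N t A \<sigma> < c_hat \<alpha> \<beta>\<^sub>0 N t A \<or> hamiltonian N t A \<sigma> > d_hat \<alpha> \<beta>\<^sub>0 N t A)"

end

theory Submission
  imports Defs "HOL-Complex_Analysis.Great_Picard" "HOL-Real_Asymp.Real_Asymp"
begin

text \<open>
  For a fixed graph the Ising measures are an exponential family in \<open>\<beta>\<close> with sufficient
  statistic minus the Hamiltonian, so every quantity that matters for testing is a ratio of partition
  functions at parameters close to \<open>\<beta>\<^sub>0\<close>. The whole theorem follows from one
  expansion: with \<open>V\<close> the scaled edge sum, which is of order \<open>1 / \<theta>\<close>,
  \<open>ln (Z \<beta>) - ln (Z \<beta>\<^sub>0) = (\<beta>\<^sup>2 - \<beta>\<^sub>0\<^sup>2) / 2 * V +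
  o(1)\<close> in probability over the graph, uniformly for \<open>\<bar>\<beta> - \<beta>\<^sub>0\<bar> \<le>
  h\<close> whenever \<open>h\<close> tends to 0. In other words the family behaves like the normal laws with
  mean \<open>\<beta> * V\<close> and variance \<open>V\<close>, and two parameters can be told apart exactly
  when their distance is large compared with \<open>1 / sqrt V\<close>, that is with \<open>sqrt
  \<theta>\<close>.

  Proof of the expansion. Writing each edge factor as \<open>exp (b * s) = cosh b * (1 + s * tanh b)\<close>
  for \<open>s = 1\<close> or \<open>s = -1\<close> splits \<open>ln Z\<close> into an explicit function of
  the numbers of loops and edges and the logarithm of a sum over the even subgraphs of the graph
  (\<open>partition_function_expansion\<close>). The explicit part is expanded by Taylor's formula; its error
  is of order \<open>h / (N\<^sup>2 * \<theta>\<^sup>3)\<close>, which is small because \<open>N powr (2 / 3)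
  * \<theta>\<close> is bounded below. The sum over even subgraphs is at least 1 and increases with
  \<open>\<beta>\<close>, so all increments of its logarithm inside the window are at most the increment of
  the sum itself between \<open>\<beta>\<^sub>0 - h\<close> and \<open>\<beta>\<^sub>0 + h\<close>. Hence it
  is enough to know its expectation over the random graph. By independence the expectation is the same sum for
  the complete graph with edge weights \<open>\<beta> * W (i / N) (j / N) / N\<close> at most.

  That deterministic sum is Lipschitz in \<open>\<beta>\<close>, uniformly in \<open>N\<close>, at every
  temperature above the critical one (\<open>high_temperature_bound\<close>). Its logarithmic derivative is at
  most half the trace of the weight matrix times the matrix \<open>C\<close> of pair correlations; a vertex of
  odd degree has at least one edge, which gives \<open>C \<le> w * C\<close> off the diagonal for the weight
  matrix \<open>w\<close>, and since the norm of \<open>w\<close> is less than 1 this bounds the Frobenius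
  norm of \<open>C - 1\<close>. The norm of the weight matrix is compared with the operator norm of
  \<open>W\<close> by \<open>graphon_matrix_norm\<close>, where Riemann integrability is used.

  The risks. For small \<open>\<delta>\<close> the chi-square divergence between
  \<open>\<beta>\<^sub>0\<close> and \<open>\<beta>\<^sub>0 + \<delta>\<close> is \<open>exp (\<delta>\<^sup>2
  * V + o(1)) - 1\<close>, so no test beats guessing (\<open>min_risk_tendsto_one\<close>). For large
  \<open>\<delta>\<close> the expansion gives the moment generating function of the standardised Hamiltonian
  under \<open>\<beta>\<^sub>0\<close>, which converges to that of the normal law; hence the level is
  \<open>\<alpha>\<close> in the limit. The same ratios of partition functions, used in an exponential Markov
  inequality, bound the error of the second kind at \<open>\<beta>\<^sub>0 + \<delta>\<close> and
  \<open>\<beta>\<^sub>0 - \<delta>\<close>, and convexity of the exponential function extends the bound to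
  all alternatives (\<open>ising_tilted_tail\<close>).
\<close>

section \<open>Even subgraphs and spin correlations\<close>

definition spin_average :: "nat \<Rightarrow> ((nat \<Rightarrow> real) \<Rightarrow> real) \<Rightarrow> real" where
  "spin_average N f = (1 / 2 ^ N) * (\<Sum>\<sigma>\<in>spins N. f \<sigma>)"

text \<open>
  The exponents are natural numbers instead of a vertex set, so that multiplying by an edge is addition; only
  their parities matter for the value on spins.
\<close>

definition spin_monomial :: "nat \<Rightarrow> (nat \<Rightarrow> nat) \<Rightarrow> (nat \<Rightarrow> real) \<Rightarrow> real" where
  "spin_monomial N m \<sigma> = (\<Prod>k=1..N. \<sigma> k ^ m k)"

definition edge_exponent :: "nat \<times> nat \<Rightarrow> nat \<Rightarrow> nat" where
  "edge_exponent e k = of_bool (k = fst e) + of_bool (k = snd e)"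

definition edges :: "nat \<Rightarrow> (nat \<times> nat) set" where
  "edges N = {(i, j). 1 \<le> i \<and> i < j \<and> j \<le> N}"

text \<open>
  Expanding the product, this is the sum of the edge weights \<open>\<Prod>e\<in>F. a e\<close> over the
  subgraphs \<open>F\<close> of \<open>E\<close> in which the vertices of odd degree are those with an odd
  exponent in \<open>m\<close>. For \<open>m = 0\<close> these are the even subgraphs; the ratio of the sums
  with \<open>m = edge_exponent (i, j)\<close> and \<open>m = 0\<close> is the correlation of the spins at
  \<open>i\<close> and \<open>j\<close>.
\<close>

definition graph_sum :: "nat \<Rightarrow> (nat \<times> nat) set \<Rightarrow> (nat \<times> nat \<Rightarrow> real) \<Rightarrow> (nat \<Rightarrow> nat) \<Rightarrow> real" where
  "graph_sum N E a m =
     spin_average N (\<lambda>\<sigma>. spin_monomial N m \<sigma> * (\<Prod>e\<in>E. 1 + a e * (\<sigma> (fst e) * \<sigma> (snd e))))"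

lemma finite_spins: "finite (spins N)"
  unfolding spins_def by (intro finite_PiE) auto

lemma card_spins: "card (spins N) = 2 ^ N"
proof -
  have "card {-1, 1 :: real} = 2" by simp
  then show ?thesis
    unfolding spins_def by (subst card_PiE) (simp_all only: prod_constant card_atLeastAtMost finite_atLeastAtMost, simp)
qed

lemma spin_cases:
  assumes "\<sigma> \<in> spins N" "k \<in> {1..N}"
  shows "\<sigma> k = -1 \<or> \<sigma> k = 1"
  using PiE_mem[OF assms[unfolded spins_def]] by simp

lemma spin_power_cong:
  "\<sigma> \<in> spins N \<Longrightarrow> k \<in> {1..N} \<Longrightarrow> even p = even q \<Longrightarrow> \<sigma> k ^ p = \<sigma> k ^ q"
  using spin_cases[of \<sigma> N k] by (auto simp: minus_one_power_iff)

lemma edges_subset: "edges N \<subseteq> {1..N} \<times> {1..N}"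
  by (auto simp: edges_def)

lemma finite_edges: "finite (edges N)"
  using edges_subset by (rule finite_subset) auto

lemma spin_average_monomial:
  "spin_average N (spin_monomial N m) = (\<Prod>k=1..N. of_bool (even (m k)))"
proof -
  have "(\<Sum>\<sigma>\<in>spins N. spin_monomial N m \<sigma>) = (\<Prod>k=1..N. \<Sum>s\<in>{-1,1::real}. s ^ m k)"
    unfolding spins_def spin_monomial_def by (subst prod_sum_PiE) auto
  also have "\<dots> = (\<Prod>k=1..N. 2 * of_bool (even (m k)))"
    by (intro prod.cong) (auto simp: minus_one_power_iff)
  also have "\<dots> = 2 ^ N * (\<Prod>k=1..N. of_bool (even (m k)))"
    by (subst prod.distrib) simp
  finally show ?thesis by (simp add: spin_average_def)
qed

lemma spin_monomial_edge:
  assumes "fst e \<in> {1..N}" "snd e \<in> {1..N}"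
  shows "spin_monomial N (\<lambda>k. m k + edge_exponent e k) \<sigma>
    = spin_monomial N m \<sigma> * (\<sigma> (fst e) * \<sigma> (snd e))"
proof -
  have *: "(\<Prod>k=1..N. \<sigma> k ^ of_bool (k = i)) = \<sigma> i" if "i \<in> {1..N}" for i
  proof -
    have "(\<Prod>k=1..N. \<sigma> k ^ of_bool (k = i)) = (\<Prod>k=1..N. if k = i then \<sigma> k else 1)"
      by (intro prod.cong) auto
    then show ?thesis using that by (simp add: prod.delta)
  qed
  show ?thesis
    using *[OF assms(1)] *[OF assms(2)]
    by (simp add: spin_monomial_def edge_exponent_def power_add prod.distrib mult_ac)
qed

lemma graph_sum_empty: "graph_sum N {} a m = (\<Prod>k=1..N. of_bool (even (m k)))"
  by (simp add: graph_sum_def spin_average_monomial)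

lemma graph_sum_insert:
  assumes "finite E" "e \<notin> E" "fst e \<in> {1..N}" "snd e \<in> {1..N}"
  shows "graph_sum N (insert e E) a m =
    graph_sum N E a m + a e * graph_sum N E a (\<lambda>k. m k + edge_exponent e k)"
  using assms
  by (simp add: graph_sum_def spin_average_def spin_monomial_edge sum_distrib_left
      sum.distrib[symmetric] algebra_simps)

text \<open>
  Averages of monomials are 0 or 1, so all coefficients in the expansion over subgraphs are nonnegative. All
  later inequalities rest on this.
\<close>

lemma graph_sum_nonneg:
  assumes "finite E" "E \<subseteq> {1..N} \<times> {1..N}" "\<And>e. e \<in> E \<Longrightarrow> 0 \<le> a e"
  shows "0 \<le> graph_sum N E a m"
  using assms
proof (induction E arbitrary: m rule: finite_induct)
  case empty
  then show ?case by (auto simp: graph_sum_empty intro!: prod_nonneg)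
next
  case (insert e E)
  then show ?case by (subst graph_sum_insert) auto
qed

lemma graph_sum_ge_one:
  assumes "finite E" "E \<subseteq> {1..N} \<times> {1..N}" "\<And>e. e \<in> E \<Longrightarrow> 0 \<le> a e"
  shows "1 \<le> graph_sum N E a (\<lambda>k. 0)"
  using assms
proof (induction E rule: finite_induct)
  case empty
  then show ?case by (simp add: graph_sum_empty)
next
  case (insert e E)
  have "0 \<le> a e * graph_sum N E a (\<lambda>k. 0 + edge_exponent e k)"
    using insert by (intro mult_nonneg_nonneg graph_sum_nonneg) auto
  then show ?case using insert by (subst graph_sum_insert) auto
qed

lemma graph_sum_insert_ge:
  assumes "finite E" "insert e E \<subseteq> {1..N} \<times> {1..N}" "\<And>f. f \<in> insert e E \<Longrightarrow> 0 \<le> a f"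
  shows "graph_sum N E a m \<le> graph_sum N (insert e E) a m"
proof (cases "e \<in> E")
  case False
  have "0 \<le> a e * graph_sum N E a (\<lambda>k. m k + edge_exponent e k)"
    using assms by (intro mult_nonneg_nonneg graph_sum_nonneg) auto
  then show ?thesis using assms False by (subst graph_sum_insert) auto
qed (simp add: insert_absorb)

lemma graph_sum_mono:
  assumes "finite E" "E \<subseteq> {1..N} \<times> {1..N}" "\<And>e. e \<in> E \<Longrightarrow> 0 \<le> a e"
    "\<And>e. e \<in> E \<Longrightarrow> a e \<le> b e"
  shows "graph_sum N E a m \<le> graph_sum N E b m"
  using assms
proof (induction E arbitrary: m rule: finite_induct)
  case empty
  then show ?case by (simp add: graph_sum_empty)
next
  case (insert e E)
  have b0: "0 \<le> b f" if "f \<in> insert e E" for f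
    using insert.prems(2,3)[OF that] by simp
  have "0 \<le> graph_sum N E b m" for m
    using insert.prems insert.hyps b0 by (intro graph_sum_nonneg) auto
  then have "graph_sum N E a m + a e * graph_sum N E a (\<lambda>k. m k + edge_exponent e k)
    \<le> graph_sum N E b m + b e * graph_sum N E b (\<lambda>k. m k + edge_exponent e k)"
    using insert.prems by (intro add_mono mult_mono' insert.IH) (auto intro!: graph_sum_nonneg insert.hyps)
  then show ?case using insert.prems insert.hyps by (simp add: graph_sum_insert mem_Times_iff)
qed

lemma graph_sum_parity:
  assumes "\<And>k. k \<in> {1..N} \<Longrightarrow> even (m k) = even (m' k)"
  shows "graph_sum N E a m = graph_sum N E a m'"
proof -
  have "spin_monomial N m \<sigma> = spin_monomial N m' \<sigma>" if "\<sigma> \<in> spins N" for \<sigma>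
    unfolding spin_monomial_def using that assms by (intro prod.cong spin_power_cong) auto
  then show ?thesis by (simp add: graph_sum_def spin_average_def)
qed

text \<open>
  A discrete derivative: each edge weight contributes its increase times the sum in which that edge is forced,
  and forcing an edge without forbidding its second use only adds nonnegative terms.
\<close>

lemma graph_sum_increment:
  assumes "finite E" "E \<subseteq> {1..N} \<times> {1..N}" "\<And>e. e \<in> E \<Longrightarrow> 0 \<le> a e"
    "\<And>e. e \<in> E \<Longrightarrow> a e \<le> b e"
  shows "graph_sum N E b m - graph_sum N E a m
    \<le> (\<Sum>e\<in>E. (b e - a e) * graph_sum N E b (\<lambda>k. m k + edge_exponent e k))"
  using assms
proof (induction E arbitrary: m rule: finite_induct)
  case empty
  then show ?case by (simp add: graph_sum_empty)
next
  case (insert e E)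
  let ?p = "\<lambda>e k. m k + edge_exponent e k"
  have b0: "0 \<le> b f" if "f \<in> insert e E" for f
    using insert.prems(2,3)[OF that] by simp
  have nn: "0 \<le> graph_sum N E b m" for m
    using insert b0 by (intro graph_sum_nonneg) auto
  have IH: "graph_sum N E b m - graph_sum N E a m
    \<le> (\<Sum>f\<in>E. (b f - a f) * graph_sum N E b (\<lambda>k. m k + edge_exponent f k))" for m
    using insert by auto
  have "graph_sum N (insert e E) b m - graph_sum N (insert e E) a m =
     (graph_sum N E b m - graph_sum N E a m) + (b e - a e) * graph_sum N E b (?p e)
      + a e * (graph_sum N E b (?p e) - graph_sum N E a (?p e))"
    using insert.prems insert.hyps by (simp add: graph_sum_insert mem_Times_iff algebra_simps)
  also have "\<dots> \<le> (\<Sum>f\<in>E. (b f - a f) * graph_sum N E b (?p f)) + (b e - a e) * graph_sum N E b (?p e)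
      + a e * (\<Sum>f\<in>E. (b f - a f) * graph_sum N E b (\<lambda>k. ?p e k + edge_exponent f k))"
    using insert.prems by (intro add_mono mult_left_mono IH order_refl) auto
  also have "\<dots> = (\<Sum>f\<in>E. (b f - a f) * (graph_sum N E b (?p f)
        + a e * graph_sum N E b (\<lambda>k. ?p f k + edge_exponent e k))) + (b e - a e) * graph_sum N E b (?p e)"
    by (simp add: sum_distrib_left sum.distrib[symmetric] algebra_simps)
  also have "\<dots> \<le> (\<Sum>f\<in>E. (b f - a f) * graph_sum N (insert e E) b (?p f))
      + (b e - a e) * graph_sum N (insert e E) b (?p e)"
  proof (intro add_mono sum_mono mult_left_mono)
    fix f assume "f \<in> E"
    show "graph_sum N E b (?p f) + a e * graph_sum N E b (\<lambda>k. ?p f k + edge_exponent e k)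
       \<le> graph_sum N (insert e E) b (?p f)"
      using insert.prems insert.hyps nn[of "\<lambda>k. ?p f k + edge_exponent e k"]
      by (subst graph_sum_insert) (auto intro!: mult_right_mono)
    show "0 \<le> b f - a f" using insert.prems(3)[of f] \<open>f \<in> E\<close> by simp
  next
    show "graph_sum N E b (?p e) \<le> graph_sum N (insert e E) b (?p e)"
      using insert.prems insert.hyps b0 by (intro graph_sum_insert_ge) auto
    show "0 \<le> b e - a e" using insert.prems(3)[of e] by simp
  qed
  also have "\<dots> = (\<Sum>f\<in>insert e E. (b f - a f) * graph_sum N (insert e E) b (?p f))"
    using insert.hyps by simp
  finally show ?case .
qed

lemma graph_sum_odd_isolated:
  assumes "finite E" "E \<subseteq> {1..N} \<times> {1..N}" "i \<in> {1..N}" "odd (m i)"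
    "\<And>e. e \<in> E \<Longrightarrow> i \<noteq> fst e \<and> i \<noteq> snd e"
  shows "graph_sum N E a m = 0"
  using assms
proof (induction E arbitrary: m rule: finite_induct)
  case empty
  then have "\<exists>k\<in>{1..N}. \<not> even (m k)" by blast
  then show ?case by (simp add: graph_sum_empty)
next
  case (insert e E)
  have i: "i \<noteq> fst e" "i \<noteq> snd e" using insert.prems(4)[of e] by auto
  have E: "E \<subseteq> {1..N} \<times> {1..N}" "fst e \<in> {1..N}" "snd e \<in> {1..N}"
    using insert.prems(1) by auto
  have iso: "i \<noteq> fst f \<and> i \<noteq> snd f" if "f \<in> E" for f
    using insert.prems(4)[of f] that by simp
  have "odd (m i + edge_exponent e i)"
    using i insert.prems(3) by (simp add: edge_exponent_def)
  then have "graph_sum N E a (\<lambda>k. m k + edge_exponent e k) = 0"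
    using insert.IH[of "\<lambda>k. m k + edge_exponent e k"] E(1) insert.prems(2) iso by blast
  moreover have "graph_sum N E a m = 0"
    using insert.IH[of m] E(1) insert.prems(2,3) iso by blast
  ultimately show ?case
    unfolding graph_sum_insert[OF insert.hyps(1,2) E(2,3)] by simp
qed

text \<open>
  A vertex of odd degree has at least one edge in the subgraph. Removing one such edge \<open>e\<close> from
  the subgraph, and allowing it to be used again, leaves a subgraph counted by the sum with exponent \<open>m
  + edge_exponent e\<close>; summing over the possible edges counts every subgraph at least once. The set
  \<open>E\<close> holds the edges away from \<open>i\<close>.
\<close>

lemma graph_sum_odd_degree:
  assumes "finite F" "finite E" "F \<inter> E = {}" "F \<union> E \<subseteq> {1..N} \<times> {1..N}"
    "\<And>e. e \<in> F \<union> E \<Longrightarrow> 0 \<le> a e"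
    "i \<in> {1..N}" "odd (m i)" "\<And>e. e \<in> E \<Longrightarrow> i \<noteq> fst e \<and> i \<noteq> snd e"
  shows "graph_sum N (F \<union> E) a m
    \<le> (\<Sum>e\<in>F. a e * graph_sum N (F \<union> E) a (\<lambda>k. m k + edge_exponent e k))"
  using assms
proof (induction F rule: finite_induct)
  case empty
  then show ?case by (simp add: graph_sum_odd_isolated[where i = i])
next
  case (insert e F)
  let ?p = "\<lambda>e k. m k + edge_exponent e k"
  have mono: "graph_sum N (F \<union> E) a m \<le> graph_sum N (insert e (F \<union> E)) a m" for m
    using insert.prems insert.hyps by (intro graph_sum_insert_ge) auto
  have "graph_sum N (insert e F \<union> E) a m = graph_sum N (F \<union> E) a m + a e * graph_sum N (F \<union> E) a (?p e)"
    using insert.prems insert.hyps by (subst Un_insert_left, subst graph_sum_insert) auto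
  also have "\<dots> \<le> (\<Sum>f\<in>F. a f * graph_sum N (F \<union> E) a (?p f)) + a e * graph_sum N (F \<union> E) a (?p e)"
    using insert.prems insert.hyps by (intro add_right_mono insert.IH) auto
  also have "\<dots> = (\<Sum>f\<in>insert e F. a f * graph_sum N (F \<union> E) a (?p f))"
    using insert.hyps by simp
  also have "\<dots> \<le> (\<Sum>f\<in>insert e F. a f * graph_sum N (insert e (F \<union> E)) a (?p f))"
    using insert.prems by (intro sum_mono mult_left_mono mono) auto
  finally show ?case by simp
qed

text \<open>
  A correlation inequality of Simon's type, before division by the even subgraph sum. The edges at
  \<open>i\<close> are the pairs of \<open>i\<close> with another vertex \<open>k\<close>, and after removal
  of such an edge the odd vertices are \<open>k\<close> and \<open>j\<close>; for \<open>k = j\<close> none is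
  left.
\<close>

lemma pair_correlation_ineq:
  fixes a :: "nat \<Rightarrow> nat \<Rightarrow> real" and N :: nat
  defines "C \<equiv> \<lambda>i j. graph_sum N (edges N) (\<lambda>(i, j). a i j) (edge_exponent (i, j))"
  assumes sym: "\<And>i j. a i j = a j i" and nn: "\<And>i j. 0 \<le> a i j"
    and ij: "i \<in> {1..N}" "j \<in> {1..N}" "i \<noteq> j"
  shows "C i j \<le> (\<Sum>k=1..N. a i k * C k j)"
proof -
  let ?a = "\<lambda>(i, j). a i j"
  define F where "F = {e \<in> edges N. i = fst e \<or> i = snd e}"
  define E where "E = edges N - F"
  define g where "g = (\<lambda>k. (min i k, max i k))"
  have FE: "F \<union> E = edges N" by (auto simp: F_def E_def)
  have F: "F = g ` ({1..N} - {i})"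
  proof (intro equalityI subsetI)
    fix e assume e: "e \<in> F"
    define k where "k = (if i = fst e then snd e else fst e)"
    have "e = g k" "k \<in> {1..N} - {i}"
      using e by (auto simp: F_def edges_def k_def g_def min_def max_def)
    then show "e \<in> g ` ({1..N} - {i})" by blast
  next
    fix e assume "e \<in> g ` ({1..N} - {i})"
    then obtain k where "k \<in> {1..N}" "k \<noteq> i" "e = g k" by blast
    then show "e \<in> F" using ij(1) by (cases "k < i") (auto simp: F_def g_def edges_def)
  qed
  have inj: "inj_on g ({1..N} - {i})"
    by (auto simp: inj_on_def g_def min_def max_def split: if_splits)
  have fin: "finite F" "finite E" using finite_edges[of N] FE by (auto simp: F_def E_def)
  have nn': "0 \<le> ?a e" for e using nn by (cases e) auto
  have "C i j \<le> (\<Sum>e\<in>F. ?a e * graph_sum N (edges N) ?a (\<lambda>k. edge_exponent (i, j) k + edge_exponent e k))"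
  proof -
    have "graph_sum N (F \<union> E) ?a (edge_exponent (i, j))
      \<le> (\<Sum>e\<in>F. ?a e * graph_sum N (F \<union> E) ?a (\<lambda>k. edge_exponent (i, j) k + edge_exponent e k))"
    proof (rule graph_sum_odd_degree[where i = i])
      show "F \<inter> E = {}" by (auto simp: E_def)
      show "F \<union> E \<subseteq> {1..N} \<times> {1..N}" unfolding FE by (rule edges_subset)
      show "odd (edge_exponent (i, j) i)" using ij by (simp add: edge_exponent_def)
      show "i \<noteq> fst e \<and> i \<noteq> snd e" if "e \<in> E" for e using that by (auto simp: E_def F_def)
    qed (use fin ij nn' in auto)
    then show ?thesis by (simp only: FE C_def)
  qed
  also have "\<dots> = (\<Sum>k\<in>{1..N} - {i}. ?a (g k) *
      graph_sum N (edges N) ?a (\<lambda>l. edge_exponent (i, j) l + edge_exponent (g k) l))"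
    unfolding F by (subst sum.reindex[OF inj]) simp
  also have "\<dots> = (\<Sum>k\<in>{1..N} - {i}. a i k * C k j)"
  proof (intro sum.cong refl)
    fix k assume "k \<in> {1..N} - {i}"
    have "?a (g k) = a i k" by (auto simp: g_def min_def max_def intro: sym)
    moreover have "graph_sum N (edges N) ?a (\<lambda>l. edge_exponent (i, j) l + edge_exponent (g k) l) = C k j"
      unfolding C_def
      by (intro graph_sum_parity) (auto simp: edge_exponent_def g_def min_def max_def)
    ultimately show "?a (g k) * graph_sum N (edges N) ?a (\<lambda>l. edge_exponent (i, j) l + edge_exponent (g k) l)
      = a i k * C k j" by simp
  qed
  also have "\<dots> \<le> (\<Sum>k=1..N. a i k * C k j)"
    unfolding C_def using nn nn' finite_edges edges_subset
    by (intro sum_mono2 mult_nonneg_nonneg graph_sum_nonneg) auto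
  finally show ?thesis .
qed

text \<open>
  Let \<open>U\<close> be \<open>C\<close> with its diagonal removed. The correlation inequality reads
  \<open>0 \<le> U \<le> a * U + Z * a\<close> entrywise, so the Frobenius norms satisfy \<open>norm U \<le> r
  * norm U + Z * norm a\<close>, where \<open>r < 1\<close> bounds the operator norm of \<open>a\<close>. The
  Frobenius norm is chosen because it controls the trace of a product by the Cauchy--Schwarz inequality.
\<close>

lemma pair_correlation_bound:
  fixes a :: "nat \<Rightarrow> nat \<Rightarrow> real" and N :: nat
  defines "Z \<equiv> graph_sum N (edges N) (\<lambda>(i, j). a i j) (\<lambda>k. 0)"
    and "C \<equiv> \<lambda>i j. graph_sum N (edges N) (\<lambda>(i, j). a i j) (edge_exponent (i, j))"
  assumes sym: "\<And>i j. a i j = a j i" and nn: "\<And>i j. 0 \<le> a i j"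
    and r: "0 \<le> r" "r < 1"
    and op: "\<And>v. (\<Sum>i=1..N. (\<Sum>k=1..N. a i k * v k)\<^sup>2) \<le> r\<^sup>2 * (\<Sum>k=1..N. (v k)\<^sup>2)"
  shows "(\<Sum>e\<in>edges N. b e * C (fst e) (snd e))
    \<le> L2_set b (edges N) * (Z * L2_set (\<lambda>(i, j). a i j) ({1..N} \<times> {1..N}) / (1 - r))"
proof -
  let ?I = "{1..N}" and ?a = "\<lambda>(i, j). a i j"
  have nn': "0 \<le> ?a e" for e using nn by (cases e) auto
  have C0: "0 \<le> C i j" for i j unfolding C_def
    using nn' finite_edges edges_subset by (intro graph_sum_nonneg) auto
  have Z1: "1 \<le> Z" unfolding Z_def
    using nn' finite_edges edges_subset by (intro graph_sum_ge_one) auto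
  have diag: "C j j = Z" for j
    unfolding C_def Z_def by (intro graph_sum_parity) (auto simp: edge_exponent_def)
  \<comment> \<open>Edges join different vertices, so the diagonal of \<open>C\<close>, which is large, can be discarded.\<close>
  define U where "U = (\<lambda>i j. if i = j then 0 else C i j)"
  have U0: "0 \<le> U i j" for i j by (simp add: U_def C0)
  have U: "U i j \<le> (\<Sum>k=1..N. a i k * U k j) + Z * a i j" if "i \<in> ?I" "j \<in> ?I" for i j
  proof (cases "i = j")
    case True
    then show ?thesis using U0 nn Z1 by (auto simp: U_def intro!: add_nonneg_nonneg sum_nonneg C0)
  next
    case False
    have "U i j \<le> (\<Sum>k=1..N. a i k * C k j)"
      using pair_correlation_ineq[of a i N j] sym nn that False by (simp add: U_def C_def)
    also have "\<dots> = (\<Sum>k=1..N. a i k * U k j + (if k = j then a i j * Z else 0))"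
      by (intro sum.cong) (auto simp: U_def diag)
    also have "\<dots> = (\<Sum>k=1..N. a i k * U k j) + Z * a i j"
      using that by (simp add: sum.distrib)
    finally show ?thesis .
  qed
  let ?U = "\<lambda>(i, j). U i j" and ?aU = "\<lambda>(i, j). \<Sum>k=1..N. a i k * U k j"
  have aU: "L2_set ?aU (?I \<times> ?I) \<le> r * L2_set ?U (?I \<times> ?I)"
  proof -
    have "(\<Sum>p\<in>?I \<times> ?I. (?aU p)\<^sup>2) = (\<Sum>j\<in>?I. \<Sum>i\<in>?I. (\<Sum>k=1..N. a i k * U k j)\<^sup>2)"
      by (subst sum.swap, subst sum.cartesian_product) (auto intro: sum.cong)
    also have "\<dots> \<le> (\<Sum>j\<in>?I. r\<^sup>2 * (\<Sum>k\<in>?I. (U k j)\<^sup>2))"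
      by (intro sum_mono op)
    also have "\<dots> = r\<^sup>2 * (\<Sum>p\<in>?I \<times> ?I. (?U p)\<^sup>2)"
      unfolding sum_distrib_left[symmetric]
      by (subst sum.swap, subst sum.cartesian_product) (auto intro: sum.cong)
    finally have "L2_set ?aU (?I \<times> ?I) \<le> sqrt (r\<^sup>2 * (\<Sum>p\<in>?I \<times> ?I. (?U p)\<^sup>2))"
      by (simp add: L2_set_def)
    then show ?thesis using r by (simp add: L2_set_def real_sqrt_mult)
  qed
  have "L2_set ?U (?I \<times> ?I) \<le> L2_set (\<lambda>p. ?aU p + Z * ?a p) (?I \<times> ?I)"
    using U U0 by (intro L2_set_mono) auto
  also have "\<dots> \<le> L2_set ?aU (?I \<times> ?I) + L2_set (\<lambda>p. Z * ?a p) (?I \<times> ?I)"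
    by (rule L2_set_triangle_ineq)
  also have "L2_set (\<lambda>p. Z * ?a p) (?I \<times> ?I) = Z * L2_set ?a (?I \<times> ?I)"
    using Z1 by (subst L2_set_right_distrib) auto
  finally have "(1 - r) * L2_set ?U (?I \<times> ?I) \<le> Z * L2_set ?a (?I \<times> ?I)"
    using aU by (simp add: algebra_simps)
  then have Ub: "L2_set ?U (?I \<times> ?I) \<le> Z * L2_set ?a (?I \<times> ?I) / (1 - r)"
    using r by (simp add: pos_le_divide_eq mult.commute)
  have "(\<Sum>e\<in>edges N. b e * C (fst e) (snd e)) = (\<Sum>e\<in>edges N. b e * ?U e)"
    by (intro sum.cong) (auto simp: U_def edges_def)
  also have "\<dots> \<le> (\<Sum>e\<in>edges N. \<bar>b e\<bar> * \<bar>?U e\<bar>)"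
    by (intro sum_mono) (metis abs_ge_self abs_mult)
  also have "\<dots> \<le> L2_set b (edges N) * L2_set ?U (edges N)"
    by (rule L2_set_mult_ineq)
  also have "\<dots> \<le> L2_set b (edges N) * L2_set ?U (?I \<times> ?I)"
    using edges_subset[of N] unfolding L2_set_def
    by (intro mult_left_mono real_sqrt_le_mono sum_mono2) (auto intro!: sum_nonneg)
  also have "\<dots> \<le> L2_set b (edges N) * (Z * L2_set ?a (?I \<times> ?I) / (1 - r))"
    by (intro mult_left_mono Ub L2_set_nonneg)
  finally show ?thesis .
qed

text \<open>
  The two previous estimates combined: the logarithmic derivative of the even subgraph sum is bounded by a
  constant depending only on the distance from the critical point.
\<close>

lemma high_temperature_increment:
  fixes w :: "nat \<Rightarrow> nat \<Rightarrow> real" and N :: nat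
  defines "Z \<equiv> \<lambda>x. graph_sum N (edges N) (\<lambda>(i, j). x * w i j) (\<lambda>k. 0)"
  assumes sym: "\<And>i j. w i j = w j i" and nn: "\<And>i j. 0 \<le> w i j"
    and w1: "(\<Sum>i=1..N. \<Sum>j=1..N. (w i j)\<^sup>2) \<le> 1"
    and op: "\<And>v. (\<Sum>i=1..N. (\<Sum>k=1..N. w i k * v k)\<^sup>2) \<le> \<rho>\<^sup>2 * (\<Sum>k=1..N. (v k)\<^sup>2)"
    and \<rho>: "0 \<le> \<rho>" and x: "0 \<le> x" "x \<le> y" "y \<le> b" "b * \<rho> < 1"
  shows "Z y - Z x \<le> (y - x) * (b / (1 - b * \<rho>)) * Z y"
proof -
  let ?I = "{1..N}" and ?w = "\<lambda>(i, j). w i j"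
  have "Z y - Z x \<le> (\<Sum>e\<in>edges N. ((\<lambda>(i, j). y * w i j) e - (\<lambda>(i, j). x * w i j) e) *
      graph_sum N (edges N) (\<lambda>(i, j). y * w i j) (\<lambda>k. 0 + edge_exponent e k))"
    unfolding Z_def using finite_edges edges_subset nn x
    by (intro graph_sum_increment) (auto intro!: mult_nonneg_nonneg mult_right_mono)
  also have "\<dots> = (y - x) * (\<Sum>e\<in>edges N. ?w e *
      graph_sum N (edges N) (\<lambda>(i, j). y * w i j) (edge_exponent (fst e, snd e)))"
    unfolding sum_distrib_left by (intro sum.cong) (auto simp: algebra_simps)
  also have "\<dots> \<le> (y - x) * (L2_set ?w (edges N) *
      (Z y * L2_set (\<lambda>(i, j). y * w i j) (?I \<times> ?I) / (1 - y * \<rho>)))"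
    unfolding Z_def
  proof (intro mult_left_mono pair_correlation_bound)
    show "y * w i j = y * w j i" for i j by (simp add: sym)
    show "0 \<le> y * w i j" for i j using nn x by simp
    show "0 \<le> y * \<rho>" using x \<rho> by simp
    have "y * \<rho> \<le> b * \<rho>" using x \<rho> by (intro mult_right_mono)
    then show "y * \<rho> < 1" using x by simp
    fix v
    have "(\<Sum>i=1..N. (\<Sum>k=1..N. y * w i k * v k)\<^sup>2) = y\<^sup>2 * (\<Sum>i=1..N. (\<Sum>k=1..N. w i k * v k)\<^sup>2)"
      by (simp add: sum_distrib_left[symmetric] mult.assoc power_mult_distrib)
    also have "\<dots> \<le> y\<^sup>2 * (\<rho>\<^sup>2 * (\<Sum>k=1..N. (v k)\<^sup>2))" by (intro mult_left_mono op) auto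
    finally show "(\<Sum>i=1..N. (\<Sum>k=1..N. y * w i k * v k)\<^sup>2) \<le> (y * \<rho>)\<^sup>2 * (\<Sum>k=1..N. (v k)\<^sup>2)"
      by (simp add: power_mult_distrib mult.assoc)
    show "0 \<le> y - x" using x by simp
  qed
  also have "\<dots> \<le> (y - x) * (1 * (Z y * y / (1 - b * \<rho>)))"
  proof -
    have full: "L2_set ?w (?I \<times> ?I) \<le> 1"
      using w1 by (simp add: L2_set_def sum.cartesian_product case_prod_unfold)
    have part: "L2_set ?w (edges N) \<le> L2_set ?w (?I \<times> ?I)"
      using edges_subset[of N] unfolding L2_set_def
      by (intro real_sqrt_le_mono sum_mono2) auto
    have "L2_set (\<lambda>(i, j). y * w i j) (?I \<times> ?I) = y * L2_set ?w (?I \<times> ?I)"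
      using x by (subst L2_set_right_distrib) (auto simp: case_prod_unfold)
    also have "\<dots> \<le> y" using full x by (simp add: mult_left_le)
    finally have y: "L2_set (\<lambda>(i, j). y * w i j) (?I \<times> ?I) \<le> y" .
    have "0 \<le> Z y" unfolding Z_def using finite_edges edges_subset nn x
      by (intro graph_sum_nonneg) (auto intro!: mult_nonneg_nonneg)
    moreover have "y * \<rho> \<le> b * \<rho>" using x \<rho> by (intro mult_right_mono)
    ultimately show ?thesis using x y full part
      by (intro mult_left_mono mult_mono frac_le) (auto intro!: mult_nonneg_nonneg divide_nonneg_nonneg)
  qed
  also have "\<dots> \<le> (y - x) * (1 * (Z y * b / (1 - b * \<rho>)))"
  proof -
    have "0 \<le> Z y" unfolding Z_def using finite_edges edges_subset nn x
      by (intro graph_sum_nonneg) (auto intro!: mult_nonneg_nonneg)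
    then show ?thesis using x by (intro mult_left_mono divide_right_mono mult_left_mono) auto
  qed
  finally show ?thesis by (simp add: mult_ac)
qed

text \<open>
  By \<open>high_temperature_increment\<close> a step of length \<open>b / n\<close> at most doubles the sum,
  so at \<open>b\<close> it is at most \<open>2 ^ n\<close>. The number \<open>n\<close> of steps does not
  depend on \<open>N\<close>, which makes the Lipschitz bound uniform.
\<close>

lemma high_temperature_bound:
  fixes w :: "nat \<Rightarrow> nat \<Rightarrow> real" and N :: nat
  defines "Z \<equiv> \<lambda>x. graph_sum N (edges N) (\<lambda>(i, j). x * w i j) (\<lambda>k. 0)"
  assumes sym: "\<And>i j. w i j = w j i" and nn: "\<And>i j. 0 \<le> w i j"
    and w1: "(\<Sum>i=1..N. \<Sum>j=1..N. (w i j)\<^sup>2) \<le> 1"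
    and op: "\<And>v. (\<Sum>i=1..N. (\<Sum>k=1..N. w i k * v k)\<^sup>2) \<le> \<rho>\<^sup>2 * (\<Sum>k=1..N. (v k)\<^sup>2)"
    and \<rho>: "0 \<le> \<rho>" and b: "0 \<le> b" "b * \<rho> < 1"
    and n: "n > 0" "2 * b * (b / (1 - b * \<rho>)) \<le> real n"
    and x: "0 \<le> x" "x \<le> y" "y \<le> b"
  shows "Z y - Z x \<le> (y - x) * ((b / (1 - b * \<rho>)) * 2 ^ n)"
proof -
  define K where "K = b / (1 - b * \<rho>)"
  have K0: "0 \<le> K" using b by (simp add: K_def)
  have inc: "Z y - Z x \<le> (y - x) * K * Z y" if "0 \<le> x" "x \<le> y" "y \<le> b" for x y
    unfolding Z_def K_def using assms that by (intro high_temperature_increment) auto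
  have Z1: "1 \<le> Z x" if "0 \<le> x" for x
    unfolding Z_def using that nn finite_edges edges_subset
    by (intro graph_sum_ge_one) (auto intro!: mult_nonneg_nonneg)
  define h where "h = b / real n"
  have h: "0 \<le> h" "h * real n = b" using n b by (auto simp: h_def)
  have "h * K * 2 \<le> 1" using n b K0 by (simp add: h_def K_def field_simps)
  then have hK: "h * K \<le> 1 / 2" by simp
  have step: "Z (h * real k) \<le> 2 ^ k" if "k \<le> n" for k
    using that
  proof (induction k)
    case 0
    have "Z 0 = 1"
      by (simp add: Z_def graph_sum_def spin_average_def spin_monomial_def card_spins case_prod_unfold)
    then show ?case by simp
  next
    case (Suc k)
    have le: "h * real (Suc k) \<le> b" using Suc.prems h by (metis mult_left_mono of_nat_le_iff)
    have pos: "0 \<le> h * real k" "h * real k \<le> h * real (Suc k)" using h by (auto intro!: mult_left_mono)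
    have "Z (h * real (Suc k)) - Z (h * real k) \<le> (h * K) * Z (h * real (Suc k))"
      using inc[OF pos le] by (simp add: algebra_simps)
    also have "\<dots> \<le> (1 / 2) * Z (h * real (Suc k))"
      using hK Z1[of "h * real (Suc k)"] pos by (intro mult_right_mono) auto
    finally have "Z (h * real (Suc k)) \<le> 2 * Z (h * real k)" by simp
    also have "\<dots> \<le> 2 * 2 ^ k" using Suc by simp
    finally show ?case by simp
  qed
  have mono: "Z y \<le> Z b" if "0 \<le> y" "y \<le> b" for y
    unfolding Z_def using that nn finite_edges edges_subset
    by (intro graph_sum_mono) (auto intro!: mult_nonneg_nonneg mult_right_mono)
  have "Z y \<le> 2 ^ n" using step[of n] h mono[of y] x by simp
  then have "Z y - Z x \<le> (y - x) * K * 2 ^ n"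
    using inc[OF x] x K0 by (intro order_trans[OF inc[OF x]] mult_left_mono) auto
  then show ?thesis by (simp add: K_def mult_ac)
qed

section \<open>The operator norm of a sampled graphon\<close>

text \<open>
  Cells are open on the left, so that they partition the interval without overlaps; the sampling point is the
  right end.
\<close>

definition grid_cell :: "nat \<Rightarrow> nat \<Rightarrow> real set" where
  "grid_cell N i = {(real i - 1) / real N <.. real i / real N}"

abbreviation (input) grid_square :: "nat \<Rightarrow> nat \<Rightarrow> nat \<Rightarrow> (real \<times> real) set" where
  "grid_square N i j \<equiv> grid_cell N i \<times> grid_cell N j"

abbreviation (input) grid_value :: "(real \<Rightarrow> real \<Rightarrow> real) \<Rightarrow> nat \<Rightarrow> nat \<Rightarrow> nat \<Rightarrow> real" where
  "grid_value W N i j \<equiv> W (real i / real N) (real j / real N)"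

lemma grid_cell_index:
  assumes "N > 0" "x \<in> grid_cell N i" shows "int i = \<lceil>x * real N\<rceil>"
  using assms by (intro ceiling_unique[symmetric]) (auto simp: grid_cell_def field_simps)

lemma grid_cell_disjoint:
  assumes "N > 0" shows "disjoint_family_on (grid_cell N) A"
  unfolding disjoint_family_on_def
proof (intro ballI impI)
  fix i j :: nat assume "i \<noteq> j"
  then show "grid_cell N i \<inter> grid_cell N j = {}"
    using grid_cell_index[OF assms, of _ i] grid_cell_index[OF assms, of _ j] by fastforce
qed

lemma UN_grid_cell:
  assumes "N > 0" shows "(\<Union>i\<in>{1..N}. grid_cell N i) = {0<..1}"
proof (intro equalityI subsetI)
  fix x assume "x \<in> (\<Union>i\<in>{1..N}. grid_cell N i)"
  then obtain i where i: "1 \<le> real i" "real i \<le> real N" "x \<in> grid_cell N i" by force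
  have "0 \<le> (real i - 1) / real N" "real i / real N \<le> 1" using i assms by auto
  then show "x \<in> {0<..1}"
    using i(3) unfolding grid_cell_def greaterThanAtMost_iff by linarith
next
  fix x :: real assume x: "x \<in> {0<..1}"
  define i where "i = nat \<lceil>x * real N\<rceil>"
  have pos: "0 < x * real N" "x * real N \<le> real N" using x assms by (auto simp: mult_left_le_one_le)
  have i: "real i = of_int \<lceil>x * real N\<rceil>" using pos by (simp add: i_def)
  have i1: "real i - 1 < x * real N" "x * real N \<le> real i" unfolding i by linarith+
  then have "0 < real i" "real i < real (Suc N)" using pos by auto
  then have "i \<in> {1..N}" unfolding of_nat_less_iff by auto
  moreover have "x \<in> grid_cell N i" using i1 assms by (auto simp: grid_cell_def field_simps)
  ultimately show "x \<in> (\<Union>i\<in>{1..N}. grid_cell N i)" by blast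
qed

lemma grid_cell_sub: "i \<in> {1..N} \<Longrightarrow> grid_cell N i \<subseteq> {0<..1}"
  using UN_grid_cell[of N] by (cases "N = 0") auto

text \<open>
  The closed cells with arbitrary tags form a tagged division whose mesh is at most \<open>2 / N\<close>.
\<close>

lemma riemann_grid_sums:
  fixes f :: "real \<times> real \<Rightarrow> real"
  assumes "riemann_integrable f (0, 0) (1, 1)"
  obtains I where "\<And>e. e > 0 \<Longrightarrow> \<exists>n0. \<forall>N\<ge>n0. \<forall>tag.
     (\<forall>i\<in>{1..N}. \<forall>j\<in>{1..N}. tag i j \<in> grid_square N i j) \<longrightarrow>
     \<bar>(\<Sum>i=1..N. \<Sum>j=1..N. f (tag i j) / (real N)\<^sup>2) - I\<bar> < e"
proof -
  obtain I where I: "\<And>e. e > 0 \<Longrightarrow> \<exists>d>0. \<forall>p. p tagged_division_of cbox (0, 0) (1, 1) \<and> (\<lambda>x. ball x d) fine p \<longrightarrow>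
        \<bar>(\<Sum>(x, k)\<in>p. measure lborel k * f x) - I\<bar> < e"
    using assms unfolding riemann_integrable_def by metis
  have "\<exists>n0. \<forall>N\<ge>n0. \<forall>tag.
     (\<forall>i\<in>{1..N}. \<forall>j\<in>{1..N}. tag i j \<in> grid_square N i j) \<longrightarrow>
     \<bar>(\<Sum>i=1..N. \<Sum>j=1..N. f (tag i j) / (real N)\<^sup>2) - I\<bar> < e" if "e > 0" for e
  proof -
    obtain d where d: "d > 0" and dI: "\<And>p. p tagged_division_of cbox (0, 0) (1, 1) \<Longrightarrow> (\<lambda>x. ball x d) fine p \<Longrightarrow>
        \<bar>(\<Sum>(x, k)\<in>p. measure lborel k * f x) - I\<bar> < e"
      using I[OF \<open>e > 0\<close>] by metis
    obtain n0 :: nat where n0: "2 / d < real n0" using reals_Archimedean2 by blast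
    show ?thesis
    proof (intro exI[of _ n0] allI impI)
      fix N and tag :: "nat \<Rightarrow> nat \<Rightarrow> real \<times> real"
      assume N: "N \<ge> n0" and tag: "\<forall>i\<in>{1..N}. \<forall>j\<in>{1..N}. tag i j \<in> grid_square N i j"
      have "0 < 2 / d" using d by simp
      then have N0: "N > 0" using n0 N by (cases "N = 0") auto
      have Nd: "2 / real N < d"
      proof -
        have "2 / d < real N" using n0 N by linarith
        then show ?thesis using d N0 by (simp add: field_simps)
      qed
      define C where "C = (\<lambda>i. cbox ((real i - 1) / real N) (real i / real N))"
      define P where "P = (\<lambda>(i, j). (tag i j, C i \<times> C j))"
      define p where "p = P ` ({1..N} \<times> {1..N})"
      have CC: "C i \<times> C j = cbox ((real i - 1) / real N, (real j - 1) / real N) (real i / real N, real j / real N)" for i j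
        by (simp add: C_def cbox_Pair_eq)
      have Cinj: "i = i'" if "C i = C i'" for i i'
      proof -
        have "(real i - 1) / real N \<le> real i / real N" for i by (simp add: divide_right_mono)
        then have "real i / real N = real i' / real N"
          using that by (simp add: C_def Icc_eq_Icc)
        then show ?thesis using N0 by simp
      qed
      have Cne: "real i / real N \<in> C i" for i by (simp add: C_def divide_right_mono)
      have Pinj: "inj_on P ({1..N} \<times> {1..N})"
        using Cne by (auto simp: inj_on_def P_def times_eq_iff dest!: Cinj)
      have int: "interior (C i) \<inter> interior (C i') = {}" if "i \<noteq> i'" for i i'
      proof -
        have "interior (C k) \<subseteq> grid_cell N k" for k by (auto simp: C_def grid_cell_def)
        moreover have "grid_cell N i \<inter> grid_cell N i' = {}"
          using that grid_cell_disjoint[OF N0, of UNIV] unfolding disjoint_family_on_def by blast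
        ultimately show ?thesis by blast
      qed
      have tagC: "tag i j \<in> C i \<times> C j" if "i \<in> {1..N}" "j \<in> {1..N}" for i j
        using tag that by (fastforce simp: C_def grid_cell_def)
      have Csub: "C i \<subseteq> {0..1}" if "i \<in> {1..N}" for i
        using that N0 by (auto simp: C_def field_simps)
      have Ccov: "\<exists>i\<in>{1..N}. x \<in> C i" if "x \<in> {0..1}" for x
      proof (cases "x = 0")
        case True
        then show ?thesis using N0 by (intro bexI[of _ 1]) (auto simp: C_def)
      next
        case False
        then have "x \<in> (\<Union>i\<in>{1..N}. grid_cell N i)" using that by (simp only: UN_grid_cell[OF N0]) simp
        then obtain i where "i \<in> {1..N}" "x \<in> grid_cell N i" by blast
        moreover have "grid_cell N i \<subseteq> C i" for i by (auto simp: C_def grid_cell_def)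
        ultimately show ?thesis by blast
      qed
      have div: "p tagged_division_of cbox (0, 0) (1, 1)"
      proof (rule tagged_division_ofI)
        show "finite p" by (simp add: p_def)
        fix x K assume xK: "(x, K) \<in> p"
        then obtain i j where ij: "i \<in> {1..N}" "j \<in> {1..N}" "x = tag i j" "K = C i \<times> C j"
          by (auto simp: p_def P_def)
        show "x \<in> K" using tagC ij by simp
        show "K \<subseteq> cbox (0, 0) (1, 1)" using Csub ij by (auto simp: cbox_Pair_eq)
        show "\<exists>a b. K = cbox a b" using CC ij by blast
        fix x' K' assume xK': "(x', K') \<in> p" "(x, K) \<noteq> (x', K')"
        from xK'(1) obtain i' j' where ij': "i' \<in> {1..N}" "j' \<in> {1..N}" "x' = tag i' j'" "K' = C i' \<times> C j'"
          by (auto simp: p_def P_def)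
        have "i \<noteq> i' \<or> j \<noteq> j'" using xK' ij ij' by auto
        then show "interior K \<inter> interior K' = {}"
          using int by (auto simp: ij(4) ij'(4) interior_Times Times_Int_Times)
      next
        show "\<Union>{K. \<exists>x. (x, K) \<in> p} = cbox (0, 0) (1, 1)"
        proof (intro equalityI subsetI)
          fix z assume "z \<in> \<Union>{K. \<exists>x. (x, K) \<in> p}"
          then show "z \<in> cbox (0, 0) (1, 1)"
            using Csub by (fastforce simp: p_def P_def cbox_Pair_eq)
        next
          fix z :: "real \<times> real" assume "z \<in> cbox (0, 0) (1, 1)"
          then have "fst z \<in> {0..1}" "snd z \<in> {0..1}" by (auto simp: cbox_Pair_eq)
          then obtain i j where "i \<in> {1..N}" "j \<in> {1..N}" "fst z \<in> C i" "snd z \<in> C j"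
            using Ccov by metis
          then have "P (i, j) \<in> p" "z \<in> C i \<times> C j" by (auto simp: p_def mem_Times_iff)
          then have "C i \<times> C j \<in> {K. \<exists>x. (x, K) \<in> p}" unfolding P_def prod.case by blast
          then show "z \<in> \<Union>{K. \<exists>x. (x, K) \<in> p}" using \<open>z \<in> C i \<times> C j\<close> by (rule UnionI)
        qed
      qed
      have "(\<lambda>x. ball x d) fine p"
      proof (rule fineI)
        fix x K assume "(x, K) \<in> p"
        then obtain i j where ij: "i \<in> {1..N}" "j \<in> {1..N}" "x = tag i j" "K = C i \<times> C j"
          by (auto simp: p_def P_def)
        show "K \<subseteq> ball x d"
        proof
          fix z assume "z \<in> K"
          then have z: "fst z \<in> C i" "snd z \<in> C j" using ij by auto
          have x: "fst x \<in> C i" "snd x \<in> C j"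
            using tagC[OF ij(1,2)] unfolding ij(3) mem_Times_iff by blast+
          have D: "\<bar>s - t\<bar> \<le> 1 / real N" if "s \<in> C i" "t \<in> C i" for s t i
            using that by (auto simp: C_def diff_divide_distrib)
          have "dist x z \<le> dist (fst x) (fst z) + dist (snd x) (snd z)"
            by (simp add: dist_prod_def sqrt_sum_squares_le_sum)
          also have "\<dots> \<le> 1 / real N + 1 / real N"
            unfolding dist_real_def using D x z by (intro add_mono) auto
          finally show "z \<in> ball x d" using Nd by simp
        qed
      qed
      from dI[OF div this] have "\<bar>(\<Sum>(x, k)\<in>p. measure lborel k * f x) - I\<bar> < e" .
      moreover have "(\<Sum>(x, k)\<in>p. measure lborel k * f x) = (\<Sum>i=1..N. \<Sum>j=1..N. f (tag i j) / (real N)\<^sup>2)"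
      proof -
        have "measure lborel (C i \<times> C j) = 1 / (real N)\<^sup>2" for i j
          unfolding CC content_Pair by (simp add: diff_divide_distrib[symmetric] power2_eq_square divide_right_mono)
        then show ?thesis
          unfolding p_def by (subst sum.reindex[OF Pinj]) (simp add: P_def sum.cartesian_product case_prod_unfold)
      qed
      ultimately show "\<bar>(\<Sum>i=1..N. \<Sum>j=1..N. f (tag i j) / (real N)\<^sup>2) - I\<bar> < e" by simp
    qed
  qed
  then show thesis by (rule that)
qed

text \<open>
  Compare two Riemann sums, one with the larger and one with the smaller of the two values in each cell: their
  difference is the sum of the absolute differences, and both are close to the integral.
\<close>

lemma riemann_grid_oscillation:
  fixes f :: "real \<times> real \<Rightarrow> real"
  assumes "riemann_integrable f (0, 0) (1, 1)" "e > 0"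
  shows "\<exists>n0. \<forall>N\<ge>n0. \<forall>s t.
     (\<forall>i\<in>{1..N}. \<forall>j\<in>{1..N}. s i j \<in> grid_square N i j \<and> t i j \<in> grid_square N i j) \<longrightarrow>
     (\<Sum>i=1..N. \<Sum>j=1..N. \<bar>f (s i j) - f (t i j)\<bar> / (real N)\<^sup>2) < e"
proof -
  obtain I where I: "\<And>e. e > 0 \<Longrightarrow> \<exists>n0. \<forall>N\<ge>n0. \<forall>tag.
     (\<forall>i\<in>{1..N}. \<forall>j\<in>{1..N}. tag i j \<in> grid_square N i j) \<longrightarrow>
     \<bar>(\<Sum>i=1..N. \<Sum>j=1..N. f (tag i j) / (real N)\<^sup>2) - I\<bar> < e"
    using riemann_grid_sums[OF assms(1)] by blast
  obtain n0 where n0: "\<And>N tag. N \<ge> n0 \<Longrightarrow>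
     (\<forall>i\<in>{1..N}. \<forall>j\<in>{1..N}. tag i j \<in> grid_square N i j) \<Longrightarrow>
     \<bar>(\<Sum>i=1..N. \<Sum>j=1..N. f (tag i j) / (real N)\<^sup>2) - I\<bar> < e / 2"
    using I[of "e / 2"] assms by fastforce
  show ?thesis
  proof (intro exI[of _ n0] allI impI)
    fix N and s t :: "nat \<Rightarrow> nat \<Rightarrow> real \<times> real"
    assume N: "N \<ge> n0" and st: "\<forall>i\<in>{1..N}. \<forall>j\<in>{1..N}. s i j \<in> grid_square N i j \<and> t i j \<in> grid_square N i j"
    define hi where "hi = (\<lambda>i j. if f (s i j) \<ge> f (t i j) then s i j else t i j)"
    define lo where "lo = (\<lambda>i j. if f (s i j) \<ge> f (t i j) then t i j else s i j)"
    have "\<bar>(\<Sum>i=1..N. \<Sum>j=1..N. f (hi i j) / (real N)\<^sup>2) - I\<bar> < e / 2"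
      using st by (intro n0 N) (simp add: hi_def)
    moreover have "\<bar>(\<Sum>i=1..N. \<Sum>j=1..N. f (lo i j) / (real N)\<^sup>2) - I\<bar> < e / 2"
      using st by (intro n0 N) (simp add: lo_def)
    moreover have "(\<Sum>i=1..N. \<Sum>j=1..N. \<bar>f (s i j) - f (t i j)\<bar> / (real N)\<^sup>2) =
       (\<Sum>i=1..N. \<Sum>j=1..N. f (hi i j) / (real N)\<^sup>2) - (\<Sum>i=1..N. \<Sum>j=1..N. f (lo i j) / (real N)\<^sup>2)"
      unfolding sum_subtractf[symmetric]
      by (intro sum.cong refl) (auto simp: hi_def lo_def diff_divide_distrib)
    ultimately show "(\<Sum>i=1..N. \<Sum>j=1..N. \<bar>f (s i j) - f (t i j)\<bar> / (real N)\<^sup>2) < e" by linarith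
  qed
qed

text \<open>
  Lebesgue measurability on the square says nothing about the single sections of a graphon, while the sections
  of a Borel function that agrees with it almost everywhere are Borel. Iterated integrals are taken of that
  function.
\<close>

lemma graphon_borel_version:
  assumes "graphon W"
  obtains B :: "real \<times> real \<Rightarrow> real" where "B \<in> borel_measurable borel"
    "\<And>p. 0 \<le> B p" "\<And>p. B p \<le> 1"
    "AE p in lborel. p \<in> {0..1} \<times> {0..1} \<longrightarrow> B p = W (fst p) (snd p)"
proof -
  let ?S = "{0..1::real} \<times> {0..1::real}"
  have S: "?S \<in> sets lebesgue"
  proof -
    have "?S = cbox (0, 0) (1, 1)" by (simp add: cbox_Pair_eq)
    then show ?thesis by simp
  qed
  have "(\<lambda>p. indicator ?S p *\<^sub>R (case p of (x, y) \<Rightarrow> W x y)) \<in> borel_measurable lebesgue"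
    using assms S by (subst borel_measurable_restrict_space_iff[symmetric]) (auto simp: graphon_def)
  then obtain g where g: "g \<in> borel_measurable lborel"
    "AE p in lborel. indicator ?S p *\<^sub>R (case p of (x, y) \<Rightarrow> W x y) = g p"
    using completion_ex_borel_measurable_real by blast
  define B where "B = (\<lambda>p. max 0 (min 1 (g p)))"
  show thesis
  proof
    have [measurable]: "g \<in> borel_measurable borel" using g by simp
    show "B \<in> borel_measurable borel" unfolding B_def by measurable
    show "0 \<le> B p" "B p \<le> 1" for p by (auto simp: B_def)
    show "AE p in lborel. p \<in> ?S \<longrightarrow> B p = W (fst p) (snd p)"
      using g(2)
    proof eventually_elim
      case (elim p)
      show ?case
      proof
        assume p: "p \<in> ?S"
        then have "g p = W (fst p) (snd p)" using elim by (simp add: case_prod_unfold)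
        then show "B p = W (fst p) (snd p)"
          using p assms by (auto simp: B_def graphon_def mem_Times_iff)
      qed
    qed
  qed
qed

text \<open>
  The Cauchy--Schwarz inequality against the constant 1, from the nonnegativity of the variance.
\<close>

lemma (in finite_measure) square_integral_le:
  fixes g :: "'a \<Rightarrow> real"
  assumes g: "integrable M g" "integrable M (\<lambda>x. (g x)\<^sup>2)"
  shows "(\<integral>x. g x \<partial>M)\<^sup>2 \<le> measure M (space M) * (\<integral>x. (g x)\<^sup>2 \<partial>M)"
proof (cases "measure M (space M) = 0")
  case True
  then have "emeasure M (space M) = 0" by (simp add: emeasure_eq_measure)
  then have "AE x in M. False" by (auto intro!: AE_I[where N = "space M"])
  then have "(\<integral>x. g x \<partial>M) = (\<integral>x. 0 \<partial>M)"
    using g by (intro integral_cong_AE) auto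
  then show ?thesis using True by simp
next
  case False
  let ?m = "measure M (space M)" and ?s = "\<integral>x. g x \<partial>M"
  have m: "?m > 0" using False by (simp add: zero_less_measure_iff)
  have "0 \<le> (\<integral>x. (g x - ?s / ?m)\<^sup>2 \<partial>M)" by simp
  also have "\<dots> = (\<integral>x. (g x)\<^sup>2 - 2 * (?s / ?m) * g x + (?s / ?m)\<^sup>2 \<partial>M)"
    by (intro Bochner_Integration.integral_cong) (auto simp: power2_diff)
  also have "\<dots> = (\<integral>x. (g x)\<^sup>2 \<partial>M) - 2 * (?s / ?m) * ?s + (?s / ?m)\<^sup>2 * ?m"
    using g by simp
  also have "\<dots> = (\<integral>x. (g x)\<^sup>2 \<partial>M) - ?s\<^sup>2 / ?m"
    using m by (simp add: power2_eq_square field_simps)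
  finally show ?thesis using m by (simp add: field_simps)
qed

lemma L2_norm_graphon_op_le:
  assumes W: "graphon W" and f: "f \<in> L2"
  shows "L2_norm (graphon_op W f) \<le> L2_norm f"
proof -
  let ?M = "lebesgue_on {0..1::real}"
  interpret M: finite_measure ?M
    by (rule finite_measure_lebesgue_on) auto
  have m1: "measure ?M (space ?M) = 1"
    by (simp add: measure_restrict_space space_restrict_space)
  have fm: "f \<in> borel_measurable ?M" and f2: "integrable ?M (\<lambda>x. (f x)\<^sup>2)"
    using f by (auto simp: L2_def)
  have fi: "integrable ?M (\<lambda>x. \<bar>f x\<bar>)"
  proof (rule Bochner_Integration.integrable_bound)
    show "integrable ?M (\<lambda>x. 1 + (f x)\<^sup>2)" using f2 by simp
    have "\<bar>t\<bar> \<le> 1 + t\<^sup>2" for t :: real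
    proof -
      have "0 \<le> (\<bar>t\<bar> - 1)\<^sup>2" by simp
      then have "2 * \<bar>t\<bar> \<le> 1 + t\<^sup>2" by (simp add: power2_diff)
      then show ?thesis using abs_ge_zero[of t] by linarith
    qed
    then show "AE x in ?M. norm \<bar>f x\<bar> \<le> norm (1 + (f x)\<^sup>2)" by simp
  qed (use fm in auto)
  have fs: "(\<integral>x. \<bar>f x\<bar> \<partial>?M)\<^sup>2 \<le> (\<integral>x. (f x)\<^sup>2 \<partial>?M)"
    using M.square_integral_le[OF fi] f2 m1 by simp
  have T: "(graphon_op W f x)\<^sup>2 \<le> (\<integral>x. (f x)\<^sup>2 \<partial>?M)" if x: "x \<in> {0..1}" for x
  proof (cases "integrable ?M (\<lambda>y. W x y * f y)")
    case True
    have "\<bar>graphon_op W f x\<bar> \<le> (\<integral>y. \<bar>W x y * f y\<bar> \<partial>?M)"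
      unfolding graphon_op_def by (rule integral_abs_bound)
    also have "\<dots> \<le> (\<integral>y. \<bar>f y\<bar> \<partial>?M)"
    proof (rule integral_mono)
      fix y assume "y \<in> space ?M"
      then have "y \<in> {0..1}" by (simp add: space_restrict_space)
      then have "0 \<le> W x y" "W x y \<le> 1" using W x by (auto simp: graphon_def)
      then show "\<bar>W x y * f y\<bar> \<le> \<bar>f y\<bar>" by (simp add: abs_mult mult_left_le_one_le)
    qed (use True fi in auto)
    finally have "(graphon_op W f x)\<^sup>2 \<le> (\<integral>y. \<bar>f y\<bar> \<partial>?M)\<^sup>2"
      by (metis abs_ge_zero power2_abs power_mono)
    then show ?thesis using fs by linarith
  next
    case False
    then show ?thesis by (simp add: graphon_op_def not_integrable_integral_eq)
  qed
  have "(\<integral>x. (graphon_op W f x)\<^sup>2 \<partial>?M) \<le> (\<integral>x. (f x)\<^sup>2 \<partial>?M)"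
  proof (cases "integrable ?M (\<lambda>x. (graphon_op W f x)\<^sup>2)")
    case True
    have "(\<integral>x. (graphon_op W f x)\<^sup>2 \<partial>?M) \<le> (\<integral>x. (\<integral>x. (f x)\<^sup>2 \<partial>?M) \<partial>?M)"
      using True T by (intro integral_mono) (auto simp: space_restrict_space)
    then show ?thesis using m1 by simp
  next
    case False
    then show ?thesis by (simp add: not_integrable_integral_eq)
  qed
  then show ?thesis by (simp add: L2_norm_def)
qed

text \<open>
  The quotients in the definition of the operator norm are bounded by 1, so that their supremum is an upper
  bound.
\<close>

lemma op_norm_bound:
  assumes W: "graphon W" and f: "f \<in> L2"
  shows "L2_norm (graphon_op W f) \<le> op_norm W * L2_norm f" and "0 \<le> op_norm W"
proof -
  have nn: "0 \<le> L2_norm f" for f by (simp add: L2_norm_def)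
  have "L2_norm (graphon_op W f) / L2_norm f \<le> 1" if "f \<in> L2" for f
    using L2_norm_graphon_op_le[OF W that] nn[of f] by (auto simp: divide_le_eq_1 less_le)
  then have bdd: "bdd_above ((\<lambda>f. L2_norm (graphon_op W f) / L2_norm f) ` L2)"
    by (auto intro!: bdd_aboveI[of _ 1])
  have le: "L2_norm (graphon_op W f) / L2_norm f \<le> op_norm W" if "f \<in> L2" for f
    unfolding op_norm_def by (rule cSUP_upper[OF that bdd])
  show "0 \<le> op_norm W" using le[OF f] nn by (meson divide_nonneg_nonneg order_trans)
  show "L2_norm (graphon_op W f) \<le> op_norm W * L2_norm f"
  proof (cases "L2_norm f = 0")
    case True
    then show ?thesis using L2_norm_graphon_op_le[OF W f] by simp
  next
    case False
    then show ?thesis using le[OF f] nn[of f] by (simp add: divide_le_eq)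
  qed
qed

lemma sum_indicator_grid_cell:
  "N > 0 \<Longrightarrow> (\<Sum>i=1..N. indicator (grid_cell N i) x) = (indicator {0<..1} x :: real)"
  by (subst UN_grid_cell[symmetric], simp, subst indicator_UN_disjoint)
    (auto intro: grid_cell_disjoint)

lemma grid_cell_sets [measurable, simp]: "grid_cell N i \<in> sets borel"
  by (simp add: grid_cell_def)

lemma emeasure_grid_cell: "N > 0 \<Longrightarrow> emeasure lborel (grid_cell N i) = ennreal (1 / real N)"
  by (simp add: grid_cell_def divide_right_mono diff_divide_distrib[symmetric])

lemma grid_square_sets [measurable, simp]: "grid_square N i j \<in> sets borel"
  unfolding borel_prod[symmetric] by (intro pair_measureI) auto

lemma emeasure_grid_square:
  assumes "N > 0"
  shows "emeasure lborel (grid_square N i j) = ennreal (1 / (real N)\<^sup>2)"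
  using assms
  by (simp add: lborel_prod[symmetric] lborel.emeasure_pair_measure_Times emeasure_grid_cell
      ennreal_mult'[symmetric] power2_eq_square)

definition cell_integral :: "(real \<times> real \<Rightarrow> real) \<Rightarrow> nat \<Rightarrow> nat \<Rightarrow> nat \<Rightarrow> real" where
  "cell_integral B N i j = (\<integral>p. indicator (grid_square N i j) p * B p \<partial>lborel)"

lemma integrable_grid_square:
  fixes B :: "real \<times> real \<Rightarrow> real"
  assumes [measurable]: "B \<in> borel_measurable borel" and B: "\<And>p. 0 \<le> B p" "\<And>p. B p \<le> 1" and "N > 0"
  shows "integrable lborel (\<lambda>p. indicator (grid_square N i j) p * B p)"
proof (rule Bochner_Integration.integrable_bound)
  show "integrable lborel (indicator (grid_square N i j) :: _ \<Rightarrow> real)"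
    using assms by (intro integrable_real_indicator) (auto simp: emeasure_grid_square)
qed (use B in \<open>auto simp: indicator_def\<close>)

text \<open>
  A function cannot stay away from its mean on a whole cell: some value in the cell is at least as far from
  \<open>c\<close> as the mean is, up to \<open>e\<close>. This turns differences between values and means
  into differences between two values.
\<close>

lemma cell_integral_near_value:
  assumes Bm: "B \<in> borel_measurable borel" and B: "\<And>p. 0 \<le> B p" "\<And>p. B p \<le> 1"
    and ae: "AE p in lborel. p \<in> {0..1} \<times> {0..1} \<longrightarrow> B p = W (fst p) (snd p)"
    and ij: "i \<in> {1..N}" "j \<in> {1..N}" and e: "e > 0"
  shows "\<exists>\<xi>\<in>grid_square N i j.
    \<bar>c / (real N)\<^sup>2 - cell_integral B N i j\<bar> \<le> (\<bar>c - W (fst \<xi>) (snd \<xi>)\<bar> + e) / (real N)\<^sup>2"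
proof (rule ccontr)
  assume "\<not> ?thesis"
  then have far: "(\<bar>c - W (fst p) (snd p)\<bar> + e) / (real N)\<^sup>2 < \<bar>c / (real N)\<^sup>2 - cell_integral B N i j\<bar>"
    if "p \<in> grid_square N i j" for p using that by force
  let ?S = "grid_square N i j"
  define a where "a = (real N)\<^sup>2 * cell_integral B N i j"
  have N: "N > 0" using ij by auto
  then have a: "cell_integral B N i j = a / (real N)\<^sup>2" by (simp add: a_def)
  have far': "\<bar>c - W (fst p) (snd p)\<bar> + e < \<bar>c - a\<bar>" if "p \<in> ?S" for p
    using far[OF that] N unfolding a by (simp add: diff_divide_distrib[symmetric] divide_less_cancel)
  have sub: "?S \<subseteq> {0..1} \<times> {0..1}" using grid_cell_sub[OF ij(1)] grid_cell_sub[OF ij(2)] by fastforce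
  have ind: "integrable lborel (indicator ?S :: _ \<Rightarrow> real)"
    using N by (intro integrable_real_indicator) (auto simp: emeasure_grid_square)
  have int: "integrable lborel (\<lambda>p. indicator ?S p * B p)" by (rule integrable_grid_square[OF Bm B N])
  have ms: "(\<integral>p. indicator ?S p * t \<partial>lborel) = t / (real N)\<^sup>2" for t :: real
    using N by (simp add: measure_def emeasure_grid_square)
  have ci: "integrable lborel (\<lambda>p. indicator ?S p * t)" for t :: real using ind by simp
  show False
  proof (cases "a \<le> c")
    case True
    have "AE p in lborel. indicator ?S p * (a + e) \<le> indicator ?S p * B p"
      using ae
    proof eventually_elim
      case (elim p)
      show ?case using elim far'[of p] sub True by (cases "p \<in> ?S") auto
    qed
    from integral_mono_AE[OF ci int this] have "(a + e) / (real N)\<^sup>2 \<le> a / (real N)\<^sup>2"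
      unfolding ms by (simp add: cell_integral_def[symmetric] a)
    then show False using e N by (simp add: divide_le_cancel)
  next
    case False
    have "AE p in lborel. indicator ?S p * B p \<le> indicator ?S p * (a - e)"
      using ae
    proof eventually_elim
      case (elim p)
      show ?case using elim far'[of p] sub False by (cases "p \<in> ?S") auto
    qed
    from integral_mono_AE[OF int ci this] have "a / (real N)\<^sup>2 \<le> (a - e) / (real N)\<^sup>2"
      unfolding ms by (simp add: cell_integral_def[symmetric] a)
    then show False using e N by (simp add: divide_le_cancel)
  qed
qed

lemma grid_values_near_cell_integrals:
  assumes Bm: "B \<in> borel_measurable borel" and B: "\<And>p. 0 \<le> B p" "\<And>p. B p \<le> 1"
    and ae: "AE p in lborel. p \<in> {0..1} \<times> {0..1} \<longrightarrow> B p = W (fst p) (snd p)"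
    and R: "riemann_integrable (\<lambda>(x, y). W x y) (0, 0) (1, 1)" and e: "e > 0"
  shows "\<exists>n0. \<forall>N\<ge>n0. (\<Sum>i=1..N. \<Sum>j=1..N.
    \<bar>grid_value W N i j / (real N)\<^sup>2 - cell_integral B N i j\<bar>) \<le> e"
proof -
  have "0 < e / 2" using e by simp
  from riemann_grid_oscillation[OF R this] obtain n0 where n0: "\<And>N s t. N \<ge> n0 \<Longrightarrow>
     (\<forall>i\<in>{1..N}. \<forall>j\<in>{1..N}. s i j \<in> grid_square N i j \<and> t i j \<in> grid_square N i j) \<Longrightarrow>
     (\<Sum>i=1..N. \<Sum>j=1..N. \<bar>(case s i j of (x, y) \<Rightarrow> W x y) - (case t i j of (x, y) \<Rightarrow> W x y)\<bar> / (real N)\<^sup>2) < e / 2"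
    by blast
  show ?thesis
  proof (intro exI[of _ "max 1 n0"] allI impI)
    fix N assume "max 1 n0 \<le> N"
    then have N: "N > 0" "N \<ge> n0" by auto
    let ?c = "\<lambda>i j. grid_value W N i j"
    have "\<forall>i\<in>{1..N}. \<forall>j\<in>{1..N}. \<exists>\<xi>. \<xi> \<in> grid_square N i j \<and>
       \<bar>?c i j / (real N)\<^sup>2 - cell_integral B N i j\<bar> \<le> (\<bar>?c i j - W (fst \<xi>) (snd \<xi>)\<bar> + e / 2) / (real N)\<^sup>2"
      using cell_integral_near_value[OF Bm B ae _ _ \<open>0 < e / 2\<close>] by blast
    then obtain t where t: "\<And>i j. i \<in> {1..N} \<Longrightarrow> j \<in> {1..N} \<Longrightarrow> t i j \<in> grid_square N i j"
      "\<And>i j. i \<in> {1..N} \<Longrightarrow> j \<in> {1..N} \<Longrightarrow>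
        \<bar>?c i j / (real N)\<^sup>2 - cell_integral B N i j\<bar> \<le> (\<bar>?c i j - W (fst (t i j)) (snd (t i j))\<bar> + e / 2) / (real N)\<^sup>2"
      by metis
    have end_pt: "real i / real N \<in> grid_cell N i" for i
      using N by (simp add: grid_cell_def divide_strict_right_mono)
    have "(\<Sum>i=1..N. \<Sum>j=1..N. \<bar>?c i j / (real N)\<^sup>2 - cell_integral B N i j\<bar>)
      \<le> (\<Sum>i=1..N. \<Sum>j=1..N. (\<bar>?c i j - W (fst (t i j)) (snd (t i j))\<bar> + e / 2) / (real N)\<^sup>2)"
      by (intro sum_mono t) auto
    also have "\<dots> = (\<Sum>i=1..N. \<Sum>j=1..N. \<bar>?c i j - W (fst (t i j)) (snd (t i j))\<bar> / (real N)\<^sup>2) + e / 2"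
      using N by (simp add: add_divide_distrib sum.distrib power2_eq_square)
    also have "\<dots> \<le> e / 2 + e / 2"
      using n0[OF N(2), of "\<lambda>i j. (real i / real N, real j / real N)" t] t end_pt
      by (simp add: case_prod_unfold)
    finally show "(\<Sum>i=1..N. \<Sum>j=1..N. \<bar>?c i j / (real N)\<^sup>2 - cell_integral B N i j\<bar>) \<le> e" by simp
  qed
qed

lemma cell_integral_iterated:
  assumes [measurable]: "B \<in> borel_measurable borel" and B: "\<And>p. 0 \<le> B p" "\<And>p. B p \<le> 1" and N: "N > 0"
  shows "cell_integral B N i j =
    (\<integral>x. indicator (grid_cell N i) x * (\<integral>y. indicator (grid_cell N j) y * B (x, y) \<partial>lborel) \<partial>lborel)"
proof -
  have "integrable (lborel \<Otimes>\<^sub>M lborel) (\<lambda>p. indicator (grid_square N i j) p * B p)"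
    using integrable_grid_square[OF assms] by (simp add: lborel_prod)
  from lborel_pair.integral_fst'[OF this]
  have "cell_integral B N i j = (\<integral>x. \<integral>y. indicator (grid_square N i j) (x, y) * B (x, y) \<partial>lborel \<partial>lborel)"
    by (simp add: cell_integral_def lborel_prod)
  then show ?thesis by (simp add: indicator_times mult.assoc)
qed

lemma step_function_L2:
  fixes v :: "nat \<Rightarrow> real"
  assumes N: "N > 0"
  defines "f \<equiv> \<lambda>y. \<Sum>j=1..N. v j * indicator (grid_cell N j) y"
  shows "f \<in> L2" and "(L2_norm f)\<^sup>2 = (\<Sum>j=1..N. (v j)\<^sup>2) / real N"
proof -
  have fm [measurable]: "f \<in> borel_measurable borel" unfolding f_def by measurable
  have sq: "(f y)\<^sup>2 = (\<Sum>j=1..N. (v j)\<^sup>2 * indicator (grid_cell N j) y)" for y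
  proof (cases "\<exists>k\<in>{1..N}. y \<in> grid_cell N k")
    case True
    then obtain k where k: "k \<in> {1..N}" "y \<in> grid_cell N k" by blast
    have ind: "indicator (grid_cell N j) y = (if j = k then 1 else 0 :: real)" for j
      using grid_cell_index[OF N, of y j] grid_cell_index[OF N k(2)] k(2) by (auto simp: indicator_def)
    have "f y = (\<Sum>j=1..N. if j = k then v j else 0)"
      unfolding f_def by (intro sum.cong) (auto simp: ind)
    moreover have "(\<Sum>j=1..N. (v j)\<^sup>2 * indicator (grid_cell N j) y) = (\<Sum>j=1..N. if j = k then (v j)\<^sup>2 else 0)"
      by (intro sum.cong) (auto simp: ind)
    ultimately show ?thesis using k(1) by simp
  next
    case False
    then have "indicator (grid_cell N j) y = (0::real)" if "j \<in> {1..N}" for j using that by simp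
    then have "f y = 0" "(\<Sum>j=1..N. (v j)\<^sup>2 * indicator (grid_cell N j) y) = 0"
      unfolding f_def by (auto intro!: sum.neutral)
    then show ?thesis by simp
  qed
  have ind: "integrable lborel (indicator (grid_cell N j) :: real \<Rightarrow> real)" for j
    using N by (intro integrable_real_indicator) (auto simp: emeasure_grid_cell)
  have int: "integrable lborel (\<lambda>y. (f y)\<^sup>2)"
    unfolding sq by (intro Bochner_Integration.integrable_sum integrable_mult_right ind)
  have out: "f y = 0" if "y \<notin> {0..1}" for y
    using that grid_cell_sub[of _ N] unfolding f_def by (intro sum.neutral) (fastforce simp: indicator_def)
  have restr: "indicator {0..1} y * (f y)\<^sup>2 = (f y)\<^sup>2" for y
    using out[of y] by (auto simp: indicator_def)
  have "integrable (lebesgue_on {0..1}) (\<lambda>y. (f y)\<^sup>2)"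
    using int by (subst integrable_restrict_space) (simp_all add: restr integrable_completion)
  moreover have "f \<in> borel_measurable (lebesgue_on {0..1})"
    by (intro measurable_restrict_space1 measurable_completion) simp
  ultimately show "f \<in> L2" by (simp add: L2_def)
  have "(LINT y|lebesgue_on {0..1}. (f y)\<^sup>2) = (\<integral>y. (f y)\<^sup>2 \<partial>lborel)"
    by (subst integral_restrict_space) (simp_all add: restr integral_completion)
  also have "\<dots> = (\<Sum>j=1..N. \<integral>y. (v j)\<^sup>2 * indicator (grid_cell N j) y \<partial>lborel)"
    unfolding sq by (intro Bochner_Integration.integral_sum integrable_mult_right ind)
  also have "\<dots> = (\<Sum>j=1..N. (v j)\<^sup>2) / real N"
    using N by (simp add: measure_def emeasure_grid_cell sum_divide_distrib)
  finally show "(L2_norm f)\<^sup>2 = (\<Sum>j=1..N. (v j)\<^sup>2) / real N"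
    by (simp add: L2_norm_def sum_nonneg)
qed

text \<open>
  The matrix of cell means is the compression of the integral operator to step functions: the entries of its
  product with \<open>v\<close> are the means over the cells of the image of the step function with values
  \<open>v\<close>, and taking means does not increase the norm.
\<close>

lemma cell_integral_matrix_bound:
  fixes v :: "nat \<Rightarrow> real"
  assumes W: "graphon W" and Bm[measurable]: "B \<in> borel_measurable borel"
    and B: "\<And>p. 0 \<le> B p" "\<And>p. B p \<le> 1"
    and ae: "AE p in lborel. p \<in> {0..1} \<times> {0..1} \<longrightarrow> B p = W (fst p) (snd p)"
    and N: "N > 0"
  shows "(\<Sum>i=1..N. (\<Sum>j=1..N. real N * cell_integral B N i j * v j)\<^sup>2) \<le> (op_norm W)\<^sup>2 * (\<Sum>j=1..N. (v j)\<^sup>2)"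
proof -
  define f where "f = (\<lambda>y. \<Sum>j=1..N. v j * indicator (grid_cell N j) y)"
  define h where "h = (\<lambda>j x. \<integral>y. indicator (grid_cell N j) y * B (x, y) \<partial>lborel)"
  define g where "g = (\<lambda>x. \<Sum>j=1..N. v j * h j x)"
  have hm [measurable]: "h j \<in> borel_measurable borel" for j
    unfolding h_def by measurable
  have gm [measurable]: "g \<in> borel_measurable borel" unfolding g_def by measurable
  have fm [measurable]: "f \<in> borel_measurable borel" unfolding f_def by measurable
  have intj: "integrable lborel (\<lambda>y. indicator (grid_cell N j) y * B (x, y))" for j x
  proof (rule Bochner_Integration.integrable_bound)
    show "integrable lborel (indicator (grid_cell N j) :: real \<Rightarrow> real)"
      using N by (intro integrable_real_indicator) (auto simp: emeasure_grid_cell)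
  qed (use B in \<open>auto simp: indicator_def\<close>)
  have h: "\<bar>h j x\<bar> \<le> 1" for j x
  proof -
    have "0 \<le> h j x" unfolding h_def using B by (intro Bochner_Integration.integral_nonneg) auto
    moreover have "h j x \<le> (\<integral>y. indicator (grid_cell N j) y \<partial>lborel)" unfolding h_def
      using N B by (intro integral_mono intj integrable_real_indicator)
        (auto simp: emeasure_grid_cell indicator_def)
    moreover have "(\<integral>y. indicator (grid_cell N j) y \<partial>lborel) = 1 / real N"
      using N by (simp add: measure_def emeasure_grid_cell)
    moreover have "1 / real N \<le> 1" using N by simp
    ultimately show ?thesis by linarith
  qed
  define K where "K = (\<Sum>j=1..N. \<bar>v j\<bar>)"
  have g: "\<bar>g x\<bar> \<le> K" for x
  proof -
    have "\<bar>g x\<bar> \<le> (\<Sum>j=1..N. \<bar>v j * h j x\<bar>)" unfolding g_def by (rule sum_abs)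
    also have "\<dots> \<le> K" unfolding K_def
      using h by (intro sum_mono) (simp add: abs_mult mult_left_le)
    finally show ?thesis .
  qed
  have bounded_int: "integrable lborel (\<lambda>x. indicator A x * u x)"
    if "A \<in> sets borel" "emeasure lborel A < \<infinity>" "u \<in> borel_measurable borel" "\<And>x. \<bar>u x\<bar> \<le> C"
    for A and u :: "real \<Rightarrow> real" and C
  proof (rule Bochner_Integration.integrable_bound)
    show "integrable lborel (\<lambda>x. indicator A x * C)" using that by simp
    have "0 \<le> C" using that(4)[of 0] by linarith
    then show "AE x in lborel. norm (indicator A x * u x) \<le> norm (indicator A x * C)"
      using that(4) by (auto simp: indicator_def)
  qed (use that in auto)
  have g2: "\<bar>(g x)\<^sup>2\<bar> \<le> K\<^sup>2" for x
    using power_mono[OF g[of x], of 2] by simp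
  have cellfin: "emeasure lborel (grid_cell N i) < \<infinity>" for i using N by (simp add: emeasure_grid_cell)
  \<comment> \<open>Each row of the matrix product is a mean of \<open>g\<close>, the image of the step function \<open>f\<close>, over a cell.\<close>
  have row: "(\<Sum>j=1..N. real N * cell_integral B N i j * v j) = real N * (\<integral>x. indicator (grid_cell N i) x * g x \<partial>lborel)" for i
  proof -
    have "(\<integral>x. indicator (grid_cell N i) x * g x \<partial>lborel) = (\<integral>x. (\<Sum>j=1..N. v j * (indicator (grid_cell N i) x * h j x)) \<partial>lborel)"
      by (simp add: g_def sum_distrib_left mult_ac)
    also have "\<dots> = (\<Sum>j=1..N. v j * (\<integral>x. indicator (grid_cell N i) x * h j x \<partial>lborel))"
      using bounded_int[OF _ cellfin hm h] by (subst Bochner_Integration.integral_sum) auto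
    also have "\<dots> = (\<Sum>j=1..N. v j * cell_integral B N i j)"
      using cell_integral_iterated[OF Bm B N] by (simp add: h_def)
    finally show ?thesis by (simp add: sum_distrib_left mult_ac)
  qed
  have cs: "(real N * (\<integral>x. indicator (grid_cell N i) x * g x \<partial>lborel))\<^sup>2
      \<le> real N * (\<integral>x. indicator (grid_cell N i) x * (g x)\<^sup>2 \<partial>lborel)" for i
  proof -
    let ?M = "restrict_space lborel (grid_cell N i)"
    interpret M: finite_measure ?M
      using cellfin[of i] by (intro finite_measureI) (simp add: emeasure_restrict_space space_restrict_space less_top)
    have "(\<integral>x. g x \<partial>?M)\<^sup>2 \<le> measure ?M (space ?M) * (\<integral>x. (g x)\<^sup>2 \<partial>?M)"
      using bounded_int[OF _ cellfin gm g] bounded_int[OF _ cellfin _ g2]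
      by (intro M.square_integral_le) (simp_all add: integrable_restrict_space)
    moreover have "measure ?M (space ?M) = 1 / real N"
      using N by (simp add: measure_def emeasure_restrict_space space_restrict_space emeasure_grid_cell)
    ultimately have "(\<integral>x. indicator (grid_cell N i) x * g x \<partial>lborel)\<^sup>2
       \<le> 1 / real N * (\<integral>x. indicator (grid_cell N i) x * (g x)\<^sup>2 \<partial>lborel)"
      by (simp add: integral_restrict_space)
    then have "(real N)\<^sup>2 * (\<integral>x. indicator (grid_cell N i) x * g x \<partial>lborel)\<^sup>2
       \<le> (real N)\<^sup>2 * (1 / real N * (\<integral>x. indicator (grid_cell N i) x * (g x)\<^sup>2 \<partial>lborel))"
      by (intro mult_left_mono) auto
    then show ?thesis using N by (simp add: power_mult_distrib power2_eq_square mult_ac)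
  qed
  \<comment> \<open>\<open>g\<close> is defined through \<open>B\<close>; by Fubini it agrees almost everywhere with the image of \<open>f\<close> under the graphon operator.\<close>
  have Tg: "AE x in lborel. x \<in> {0..1} \<longrightarrow> graphon_op W f x = g x"
  proof -
    have "AE p in lborel \<Otimes>\<^sub>M lborel. p \<in> {0..1} \<times> {0..1} \<longrightarrow> B p = W (fst p) (snd p)"
      unfolding lborel_prod by (rule ae)
    from lborel_pair.AE_pair[OF this]
    show ?thesis
    proof eventually_elim
      case (elim x)
      show ?case
      proof
        assume x: "x \<in> {0..1}"
        have Bx [measurable]: "(\<lambda>y. B (x, y)) \<in> borel_measurable borel" by measurable
        have ae_y: "AE y in lebesgue. indicator {0..1} y * (B (x, y) * f y) = indicator {0..1} y * (W x y * f y)"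
          using AE_completion[OF elim] by eventually_elim (use x in \<open>auto simp: indicator_def\<close>)
        have m1: "(\<lambda>y. indicator {0..1} y * (B (x, y) * f y)) \<in> borel_measurable lebesgue"
          by (intro measurable_completion) simp
        have "graphon_op W f x = (\<integral>y. indicator {0..1} y * (W x y * f y) \<partial>lebesgue)"
          unfolding graphon_op_def by (subst integral_restrict_space) simp_all
        also have "\<dots> = (\<integral>y. indicator {0..1} y * (B (x, y) * f y) \<partial>lebesgue)"
          using ae_y borel_measurable_AE[OF m1 ae_y] m1 by (intro integral_cong_AE) auto
        also have "\<dots> = (\<integral>y. indicator {0..1} y * (B (x, y) * f y) \<partial>lborel)"
          by (rule integral_completion) simp
        also have "\<dots> = (\<integral>y. (\<Sum>j=1..N. v j * (indicator (grid_cell N j) y * B (x, y))) \<partial>lborel)"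
        proof (intro Bochner_Integration.integral_cong refl)
          fix y
          have "indicator {0..1} y * (v j * indicator (grid_cell N j) y) = v j * indicator (grid_cell N j) y"
            if "j \<in> {1..N}" for j
            using grid_cell_sub[OF that] by (auto simp: indicator_def)
          then have "indicator {0..1} y * f y = f y"
            unfolding f_def sum_distrib_left by (intro sum.cong) auto
          then have "indicator {0..1} y * (B (x, y) * f y) = B (x, y) * f y" by (metis mult.left_commute)
          also have "\<dots> = (\<Sum>j=1..N. v j * (indicator (grid_cell N j) y * B (x, y)))"
            unfolding f_def sum_distrib_left by (intro sum.cong refl) (simp only: mult_ac)
          finally show "indicator {0..1} y * (B (x, y) * f y) = (\<Sum>j=1..N. v j * (indicator (grid_cell N j) y * B (x, y)))" .
        qed
        also have "\<dots> = g x"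
          using intj by (simp add: g_def h_def)
        finally show "graphon_op W f x = g x" .
      qed
    qed
  qed
  have opg: "(L2_norm (graphon_op W f))\<^sup>2 = (\<integral>x. indicator {0..1} x * (g x)\<^sup>2 \<partial>lborel)"
  proof -
    have ae_x: "AE x in lebesgue. indicator {0..1} x * (g x)\<^sup>2 = indicator {0..1} x * (graphon_op W f x)\<^sup>2"
      using AE_completion[OF Tg] by eventually_elim (auto simp: indicator_def)
    have m1: "(\<lambda>x. indicator {0..1} x * (g x)\<^sup>2) \<in> borel_measurable lebesgue"
      by (intro measurable_completion) simp
    have "(L2_norm (graphon_op W f))\<^sup>2 = (LINT x|lebesgue_on {0..1}. (graphon_op W f x)\<^sup>2)"
      by (simp add: L2_norm_def)
    also have "\<dots> = (\<integral>x. indicator {0..1} x * (graphon_op W f x)\<^sup>2 \<partial>lebesgue)"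
      by (subst integral_restrict_space) simp_all
    also have "\<dots> = (\<integral>x. indicator {0..1} x * (g x)\<^sup>2 \<partial>lebesgue)"
      using ae_x borel_measurable_AE[OF m1 ae_x] m1 by (intro integral_cong_AE) auto
    also have "\<dots> = (\<integral>x. indicator {0..1} x * (g x)\<^sup>2 \<partial>lborel)"
      by (rule integral_completion) simp
    finally show ?thesis .
  qed
  have "(\<Sum>i=1..N. (\<Sum>j=1..N. real N * cell_integral B N i j * v j)\<^sup>2)
    \<le> (\<Sum>i=1..N. real N * (\<integral>x. indicator (grid_cell N i) x * (g x)\<^sup>2 \<partial>lborel))"
    unfolding row by (intro sum_mono cs)
  also have "\<dots> = real N * (\<integral>x. (\<Sum>i=1..N. indicator (grid_cell N i) x) * (g x)\<^sup>2 \<partial>lborel)"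
  proof -
    have "integrable lborel (\<lambda>x. indicator (grid_cell N i) x * (g x)\<^sup>2)" for i
      by (rule bounded_int[OF _ cellfin _ g2]) auto
    then show ?thesis
      unfolding sum_distrib_left[symmetric] sum_distrib_right
      by (subst Bochner_Integration.integral_sum) (rule refl | assumption)+
  qed
  also have "\<dots> \<le> real N * (\<integral>x. indicator {0..1} x * (g x)\<^sup>2 \<partial>lborel)"
    unfolding sum_indicator_grid_cell[OF N]
    by (intro mult_left_mono integral_mono bounded_int[OF _ _ _ g2]) (auto simp: indicator_def)
  also have "\<dots> = real N * (L2_norm (graphon_op W f))\<^sup>2" by (simp add: opg)
  also have "\<dots> \<le> real N * (op_norm W * L2_norm f)\<^sup>2"
  proof -
    have "f \<in> L2" unfolding f_def by (rule step_function_L2[OF N])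
    from op_norm_bound(1)[OF W this] show ?thesis
      by (intro mult_left_mono power_mono) (auto simp: L2_norm_def)
  qed
  also have "\<dots> = (op_norm W)\<^sup>2 * (\<Sum>j=1..N. (v j)\<^sup>2)"
    using N step_function_L2(2)[OF N, of v] by (simp add: f_def power_mult_distrib)
  finally show ?thesis .
qed

text \<open>
  The sampled matrix differs from the matrix of cell means by a matrix with small Frobenius norm: its entries
  are at most \<open>1 / N\<close> and, by Riemann integrability, the sum of their absolute values is small
  compared with \<open>N\<close>.
\<close>

lemma graphon_matrix_norm:
  assumes W: "graphon W" and R: "riemann_integrable (\<lambda>(x, y). W x y) (0, 0) (1, 1)" and e: "e > 0"
  shows "\<exists>n0. \<forall>N\<ge>n0. \<forall>v. (\<Sum>i=1..N. (\<Sum>j=1..N. grid_value W N i j / real N * v j)\<^sup>2)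
    \<le> (op_norm W + e)\<^sup>2 * (\<Sum>j=1..N. (v j)\<^sup>2)"
proof -
  obtain B where Bm: "B \<in> borel_measurable borel" and B: "\<And>p. 0 \<le> B p" "\<And>p. B p \<le> 1"
    and ae: "AE p in lborel. p \<in> {0..1} \<times> {0..1} \<longrightarrow> B p = W (fst p) (snd p)"
    using graphon_borel_version[OF W] by blast
  have "0 < e\<^sup>2" using e by simp
  from grid_values_near_cell_integrals[OF Bm B ae R this] obtain n0 where
    n0: "\<And>N. N \<ge> n0 \<Longrightarrow> (\<Sum>i=1..N. \<Sum>j=1..N.
      \<bar>grid_value W N i j / (real N)\<^sup>2 - cell_integral B N i j\<bar>) \<le> e\<^sup>2" by blast
  show ?thesis
  proof (intro exI[of _ "max 1 n0"] allI impI)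
    fix N and v :: "nat \<Rightarrow> real"
    assume "max 1 n0 \<le> N"
    then have N: "N > 0" "N \<ge> n0" by auto
    let ?I = "{1..N}"
    define w where "w = (\<lambda>i j. grid_value W N i j / real N)"
    define u where "u = (\<lambda>i j. real N * cell_integral B N i j)"
    have op0: "0 \<le> op_norm W" using op_norm_bound(2)[OF W step_function_L2(1)[OF N(1)]] .
    have w01: "0 \<le> w i j" "w i j \<le> 1 / real N" if "i \<in> ?I" "j \<in> ?I" for i j
      using W that by (auto simp: w_def graphon_def divide_right_mono)
    have u01: "0 \<le> u i j" "u i j \<le> 1 / real N" for i j
    proof -
      have "0 \<le> cell_integral B N i j" unfolding cell_integral_def
        using B by (intro Bochner_Integration.integral_nonneg) auto
      moreover have "cell_integral B N i j \<le> 1 / (real N)\<^sup>2"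
      proof -
        have "cell_integral B N i j \<le> (\<integral>p. indicator (grid_square N i j) p \<partial>lborel)"
        unfolding cell_integral_def using N B
        by (intro integral_mono integrable_grid_square[OF Bm B N(1)] integrable_real_indicator)
          (auto simp: emeasure_grid_square indicator_def)
        also have "\<dots> = 1 / (real N)\<^sup>2"
          using N by (simp add: measure_def emeasure_grid_square)
        finally show ?thesis .
      qed
      ultimately show "0 \<le> u i j" "u i j \<le> 1 / real N"
        using N by (auto simp: u_def power2_eq_square field_simps)
    qed
    have D: "L2_set (\<lambda>(i, j). w i j - u i j) (?I \<times> ?I) \<le> e"
    proof -
      have "(\<Sum>i=1..N. \<Sum>j=1..N. (w i j - u i j)\<^sup>2) \<le> (\<Sum>i=1..N. \<Sum>j=1..N.
         \<bar>grid_value W N i j / (real N)\<^sup>2 - cell_integral B N i j\<bar>)"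
      proof (intro sum_mono)
        fix i j assume ij: "i \<in> ?I" "j \<in> ?I"
        have "\<bar>w i j - u i j\<bar> \<le> 1 / real N" using w01[OF ij] u01[of i j] by linarith
        then have "\<bar>w i j - u i j\<bar> * \<bar>w i j - u i j\<bar> \<le> 1 / real N * \<bar>w i j - u i j\<bar>"
          by (intro mult_right_mono) auto
        also have "\<dots> = \<bar>(w i j - u i j) / real N\<bar>" by simp
        also have "(w i j - u i j) / real N = grid_value W N i j / (real N)\<^sup>2 - cell_integral B N i j"
          using N by (simp add: w_def u_def diff_divide_distrib power2_eq_square)
        finally show "(w i j - u i j)\<^sup>2 \<le> \<bar>grid_value W N i j / (real N)\<^sup>2 - cell_integral B N i j\<bar>"
          by (simp add: power2_eq_square)
      qed
      also have "\<dots> \<le> e\<^sup>2" by (rule n0[OF N(2)])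
      finally have "sqrt (\<Sum>i=1..N. \<Sum>j=1..N. (w i j - u i j)\<^sup>2) \<le> sqrt (e\<^sup>2)" by (rule real_sqrt_le_mono)
      then show ?thesis using e by (simp add: L2_set_def sum.cartesian_product case_prod_unfold)
    qed
    let ?w = "\<lambda>i. \<Sum>j=1..N. w i j * v j" and ?u = "\<lambda>i. \<Sum>j=1..N. u i j * v j"
    have diff: "L2_set (\<lambda>i. ?w i - ?u i) ?I \<le> e * L2_set v ?I"
    proof -
      have "(\<Sum>i\<in>?I. (?w i - ?u i)\<^sup>2) = (\<Sum>i\<in>?I. (\<Sum>j\<in>?I. (w i j - u i j) * v j)\<^sup>2)"
        by (simp add: sum_subtractf left_diff_distrib)
      also have "\<dots> \<le> (\<Sum>i\<in>?I. (\<Sum>j\<in>?I. (w i j - u i j)\<^sup>2) * (\<Sum>j\<in>?I. (v j)\<^sup>2))"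
        by (intro sum_mono Cauchy_Schwarz_ineq_sum)
      also have "\<dots> = (\<Sum>p\<in>?I \<times> ?I. (case p of (i, j) \<Rightarrow> w i j - u i j)\<^sup>2) * (\<Sum>j\<in>?I. (v j)\<^sup>2)"
        by (simp add: sum_distrib_right sum.cartesian_product case_prod_unfold)
      finally have "L2_set (\<lambda>i. ?w i - ?u i) ?I \<le> L2_set (\<lambda>(i, j). w i j - u i j) (?I \<times> ?I) * L2_set v ?I"
        unfolding L2_set_def real_sqrt_mult[symmetric] by (rule real_sqrt_le_mono)
      also have "\<dots> \<le> e * L2_set v ?I" by (intro mult_right_mono D L2_set_nonneg)
      finally show ?thesis .
    qed
    have main: "L2_set ?u ?I \<le> op_norm W * L2_set v ?I"
    proof -
      have "(\<Sum>i\<in>?I. (?u i)\<^sup>2) \<le> (op_norm W)\<^sup>2 * (\<Sum>j\<in>?I. (v j)\<^sup>2)"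
        unfolding u_def by (rule cell_integral_matrix_bound[OF W Bm B ae N(1)])
      then have "L2_set ?u ?I \<le> sqrt ((op_norm W)\<^sup>2 * (\<Sum>j\<in>?I. (v j)\<^sup>2))"
        unfolding L2_set_def by (rule real_sqrt_le_mono)
      then show ?thesis using op0 by (simp add: L2_set_def real_sqrt_mult)
    qed
    have "L2_set ?w ?I = L2_set (\<lambda>i. ?u i + (?w i - ?u i)) ?I" by simp
    also have "\<dots> \<le> L2_set ?u ?I + L2_set (\<lambda>i. ?w i - ?u i) ?I" by (rule L2_set_triangle_ineq)
    also have "\<dots> \<le> (op_norm W + e) * L2_set v ?I" using main diff by (simp add: algebra_simps)
    finally have "(L2_set ?w ?I)\<^sup>2 \<le> ((op_norm W + e) * L2_set v ?I)\<^sup>2"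
      by (intro power_mono L2_set_nonneg)
    then show "(\<Sum>i=1..N. (\<Sum>j=1..N. grid_value W N i j / real N * v j)\<^sup>2)
        \<le> (op_norm W + e)\<^sup>2 * (\<Sum>j=1..N. (v j)\<^sup>2)"
      by (simp add: L2_set_def sum_nonneg power_mult_distrib w_def)
  qed
qed

lemma graphon_density:
  assumes W: "graphon W" and R: "riemann_integrable (\<lambda>(x, y). W x y) (0, 0) (1, 1)"
    and pos: "(LINT p|lebesgue_on ({0..1} \<times> {0..1}). (case p of (x, y) \<Rightarrow> W x y)) > 0"
  shows "\<exists>c>0. \<exists>n0. \<forall>N\<ge>n0. c * (real N)\<^sup>2 \<le> (\<Sum>i=1..N. \<Sum>j=1..N. grid_value W N i j)"
proof -
  obtain B where Bm[measurable]: "B \<in> borel_measurable borel" and B: "\<And>p. 0 \<le> B p" "\<And>p. B p \<le> 1"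
    and ae: "AE p in lborel. p \<in> {0..1} \<times> {0..1} \<longrightarrow> B p = W (fst p) (snd p)"
    using graphon_borel_version[OF W] by blast
  let ?S = "{0..1::real} \<times> {0..1::real}"
  define I where "I = (LINT p|lebesgue_on ?S. (case p of (x, y) \<Rightarrow> W x y))"
  have S: "?S \<in> sets borel" unfolding borel_prod[symmetric] by (intro pair_measureI) auto
  then have S': "?S \<in> sets lebesgue" by simp
  have n1: "{0} \<times> UNIV \<in> null_sets (lborel :: (real \<times> real) measure)"
    "UNIV \<times> {0} \<in> null_sets (lborel :: (real \<times> real) measure)"
    unfolding lborel_prod[symmetric]
    by (auto intro!: null_setsI pair_measureI simp: lborel.emeasure_pair_measure_Times)
  have ae0: "AE p in (lborel :: (real \<times> real) measure). p \<notin> {0} \<times> UNIV \<and> p \<notin> UNIV \<times> {0}"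
    by (intro eventually_conj AE_not_in n1)
  have cells: "(\<Sum>i=1..N. \<Sum>j=1..N. cell_integral B N i j) = I" if N: "N > 0" for N
  proof -
    have "(\<Sum>i=1..N. \<Sum>j=1..N. cell_integral B N i j) =
       (\<integral>p. (\<Sum>i=1..N. \<Sum>j=1..N. indicator (grid_square N i j) p * B p) \<partial>lborel)"
      unfolding cell_integral_def
      by (simp only: Bochner_Integration.integral_sum Bochner_Integration.integrable_sum
          integrable_grid_square[OF Bm B N])
    also have "\<dots> = (\<integral>p. indicator ({0<..1} \<times> {0<..1}) p * B p \<partial>lborel)"
    proof (intro Bochner_Integration.integral_cong refl)
      fix p :: "real \<times> real"
      have "(\<Sum>i=1..N. \<Sum>j=1..N. indicator (grid_square N i j) p * B p) =
        (\<Sum>i=1..N. indicator (grid_cell N i) (fst p)) * (\<Sum>j=1..N. indicator (grid_cell N j) (snd p)) * B p"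
        unfolding sum_product unfolding sum_distrib_right by (cases p) (simp only: indicator_times fst_conv snd_conv)
      also have "\<dots> = indicator ({0<..1} \<times> {0<..1}) p * B p"
        by (cases p) (simp only: sum_indicator_grid_cell[OF N] indicator_times fst_conv snd_conv)
      finally show "(\<Sum>i=1..N. \<Sum>j=1..N. indicator (grid_square N i j) p * B p) =
        indicator ({0<..1} \<times> {0<..1}) p * B p" .
    qed
    also have "\<dots> = (\<integral>p. indicator ?S p * B p \<partial>lborel)"
    proof (rule integral_cong_AE)
      have "{0<..1::real} \<times> {0<..1::real} \<in> sets borel"
        unfolding borel_prod[symmetric] by (intro pair_measureI) auto
      then show "(\<lambda>p. indicator ({0<..1} \<times> {0<..1}) p * B p) \<in> borel_measurable lborel" by simp
      show "(\<lambda>p. indicator ?S p * B p) \<in> borel_measurable lborel" using S by simp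
      show "AE p in lborel. indicator ({0<..1} \<times> {0<..1}) p * B p = indicator ?S p * B p"
        using ae0 by eventually_elim (auto simp: indicator_def)
    qed
    also have "\<dots> = (\<integral>p. indicator ?S p * B p \<partial>lebesgue)"
      using S by (intro integral_completion[symmetric]) simp
    also have "\<dots> = I"
    proof -
      have ae': "AE p in lebesgue. indicator ?S p * B p = indicator ?S p * (case p of (x, y) \<Rightarrow> W x y)"
        using AE_completion[OF ae] by eventually_elim (auto simp: indicator_def)
      have m1: "(\<lambda>p. indicator ?S p * B p) \<in> borel_measurable lebesgue"
        using S by (intro measurable_completion) simp
      have "I = (\<integral>p. indicator ?S p * (case p of (x, y) \<Rightarrow> W x y) \<partial>lebesgue)"
        unfolding I_def using S' by (subst integral_restrict_space) simp_all
      then show ?thesis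
        using ae' borel_measurable_AE[OF m1 ae'] m1 by (simp only:) (intro integral_cong_AE, auto)
    qed
    finally show ?thesis .
  qed
  have "0 < I / 2" using pos by (simp add: I_def)
  from grid_values_near_cell_integrals[OF Bm B ae R this] obtain n0 where
    n0: "\<And>N. N \<ge> n0 \<Longrightarrow> (\<Sum>i=1..N. \<Sum>j=1..N.
      \<bar>grid_value W N i j / (real N)\<^sup>2 - cell_integral B N i j\<bar>) \<le> I / 2" by blast
  show ?thesis
  proof (intro exI[of _ "I / 2"] exI[of _ "max 1 n0"] conjI allI impI)
    show "0 < I / 2" by fact
    fix N assume "max 1 n0 \<le> N"
    then have N: "N > 0" "N \<ge> n0" by auto
    let ?W = "\<lambda>i j. grid_value W N i j"
    have "I - (\<Sum>i=1..N. \<Sum>j=1..N. ?W i j / (real N)\<^sup>2) =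
       (\<Sum>i=1..N. \<Sum>j=1..N. cell_integral B N i j - ?W i j / (real N)\<^sup>2)"
      unfolding cells[OF N(1), symmetric] by (simp add: sum_subtractf)
    also have "\<dots> \<le> (\<Sum>i=1..N. \<Sum>j=1..N. \<bar>?W i j / (real N)\<^sup>2 - cell_integral B N i j\<bar>)"
      by (intro sum_mono) auto
    also have "\<dots> \<le> I / 2" by (rule n0[OF N(2)])
    finally have "I / 2 \<le> (\<Sum>i=1..N. \<Sum>j=1..N. ?W i j / (real N)\<^sup>2)" by simp
    then show "I / 2 * (real N)\<^sup>2 \<le> (\<Sum>i=1..N. \<Sum>j=1..N. ?W i j)"
      using N by (simp add: sum_divide_distrib[symmetric] pos_le_divide_eq)
  qed
qed

section \<open>Convergence of moment generating functions\<close>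

lemma not_tendsto_subseq:
  fixes X :: "nat \<Rightarrow> 'a::metric_space"
  assumes "\<not> X \<longlonglongrightarrow> L"
  obtains e r where "e > 0" "strict_mono (r :: nat \<Rightarrow> nat)" "\<And>n. dist (X (r n)) L \<ge> e"
proof -
  obtain e where e: "e > 0" "\<And>n0. \<exists>n\<ge>n0. dist (X n) L \<ge> e"
    using assms unfolding lim_sequentially by (metis not_le)
  have "infinite {n. dist (X n) L \<ge> e}"
    unfolding infinite_nat_iff_unbounded_le using e(2) by auto
  then obtain r :: "nat \<Rightarrow> nat" where "strict_mono r" "\<And>n. dist (X (r n)) L \<ge> e"
    using infinite_enumerate by blast
  with e(1) show thesis by (rule that)
qed

definition complex_mgf :: "real pmf \<Rightarrow> complex \<Rightarrow> complex" where
  "complex_mgf P z = (\<Sum>x\<in>set_pmf P. of_real (pmf P x) * exp (z * of_real x))"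

lemma complex_mgf_holomorphic: "complex_mgf P holomorphic_on A"
  unfolding complex_mgf_def by (intro holomorphic_intros)

lemma complex_mgf_of_real:
  assumes "finite (set_pmf P)"
  shows "complex_mgf P (of_real s) = of_real (measure_pmf.expectation P (\<lambda>x. exp (s * x)))"
  using assms
  by (subst integral_measure_pmf_real[of "set_pmf P"]) (auto simp: complex_mgf_def exp_of_real[symmetric] mult.commute)

lemma norm_complex_mgf_le:
  assumes "finite (set_pmf P)" "\<bar>Re z\<bar> \<le> R"
  shows "norm (complex_mgf P z) \<le> measure_pmf.expectation P (\<lambda>x. exp (R * x)) + measure_pmf.expectation P (\<lambda>x. exp (- R * x))"
proof -
  have "norm (complex_mgf P z) \<le> (\<Sum>x\<in>set_pmf P. pmf P x * (exp (R * x) + exp (- R * x)))"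
    unfolding complex_mgf_def
  proof (rule sum_norm_le)
    fix x
    have "Re z * x \<le> \<bar>Re z\<bar> * \<bar>x\<bar>" by (metis abs_ge_self abs_mult)
    also have "\<dots> \<le> R * \<bar>x\<bar>" using assms by (intro mult_right_mono) auto
    finally have "exp (Re z * x) \<le> exp (R * x) + exp (- R * x)"
      by (cases "x \<ge> 0") (auto intro: order_trans[of _ "exp (R * x)"] order_trans[of _ "exp (- R * x)"])
    then show "norm (complex_of_real (pmf P x) * exp (z * complex_of_real x)) \<le> pmf P x * (exp (R * x) + exp (- R * x))"
      by (simp add: norm_mult mult_left_mono)
  qed
  also have "\<dots> = measure_pmf.expectation P (\<lambda>x. exp (R * x)) + measure_pmf.expectation P (\<lambda>x. exp (- R * x))"
    using assms(1) by (subst (1 2) integral_measure_pmf_real[of "set_pmf P"]) (auto simp: sum.distrib algebra_simps)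
  finally show ?thesis .
qed

text \<open>
  Vitali's argument: the functions are entire and locally bounded, because on a vertical line they are largest
  at the real point. By Montel's theorem every subsequence has a locally uniformly convergent subsequence; the
  limit agrees with \<open>exp (z\<^sup>2 / 2)\<close> on the real line and hence everywhere.
\<close>

lemma complex_mgf_tendsto:
  fixes P :: "nat \<Rightarrow> real pmf"
  assumes fin: "\<And>n. finite (set_pmf (P n))"
    and mgf: "\<And>s. (\<lambda>n. measure_pmf.expectation (P n) (\<lambda>x. exp (s * x))) \<longlonglongrightarrow> exp (s\<^sup>2 / 2)"
  shows "(\<lambda>n. complex_mgf (P n) z) \<longlonglongrightarrow> exp (z\<^sup>2 / 2)"
proof (rule ccontr)
  assume "\<not> ?thesis"
  then obtain e r where e: "e > 0" and r: "strict_mono (r :: nat \<Rightarrow> nat)"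
    and far: "\<And>n. dist (complex_mgf (P (r n)) z) (exp (z\<^sup>2 / 2)) \<ge> e"
    using not_tendsto_subseq by blast
  define F where "F = (\<lambda>n. complex_mgf (P (r n)))"
  have bounded: "\<exists>B. \<forall>h\<in>range F. \<forall>z\<in>K. norm (h z) \<le> B" if K: "compact K" for K
  proof -
    obtain R where R: "\<And>z. z \<in> K \<Longrightarrow> norm z \<le> R"
      using compact_imp_bounded[OF K] unfolding bounded_iff by blast
    have "Bseq (\<lambda>n. measure_pmf.expectation (P n) (\<lambda>x. exp (R * x)) + measure_pmf.expectation (P n) (\<lambda>x. exp (- R * x)))"
      by (intro convergent_imp_Bseq convergent_add) (use mgf convergent_def in blast)+
    then obtain B where B: "\<And>n. norm (measure_pmf.expectation (P n) (\<lambda>x. exp (R * x)) + measure_pmf.expectation (P n) (\<lambda>x. exp (- R * x))) \<le> B"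
      unfolding Bseq_def by blast
    show ?thesis
    proof (intro exI ballI)
      fix h z assume "h \<in> range F" "z \<in> K"
      then obtain n where h: "h = complex_mgf (P (r n))" by (auto simp: F_def)
      have "\<bar>Re z\<bar> \<le> R" using R[OF \<open>z \<in> K\<close>] abs_Re_le_cmod[of z] by linarith
      from norm_complex_mgf_le[OF fin this, of "r n"] B[of "r n"]
      show "norm (h z) \<le> B" unfolding h real_norm_def by linarith
    qed
  qed
  obtain g q where g: "g holomorphic_on UNIV" and q: "strict_mono (q :: nat \<Rightarrow> nat)"
    and lim: "\<And>x. (\<lambda>n. F (q n) x) \<longlonglongrightarrow> g x"
  proof (rule Montel[of UNIV "range F" F])
    show "h holomorphic_on UNIV" if "h \<in> range F" for h
      using that complex_mgf_holomorphic by (auto simp: F_def)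
    show "\<exists>B. \<forall>h\<in>range F. \<forall>z\<in>K. norm (h z) \<le> B" if "compact K" for K
      using that by (rule bounded)
  qed (use that in auto)
  have real_val: "g (of_real s) = exp ((of_real s)\<^sup>2 / 2)" for s :: real
  proof -
    have "strict_mono (r \<circ> q)" using r q by (rule strict_mono_o)
    from LIMSEQ_subseq_LIMSEQ[OF mgf this]
    have "(\<lambda>n. measure_pmf.expectation (P (r (q n))) (\<lambda>x. exp (s * x))) \<longlonglongrightarrow> exp (s\<^sup>2 / 2)" by (simp add: o_def)
    from tendsto_of_real[OF this, where 'a = complex]
    have "(\<lambda>n. F (q n) (of_real s)) \<longlonglongrightarrow> of_real (exp (s\<^sup>2 / 2))"
      by (simp add: F_def complex_mgf_of_real[OF fin])
    then have "g (of_real s) = of_real (exp (s\<^sup>2 / 2))" using lim LIMSEQ_unique by blast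
    then show ?thesis by (simp add: exp_of_real[symmetric])
  qed
  have "g z - exp (z\<^sup>2 / 2) = 0"
  proof (rule analytic_continuation[where f = "\<lambda>z. g z - exp (z\<^sup>2 / 2)" and S = UNIV and U = "\<real>" and \<xi> = 0])
    show "(\<lambda>z. g z - exp (z\<^sup>2 / 2)) holomorphic_on UNIV"
      by (intro holomorphic_intros g) auto
    show "(0::complex) islimpt \<real>"
      unfolding islimpt_approachable
    proof (intro allI impI)
      fix e :: real assume "e > 0"
      then show "\<exists>x'\<in>\<real>. x' \<noteq> 0 \<and> dist x' (0::complex) < e"
        by (intro bexI[of _ "of_real (e / 2)"]) auto
    qed
    show "g z - exp (z\<^sup>2 / 2) = 0" if "z \<in> \<real>" for z
      using that real_val by (auto elim!: Reals_cases)
  qed auto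
  then have "(\<lambda>n. F (q n) z) \<longlonglongrightarrow> exp (z\<^sup>2 / 2)" using lim[of z] by simp
  then have "eventually (\<lambda>n. dist (F (q n) z) (exp (z\<^sup>2 / 2)) < e) sequentially"
    using e by (rule tendstoD)
  then show False using far unfolding F_def eventually_sequentially by (meson le_refl not_le)
qed

text \<open>
  On the imaginary axis the moment generating functions are characteristic functions, so the Levy continuity
  theorem applies.
\<close>

lemma mgf_convergence_imp_weak_convergence:
  fixes P :: "nat \<Rightarrow> real pmf"
  assumes fin: "\<And>n. finite (set_pmf (P n))"
    and mgf: "\<And>s. (\<lambda>n. measure_pmf.expectation (P n) (\<lambda>x. exp (s * x))) \<longlonglongrightarrow> exp (s\<^sup>2 / 2)"
  shows "weak_conv_m (\<lambda>n. distr (measure_pmf (P n)) borel (\<lambda>x. x)) std_normal_distribution"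
proof (rule levy_continuity)
  show "real_distribution (distr (measure_pmf (P n)) borel (\<lambda>x. x))" for n
    by (rule prob_space.real_distribution_distr[OF prob_space_measure_pmf]) simp
  show "real_distribution std_normal_distribution" by (rule real_dist_normal_dist)
  fix t :: real
  have "char (distr (measure_pmf (P n)) borel (\<lambda>x. x)) t = complex_mgf (P n) (\<i> * of_real t)" for n
  proof -
    have "char (distr (measure_pmf (P n)) borel (\<lambda>x. x)) t = (\<integral>x. iexp (t * x) \<partial>measure_pmf (P n))"
      unfolding char_def by (subst integral_distr) auto
    also have "\<dots> = (\<Sum>x\<in>set_pmf (P n). pmf (P n) x *\<^sub>R iexp (t * x))"
      by (rule integral_measure_pmf[OF fin]) auto
    finally show ?thesis by (simp add: complex_mgf_def scaleR_conv_of_real mult_ac)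
  qed
  moreover have "exp ((\<i> * of_real t)\<^sup>2 / 2) = char std_normal_distribution t"
    by (simp add: char_std_normal_distribution power_mult_distrib exp_of_real[symmetric])
  ultimately show "(\<lambda>n. char (distr (measure_pmf (P n)) borel (\<lambda>x. x)) t) \<longlonglongrightarrow> char std_normal_distribution t"
    using complex_mgf_tendsto[OF assms, of "\<i> * of_real t"] by simp
qed

lemma std_normal_singleton: "emeasure std_normal_distribution {x} = 0"
  by (subst emeasure_density) (auto simp: nn_integral_indicator_singleton')

lemma std_normal_symmetric:
  "measure std_normal_distribution {..<-x} = measure std_normal_distribution {x<..}"
proof -
  have "emeasure std_normal_distribution {..<-x} = (\<integral>\<^sup>+y. ennreal (std_normal_density y) * indicator {..<-x} y \<partial>lborel)"
    by (subst emeasure_density) auto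
  also have "\<dots> = (\<integral>\<^sup>+y. ennreal (std_normal_density y) * indicator {..<-x} y \<partial>distr lborel borel uminus)"
    by (simp add: lborel_distr_uminus)
  also have "\<dots> = (\<integral>\<^sup>+y. ennreal (std_normal_density (- y)) * indicator {..<-x} (- y) \<partial>lborel)"
    by (subst nn_integral_distr) auto
  also have "\<dots> = (\<integral>\<^sup>+y. ennreal (std_normal_density y) * indicator {x<..} y \<partial>lborel)"
    by (intro nn_integral_cong) (auto simp: std_normal_density_def indicator_def)
  also have "\<dots> = emeasure std_normal_distribution {x<..}"
    by (subst emeasure_density) auto
  finally show ?thesis by (simp add: measure_def)
qed

lemma cdf_normal_z:
  assumes "0 < a" "a < 1"
  shows "cdf std_normal_distribution (normal_z a) = 1 - a"
proof -
  interpret N: real_distribution std_normal_distribution by (rule real_dist_normal_dist)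
  let ?F = "cdf std_normal_distribution"
  have cont: "isCont ?F x" for x
    using std_normal_singleton[of x] by (simp add: N.isCont_cdf measure_def)
  have "eventually (\<lambda>x. ?F x > 1 - a) at_top"
    using N.cdf_lim_at_top_prob assms by (intro order_tendstoD(1)[of ?F 1]) auto
  then obtain u where u: "?F u > 1 - a" by (auto simp: eventually_at_top_linorder)
  have "eventually (\<lambda>x. ?F x < 1 - a) at_bot"
    using N.cdf_lim_at_bot assms by (intro order_tendstoD(2)[of ?F 0]) auto
  then obtain l where l: "\<And>x. x \<le> l \<Longrightarrow> ?F x < 1 - a" by (auto simp: eventually_at_bot_linorder)
  have "l \<le> u" using u l[of u] by (cases "l \<le> u") auto
  then obtain x where x: "?F x = 1 - a"
    using IVT[of ?F l "1 - a" u] u l[of l] cont by fastforce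
  let ?A = "{x. ?F x \<ge> 1 - a}"
  have bdd: "bdd_below ?A" using l by (intro bdd_belowI[of _ l]) (metis mem_Collect_eq linorder_le_cases not_le)
  have "closed ?A" using cont by (intro closed_Collect_le continuous_intros) (simp add: continuous_at_imp_continuous_on)
  then have "Inf ?A \<in> ?A" using x bdd by (intro closed_contains_Inf) (auto intro!: exI[of _ x])
  moreover have "?F (Inf ?A) \<le> ?F x" using x bdd by (intro N.cdf_nondecreasing cInf_lower) auto
  ultimately show ?thesis using x by (simp add: normal_z_def)
qed

lemma normal_z_two_sided:
  assumes "0 < \<alpha>" "\<alpha> < 1"
  shows "measure std_normal_distribution ({..<- normal_z (\<alpha> / 2)} \<union> {normal_z (\<alpha> / 2)<..}) = \<alpha>"
    and "0 \<le> normal_z (\<alpha> / 2)"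
proof -
  interpret N: real_distribution std_normal_distribution by (rule real_dist_normal_dist)
  let ?z = "normal_z (\<alpha> / 2)"
  have cdf: "measure std_normal_distribution {..?z} = 1 - \<alpha> / 2"
    using cdf_normal_z[of "\<alpha> / 2"] assms by (simp add: cdf_def)
  have "{?z<..} = space std_normal_distribution - {..?z}" by auto
  then have up: "measure std_normal_distribution {?z<..} = \<alpha> / 2"
    using N.prob_compl[of "{..?z}"] cdf by simp
  show z: "0 \<le> ?z"
  proof (rule ccontr)
    assume "\<not> 0 \<le> ?z"
    then have "measure std_normal_distribution {..?z} \<le> measure std_normal_distribution {..<-?z}"
      by (intro N.finite_measure_mono) auto
    then show False using std_normal_symmetric[of ?z] up cdf assms by simp
  qed
  have "measure std_normal_distribution ({..<- ?z} \<union> {?z<..}) =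
      measure std_normal_distribution {..<- ?z} + measure std_normal_distribution {?z<..}"
    using z by (intro N.finite_measure_Union) auto
  then show "measure std_normal_distribution ({..<- ?z} \<union> {?z<..}) = \<alpha>"
    by (simp add: std_normal_symmetric up)
qed

lemma two_sided_level_limit:
  fixes P :: "nat \<Rightarrow> real pmf"
  assumes "0 < \<alpha>" "\<alpha> < 1" and fin: "\<And>n. finite (set_pmf (P n))"
    and mgf: "\<And>s. (\<lambda>n. measure_pmf.expectation (P n) (\<lambda>x. exp (s * x))) \<longlonglongrightarrow> exp (s\<^sup>2 / 2)"
  shows "(\<lambda>n. measure_pmf.prob (P n) ({..<- normal_z (\<alpha> / 2)} \<union> {normal_z (\<alpha> / 2)<..})) \<longlonglongrightarrow> \<alpha>"
proof -
  interpret N: real_distribution std_normal_distribution by (rule real_dist_normal_dist)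
  let ?z = "normal_z (\<alpha> / 2)" and ?M = "\<lambda>n. distr (measure_pmf (P n)) borel (\<lambda>x. x)"
  let ?A = "{..<- ?z} \<union> {?z<..}"
  have rd: "real_distribution (?M n)" for n
    by (rule prob_space.real_distribution_distr[OF prob_space_measure_pmf]) simp
  have "frontier ?A \<subseteq> {- ?z} \<union> {?z}"
    using frontier_Un_subset[of "{..<- ?z}" "{?z<..}"] by auto
  then have "emeasure std_normal_distribution (frontier ?A) \<le> emeasure std_normal_distribution ({- ?z} \<union> {?z})"
    by (intro emeasure_mono) auto
  also have "\<dots> \<le> emeasure std_normal_distribution {- ?z} + emeasure std_normal_distribution {?z}"
    by (intro emeasure_subadditive) auto
  finally have "emeasure std_normal_distribution (frontier ?A) = 0" by (simp only: std_normal_singleton) simp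
  from weak_conv_imp_continuity_set_conv[OF rd real_dist_normal_dist mgf_convergence_imp_weak_convergence[OF fin mgf] _ this]
  have "(\<lambda>n. measure (?M n) ?A) \<longlonglongrightarrow> \<alpha>"
    using normal_z_two_sided[OF assms(1,2)] by simp
  moreover have "measure (?M n) ?A = measure_pmf.prob (P n) ?A" for n
    by (subst measure_distr) auto
  ultimately show ?thesis by simp
qed

text \<open>
  The quantitative form that can be applied graph by graph: the law of the standardised Hamiltonian is random,
  and this statement turns its closeness to the normal law into a condition on a single graph, with tolerances
  independent of the graph. It follows from \<open>two_sided_level_limit\<close> by contradiction, choosing a
  counterexample for every \<open>e = 1 / (n + 1)\<close> and \<open>R = n + 1\<close>.
\<close>

lemma two_sided_level_stability:
  assumes \<alpha>: "0 < \<alpha>" "\<alpha> < 1" and \<epsilon>: "\<epsilon> > 0"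
  shows "\<exists>e>0. \<exists>R>0. \<forall>P :: real pmf. finite (set_pmf P) \<longrightarrow>
    (\<forall>s. \<bar>s\<bar> \<le> R \<longrightarrow> \<bar>measure_pmf.expectation P (\<lambda>x. exp (s * x)) - exp (s\<^sup>2 / 2)\<bar> \<le> e) \<longrightarrow>
    \<bar>measure_pmf.prob P ({..<- normal_z (\<alpha> / 2)} \<union> {normal_z (\<alpha> / 2)<..}) - \<alpha>\<bar> \<le> \<epsilon>"
proof (rule ccontr)
  let ?A = "{..<- normal_z (\<alpha> / 2)} \<union> {normal_z (\<alpha> / 2)<..}"
  assume "\<not> ?thesis"
  then have "\<exists>P :: real pmf. finite (set_pmf P) \<and>
    (\<forall>s. \<bar>s\<bar> \<le> R \<longrightarrow> \<bar>measure_pmf.expectation P (\<lambda>x. exp (s * x)) - exp (s\<^sup>2 / 2)\<bar> \<le> e) \<and>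
    \<epsilon> < \<bar>measure_pmf.prob P ?A - \<alpha>\<bar>" if "e > 0" "R > 0" for e R
    using that by (simp add: not_le)
  then have "\<forall>n. \<exists>P :: real pmf. finite (set_pmf P) \<and>
    (\<forall>s. \<bar>s\<bar> \<le> real (Suc n) \<longrightarrow> \<bar>measure_pmf.expectation P (\<lambda>x. exp (s * x)) - exp (s\<^sup>2 / 2)\<bar> \<le> 1 / real (Suc n)) \<and>
    \<epsilon> < \<bar>measure_pmf.prob P ?A - \<alpha>\<bar>" by simp
  then obtain P :: "nat \<Rightarrow> real pmf" where P: "\<And>n. finite (set_pmf (P n))"
    "\<And>n s. \<bar>s\<bar> \<le> real (Suc n) \<Longrightarrow> \<bar>measure_pmf.expectation (P n) (\<lambda>x. exp (s * x)) - exp (s\<^sup>2 / 2)\<bar> \<le> 1 / real (Suc n)"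
    "\<And>n. \<epsilon> < \<bar>measure_pmf.prob (P n) ?A - \<alpha>\<bar>"
    by metis
  have "(\<lambda>n. measure_pmf.expectation (P n) (\<lambda>x. exp (s * x))) \<longlonglongrightarrow> exp (s\<^sup>2 / 2)" for s
  proof (rule LIM_zero_cancel, rule Lim_null_comparison)
    obtain n0 where "\<bar>s\<bar> \<le> real n0" using real_arch_simple by blast
    then show "eventually (\<lambda>n. norm (measure_pmf.expectation (P n) (\<lambda>x. exp (s * x)) - exp (s\<^sup>2 / 2)) \<le> 1 / real (Suc n)) sequentially"
      using P(2)[of s] by (intro eventually_sequentiallyI[of n0]) auto
    show "(\<lambda>n. 1 / real (Suc n)) \<longlonglongrightarrow> 0"
      by (rule LIMSEQ_Suc[OF lim_1_over_n])
  qed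
  from tendstoD[OF two_sided_level_limit[OF \<alpha> P(1) this] \<epsilon>]
  obtain n where "dist (measure_pmf.prob (P n) ?A) \<alpha> < \<epsilon>"
    unfolding eventually_sequentially by blast
  then show False using P(3)[of n] by (simp add: dist_real_def)
qed

section \<open>Expansion of the log-partition function\<close>

definition adjacency :: "(nat \<Rightarrow> nat \<Rightarrow> real) \<Rightarrow> bool" where
  "adjacency A \<longleftrightarrow> (\<forall>i j. A i j = A j i \<and> A i j \<in> {0, 1})"

definition loop_count :: "nat \<Rightarrow> (nat \<Rightarrow> nat \<Rightarrow> real) \<Rightarrow> real" where
  "loop_count N A = (\<Sum>i=1..N. A i i)"

definition edge_count :: "nat \<Rightarrow> (nat \<Rightarrow> nat \<Rightarrow> real) \<Rightarrow> real" where
  "edge_count N A = (\<Sum>(i, j)\<in>edges N. A i j)"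

definition even_subgraph_sum :: "nat \<Rightarrow> (nat \<Rightarrow> nat \<Rightarrow> real) \<Rightarrow> real \<Rightarrow> real" where
  "even_subgraph_sum N A u = graph_sum N (edges N) (\<lambda>(i, j). u * A i j) (\<lambda>k. 0)"

lemma adjacency_nonneg: "adjacency A \<Longrightarrow> 0 \<le> A i j"
  unfolding adjacency_def by (metis insertE order_refl singletonD zero_le_one)

lemma symmetric_double_sum:
  fixes f :: "nat \<Rightarrow> nat \<Rightarrow> real"
  assumes "\<And>i j. f i j = f j i"
  shows "(\<Sum>i=1..N. \<Sum>j=1..N. f i j) = (\<Sum>i=1..N. f i i) + 2 * (\<Sum>(i, j)\<in>edges N. f i j)"
proof -
  let ?g = "\<lambda>(i, j). f i j"
  let ?D = "(\<lambda>i. (i, i)) ` {1..N}" and ?S = "prod.swap ` edges N"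
  have dec: "{1..N} \<times> {1..N} = ?D \<union> (edges N \<union> ?S)"
  proof (intro equalityI subsetI)
    fix p assume "p \<in> {1..N} \<times> {1..N}"
    then obtain i j where p: "p = (i, j)" "i \<in> {1..N}" "j \<in> {1..N}" by blast
    consider "i = j" | "(i, j) \<in> edges N" | "(j, i) \<in> edges N"
      using p by (fastforce simp: edges_def)
    then show "p \<in> ?D \<union> (edges N \<union> ?S)"
    proof cases
      case 3
      then have "(i, j) \<in> ?S" using image_eqI[of "(i, j)" prod.swap "(j, i)"] by simp
      then show ?thesis using p by simp
    qed (use p in auto)
  qed (auto simp: edges_def)
  have "(\<Sum>i=1..N. \<Sum>j=1..N. f i j) = sum ?g ({1..N} \<times> {1..N})" by (simp add: sum.cartesian_product)
  also have "\<dots> = sum ?g ?D + (sum ?g (edges N) + sum ?g ?S)"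
    unfolding dec using finite_edges[of N]
    by (subst sum.union_disjoint, simp, simp, fastforce simp: edges_def)
      (subst sum.union_disjoint, auto simp: edges_def)
  also have "sum ?g ?D = (\<Sum>i=1..N. f i i)" by (subst sum.reindex) (auto simp: inj_on_def)
  also have "sum ?g ?S = sum ?g (edges N)"
    using assms by (subst sum.reindex) (auto simp: case_prod_unfold intro!: sum.cong)
  finally show ?thesis by simp
qed

text \<open>
  The high-temperature expansion. The identity \<open>exp (b * s) = cosh b * (1 + s * tanh b)\<close> for
  \<open>s = 1\<close> or \<open>s = -1\<close> is applied to every edge; a loop contributes a constant since
  spins have square 1.
\<close>

lemma partition_function_expansion:
  fixes \<beta> t :: real and N :: nat
  assumes A: "adjacency A"
  defines "b \<equiv> \<beta> / (real N * t)"
  shows "partition_function N t A \<beta> =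
    exp (b / 2 * loop_count N A + edge_count N A * ln (cosh b)) * even_subgraph_sum N A (tanh b)"
proof -
  have sym: "A i j = A j i" and A01: "A i j = 0 \<or> A i j = 1" for i j
    using A by (auto simp: adjacency_def)
  have weight: "exp (- \<beta> * hamiltonian N t A \<sigma>) =
     exp (b / 2 * loop_count N A + edge_count N A * ln (cosh b)) *
     (\<Prod>e\<in>edges N. 1 + (\<lambda>(i, j). tanh b * A i j) e * (\<sigma> (fst e) * \<sigma> (snd e)))"
    if \<sigma>: "\<sigma> \<in> spins N" for \<sigma>
  proof -
    have "(\<Sum>i=1..N. \<Sum>j=1..N. A i j * \<sigma> i * \<sigma> j) =
        (\<Sum>i=1..N. A i i * \<sigma> i * \<sigma> i) + 2 * (\<Sum>(i, j)\<in>edges N. A i j * \<sigma> i * \<sigma> j)"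
      by (rule symmetric_double_sum) (simp add: sym mult_ac)
    also have "(\<Sum>i=1..N. A i i * \<sigma> i * \<sigma> i) = loop_count N A"
      unfolding loop_count_def
    proof (rule sum.cong[OF refl])
      fix i assume "i \<in> {1..N}"
      then show "A i i * \<sigma> i * \<sigma> i = A i i" using spin_cases[OF \<sigma>, of i] by auto
    qed
    finally have ham: "- \<beta> * hamiltonian N t A \<sigma> =
        b / 2 * loop_count N A + b * (\<Sum>(i, j)\<in>edges N. A i j * \<sigma> i * \<sigma> j)"
      by (simp add: hamiltonian_def b_def algebra_simps add_divide_distrib)
    have edge: "exp (b * (A i j * \<sigma> i * \<sigma> j)) =
        exp (A i j * ln (cosh b)) * (1 + tanh b * A i j * (\<sigma> i * \<sigma> j))" if "(i, j) \<in> edges N" for i j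
    proof -
      have "i \<in> {1..N}" "j \<in> {1..N}" using that by (auto simp: edges_def)
      then have s: "\<sigma> i * \<sigma> j = 1 \<or> \<sigma> i * \<sigma> j = -1"
        using spin_cases[OF \<sigma>, of i] spin_cases[OF \<sigma>, of j] by auto
      have "cosh b > 0" by (rule cosh_real_pos)
      then have "cosh b * (1 + tanh b) = exp b" "cosh b * (1 - tanh b) = exp (- b)"
        by (auto simp: tanh_def algebra_simps cosh_plus_sinh cosh_minus_sinh)
      then show ?thesis using A01[of i j] s \<open>cosh b > 0\<close> by (auto simp: mult.assoc)
    qed
    have "exp (b * (\<Sum>(i, j)\<in>edges N. A i j * \<sigma> i * \<sigma> j)) = (\<Prod>(i, j)\<in>edges N. exp (b * (A i j * \<sigma> i * \<sigma> j)))"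
      using finite_edges by (simp add: sum_distrib_left exp_sum case_prod_unfold)
    also have "\<dots> = (\<Prod>(i, j)\<in>edges N. exp (A i j * ln (cosh b)) * (1 + tanh b * A i j * (\<sigma> i * \<sigma> j)))"
      using edge by (intro prod.cong) auto
    also have "\<dots> = exp (edge_count N A * ln (cosh b)) *
        (\<Prod>e\<in>edges N. 1 + (\<lambda>(i, j). tanh b * A i j) e * (\<sigma> (fst e) * \<sigma> (snd e)))"
      using finite_edges by (simp add: case_prod_unfold prod.distrib exp_sum edge_count_def sum_distrib_right)
    finally show ?thesis unfolding ham exp_add by (simp add: mult_ac)
  qed
  have "spin_monomial N (\<lambda>k. 0) \<sigma> = 1" for \<sigma> by (simp add: spin_monomial_def)
  then show ?thesis
    unfolding partition_function_def even_subgraph_sum_def graph_sum_def spin_average_def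
    using weight by (simp add: sum_distrib_left)
qed

lemma even_subgraph_sum_ge_one:
  assumes "adjacency A" "0 \<le> u" shows "1 \<le> even_subgraph_sum N A u"
proof -
  have "0 \<le> A i j" for i j by (rule adjacency_nonneg[OF assms(1)])
  then show ?thesis
    unfolding even_subgraph_sum_def using assms(2) finite_edges edges_subset
    by (intro graph_sum_ge_one) auto
qed

lemma even_subgraph_sum_mono:
  assumes "adjacency A" "0 \<le> u" "u \<le> v"
  shows "even_subgraph_sum N A u \<le> even_subgraph_sum N A v"
proof -
  have "0 \<le> A i j" for i j by (rule adjacency_nonneg[OF assms(1)])
  then show ?thesis
    unfolding even_subgraph_sum_def using assms finite_edges edges_subset
    by (intro graph_sum_mono) (auto intro!: mult_right_mono)
qed

lemma scaled_edge_sum_eq: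
  assumes "adjacency A"
  shows "scaled_edge_sum N t A = (loop_count N A + 2 * edge_count N A) / (2 * (real N)\<^sup>2 * t\<^sup>2)"
  using symmetric_double_sum[of A N] assms
  by (simp add: scaled_edge_sum_def adjacency_def loop_count_def edge_count_def)

lemma tanh_bounds:
  fixes x :: real
  assumes "0 \<le> x"
  shows "tanh x \<le> x" "x - x ^ 3 \<le> tanh x"
proof -
  have d: "(tanh has_real_derivative 1 - (tanh x)\<^sup>2) (at x)" for x :: real
    by (auto intro!: derivative_eq_intros)
  have le: "tanh x \<le> x" if "0 \<le> x" for x :: real
  proof -
    have "(\<lambda>x. x - tanh x) 0 \<le> (\<lambda>x. x - tanh x) x"
      by (rule DERIV_nonneg_imp_nondecreasing[OF that]) (auto intro!: derivative_eq_intros exI d)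
    then show ?thesis by simp
  qed
  then show "tanh x \<le> x" using assms by blast
  have "(\<lambda>x. tanh x - (x - x ^ 3)) 0 \<le> (\<lambda>x. tanh x - (x - x ^ 3)) x"
  proof (rule DERIV_nonneg_imp_nondecreasing[OF assms])
    fix y :: real assume y: "0 \<le> y"
    have "(tanh y)\<^sup>2 \<le> y\<^sup>2" using le[OF y] y by (intro power_mono) auto
    then have "0 \<le> 1 - (tanh y)\<^sup>2 - (1 - 3 * y\<^sup>2)" using zero_le_power2[of y] by linarith
    moreover have "((\<lambda>x. tanh x - (x - x ^ 3)) has_real_derivative 1 - (tanh y)\<^sup>2 - (1 - 3 * y\<^sup>2)) (at y)"
      by (auto intro!: derivative_eq_intros simp: power2_eq_square)
    ultimately show "\<exists>z. ((\<lambda>x. tanh x - (x - x ^ 3)) has_real_derivative z) (at y) \<and> 0 \<le> z" by blast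
  qed
  then show "x - x ^ 3 \<le> tanh x" by simp
qed

lemma tanh_diff_le:
  fixes x y :: real
  assumes "x \<le> y" shows "tanh y - tanh x \<le> y - x"
proof -
  have "(\<lambda>x. x - tanh x) x \<le> (\<lambda>x. x - tanh x) y"
    by (rule DERIV_nonneg_imp_nondecreasing[OF assms]) (auto intro!: derivative_eq_intros exI)
  then show ?thesis by simp
qed

text \<open>
  The derivative of \<open>ln (cosh x) - x\<^sup>2 / 2\<close> is \<open>tanh x - x\<close>, which is at most
  \<open>x ^ 3\<close> in absolute value.
\<close>

lemma ln_cosh_increment:
  fixes a b B :: real
  assumes "0 \<le> a" "a \<le> B" "0 \<le> b" "b \<le> B"
  shows "\<bar>ln (cosh b) - ln (cosh a) - (b\<^sup>2 - a\<^sup>2) / 2\<bar> \<le> \<bar>b - a\<bar> * B ^ 3"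
proof -
  define g where "g = (\<lambda>x::real. ln (cosh x) - x\<^sup>2 / 2)"
  have g: "(g has_real_derivative tanh x - x) (at x)" for x
    unfolding g_def by (auto intro!: derivative_eq_intros simp: tanh_def cosh_real_nonzero)
  have "norm (g b - g a) \<le> B ^ 3 * norm (b - a)"
  proof (rule field_differentiable_bound[where S = "{0..B}" and f' = "\<lambda>x. tanh x - x"])
    show "(g has_field_derivative tanh x - x) (at x within {0..B})" for x
      by (rule has_field_derivative_at_within[OF g])
    fix x assume x: "x \<in> {0..B}"
    have "x ^ 3 \<le> B ^ 3" using x by (intro power_mono) auto
    moreover have "tanh x \<le> x" "x - x ^ 3 \<le> tanh x" using tanh_bounds[of x] x by auto
    ultimately show "norm (tanh x - x) \<le> B ^ 3" unfolding real_norm_def by linarith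
  qed (use assms in auto)
  then show ?thesis by (simp add: g_def diff_divide_distrib mult.commute algebra_simps)
qed

text \<open>
  A bound for the deviation of \<open>ln Z\<close> from its quadratic expansion on the window of radius
  \<open>h\<close>. Its four terms are the linear contribution of the loops, the loops counted by the scaled
  edge sum but absent from the quadratic term, the Taylor remainder of \<open>ln (cosh x)\<close>, and the
  increment of the even subgraph sum.
\<close>

definition expansion_error :: "nat \<Rightarrow> real \<Rightarrow> real \<Rightarrow> real \<Rightarrow> (nat \<Rightarrow> nat \<Rightarrow> real) \<Rightarrow> real" where
  "expansion_error N t \<beta>\<^sub>0 h A =
     h / (2 * real N * t) * loop_count N A
     + 3 * \<beta>\<^sub>0 * h / (4 * (real N * t)\<^sup>2) * loop_count N A
     + h * (2 * \<beta>\<^sub>0) ^ 3 / (real N * t) ^ 4 * edge_count N A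
     + (even_subgraph_sum N A (tanh ((\<beta>\<^sub>0 + h) / (real N * t))) - even_subgraph_sum N A (tanh ((\<beta>\<^sub>0 - h) / (real N * t))))"

lemma partition_function_pos: "partition_function N t A \<beta> > 0"
proof -
  have "spins N \<noteq> {}" using card_spins[of N] by auto
  then show ?thesis unfolding partition_function_def using finite_spins by (auto intro!: divide_pos_pos sum_pos)
qed

text \<open>
  The even subgraph sum enters through its logarithm. As the sum is at least 1 the logarithm is 1-Lipschitz
  there, and by monotonicity the two ends of the window control every point in it; so a single random variable
  bounds the error uniformly.
\<close>

lemma ln_partition_function_increment:
  assumes A: "adjacency A" and N: "N > 0" and t: "t > 0" and h: "0 \<le> h" "h \<le> \<beta>\<^sub>0" and \<beta>: "\<bar>\<beta> - \<beta>\<^sub>0\<bar> \<le> h"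
  shows "\<bar>ln (partition_function N t A \<beta>) - ln (partition_function N t A \<beta>\<^sub>0)
      - (\<beta>\<^sup>2 - \<beta>\<^sub>0\<^sup>2) / 2 * scaled_edge_sum N t A\<bar> \<le> expansion_error N t \<beta>\<^sub>0 h A"
proof -
  define s where "s = real N * t"
  have s: "s > 0" using N t by (simp add: s_def)
  let ?D = "loop_count N A" and ?E = "edge_count N A" and ?X = "even_subgraph_sum N A"
  have A0: "0 \<le> A i j" for i j by (rule adjacency_nonneg[OF A])
  have D0: "0 \<le> ?D" and E0: "0 \<le> ?E"
    using A0 by (auto simp: loop_count_def edge_count_def intro!: sum_nonneg)
  have \<beta>s: "0 \<le> \<beta>" "\<beta> \<le> 2 * \<beta>\<^sub>0" "0 \<le> \<beta>\<^sub>0" using h \<beta> by linarith+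
  have tanh0: "0 \<le> tanh (c / s)" if "0 \<le> c" for c using that s by simp
  have lnZ: "ln (partition_function N t A c) = c / s / 2 * ?D + ?E * ln (cosh (c / s)) + ln (?X (tanh (c / s)))"
    if "0 \<le> c" for c
  proof -
    have "?X (tanh (c / s)) > 0" using even_subgraph_sum_ge_one[OF A tanh0[OF that], of N] by linarith
    then show ?thesis unfolding partition_function_expansion[OF A] s_def by (simp add: ln_mult)
  qed
  have X: "\<bar>ln (?X (tanh (\<beta> / s))) - ln (?X (tanh (\<beta>\<^sub>0 / s)))\<bar> \<le> ?X (tanh ((\<beta>\<^sub>0 + h) / s)) - ?X (tanh ((\<beta>\<^sub>0 - h) / s))"
  proof -
    have X1: "1 \<le> ?X (tanh ((\<beta>\<^sub>0 - h) / s))" using h by (intro even_subgraph_sum_ge_one[OF A] tanh0) simp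
    have mono: "?X (tanh ((\<beta>\<^sub>0 - h) / s)) \<le> ?X (tanh (c / s)) \<and> ?X (tanh (c / s)) \<le> ?X (tanh ((\<beta>\<^sub>0 + h) / s))"
      if "\<bar>c - \<beta>\<^sub>0\<bar> \<le> h" for c
    proof -
      have "\<beta>\<^sub>0 - h \<le> c" "c \<le> \<beta>\<^sub>0 + h" using that by linarith+
      then have "(\<beta>\<^sub>0 - h) / s \<le> c / s" "c / s \<le> (\<beta>\<^sub>0 + h) / s" using s by (auto intro: divide_right_mono)
      then have le: "tanh ((\<beta>\<^sub>0 - h) / s) \<le> tanh (c / s)" "tanh (c / s) \<le> tanh ((\<beta>\<^sub>0 + h) / s)"
        by (simp_all only: tanh_real_le_iff)
      have "0 \<le> c" "0 \<le> \<beta>\<^sub>0 - h" using that h by linarith+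
      then have "0 \<le> tanh (c / s)" "0 \<le> tanh ((\<beta>\<^sub>0 - h) / s)" by (simp_all only: tanh0)
      then show ?thesis using even_subgraph_sum_mono[OF A _ le(1)] even_subgraph_sum_mono[OF A _ le(2)] by blast
    qed
    have lip: "ln y - ln x \<le> y - x" if "1 \<le> x" "x \<le> y" for x y :: real
    proof -
      have "ln y - ln x = ln (y / x)" using that by (simp add: ln_div)
      also have "\<dots> \<le> y / x - 1" using that by (intro ln_le_minus_one) auto
      also have "\<dots> = (y - x) / x" using that by (simp add: diff_divide_distrib)
      also have "\<dots> \<le> (y - x) / 1" using that by (intro divide_left_mono) auto
      finally show ?thesis by simp
    qed
    define lo hi x y where "lo = ?X (tanh ((\<beta>\<^sub>0 - h) / s))" and "hi = ?X (tanh ((\<beta>\<^sub>0 + h) / s))"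
      and "x = ?X (tanh (\<beta> / s))" and "y = ?X (tanh (\<beta>\<^sub>0 / s))"
    have "1 \<le> lo" "lo \<le> x" "x \<le> hi" "lo \<le> y" "y \<le> hi"
      using X1 mono[OF \<beta>] mono[of \<beta>\<^sub>0] h by (auto simp: lo_def hi_def x_def y_def)
    moreover have "\<bar>ln u - ln v\<bar> \<le> hi - lo" if "1 \<le> lo" "lo \<le> u" "u \<le> v" "v \<le> hi" for u v
    proof -
      have "ln u \<le> ln v" using that by simp
      moreover have "ln v - ln u \<le> v - u" using that by (intro lip) auto
      ultimately show ?thesis using that by linarith
    qed
    ultimately have "\<bar>ln x - ln y\<bar> \<le> hi - lo"
      by (cases "x \<le> y") (metis, metis abs_minus_commute linear)
    then show ?thesis by (simp add: lo_def hi_def x_def y_def)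
  qed
  have scale: "\<bar>r * c\<bar> \<le> K * c" if "0 \<le> c" "\<bar>r\<bar> \<le> K" for r c K :: real
    using that by (simp add: abs_mult mult_right_mono)
  have E: "\<bar>?E * (ln (cosh (\<beta> / s)) - ln (cosh (\<beta>\<^sub>0 / s)) - ((\<beta> / s)\<^sup>2 - (\<beta>\<^sub>0 / s)\<^sup>2) / 2)\<bar> \<le> h * (2 * \<beta>\<^sub>0) ^ 3 / s ^ 4 * ?E"
  proof -
    have "\<bar>ln (cosh (\<beta> / s)) - ln (cosh (\<beta>\<^sub>0 / s)) - ((\<beta> / s)\<^sup>2 - (\<beta>\<^sub>0 / s)\<^sup>2) / 2\<bar> \<le> \<bar>\<beta> / s - \<beta>\<^sub>0 / s\<bar> * (2 * \<beta>\<^sub>0 / s) ^ 3"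
      using \<beta>s s by (intro ln_cosh_increment) (auto intro!: divide_right_mono)
    also have "\<dots> = \<bar>\<beta> - \<beta>\<^sub>0\<bar> * (2 * \<beta>\<^sub>0) ^ 3 / s ^ 4"
    proof -
      have "\<bar>\<beta> / s - \<beta>\<^sub>0 / s\<bar> = \<bar>\<beta> - \<beta>\<^sub>0\<bar> / s"
        using s by (simp add: diff_divide_distrib[symmetric] abs_divide)
      moreover have "s ^ 4 = s * s ^ 3" by (simp add: eval_nat_numeral)
      ultimately show ?thesis by (simp add: power_divide)
    qed
    also have "\<dots> \<le> h * (2 * \<beta>\<^sub>0) ^ 3 / s ^ 4"
      using \<beta> \<beta>s s by (intro divide_right_mono mult_right_mono) auto
    finally show ?thesis using scale[OF E0] by (metis mult.commute)
  qed
  have D1: "\<bar>(\<beta> - \<beta>\<^sub>0) / (2 * s) * ?D\<bar> \<le> h / (2 * s) * ?D"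
    using \<beta> s by (intro scale D0) (simp add: abs_divide divide_right_mono)
  have D2: "\<bar>(\<beta>\<^sup>2 - \<beta>\<^sub>0\<^sup>2) / (4 * s\<^sup>2) * ?D\<bar> \<le> 3 * \<beta>\<^sub>0 * h / (4 * s\<^sup>2) * ?D"
  proof -
    have "\<beta>\<^sup>2 - \<beta>\<^sub>0\<^sup>2 = (\<beta> + \<beta>\<^sub>0) * (\<beta> - \<beta>\<^sub>0)" by (simp add: power2_eq_square algebra_simps)
    then have "\<bar>\<beta>\<^sup>2 - \<beta>\<^sub>0\<^sup>2\<bar> = (\<beta> + \<beta>\<^sub>0) * \<bar>\<beta> - \<beta>\<^sub>0\<bar>" using \<beta>s by (simp add: abs_mult)
    also have "\<dots> \<le> (3 * \<beta>\<^sub>0) * h" using \<beta>s \<beta> by (intro mult_mono) auto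
    finally have "\<bar>\<beta>\<^sup>2 - \<beta>\<^sub>0\<^sup>2\<bar> / (4 * s\<^sup>2) \<le> 3 * \<beta>\<^sub>0 * h / (4 * s\<^sup>2)"
      by (intro divide_right_mono) auto
    then show ?thesis by (intro scale D0) (simp add: abs_divide)
  qed
  have V: "scaled_edge_sum N t A = (?D + 2 * ?E) / (2 * s\<^sup>2)"
    using scaled_edge_sum_eq[OF A] by (simp add: s_def power_mult_distrib mult.assoc)
  have "ln (partition_function N t A \<beta>) - ln (partition_function N t A \<beta>\<^sub>0) - (\<beta>\<^sup>2 - \<beta>\<^sub>0\<^sup>2) / 2 * scaled_edge_sum N t A =
     (\<beta> - \<beta>\<^sub>0) / (2 * s) * ?D - (\<beta>\<^sup>2 - \<beta>\<^sub>0\<^sup>2) / (4 * s\<^sup>2) * ?D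
     + ?E * (ln (cosh (\<beta> / s)) - ln (cosh (\<beta>\<^sub>0 / s)) - ((\<beta> / s)\<^sup>2 - (\<beta>\<^sub>0 / s)\<^sup>2) / 2)
     + (ln (?X (tanh (\<beta> / s))) - ln (?X (tanh (\<beta>\<^sub>0 / s))))"
    unfolding V lnZ[OF \<beta>s(1)] lnZ[OF \<beta>s(3)] using s by (simp add: field_simps power2_eq_square)
  then show ?thesis
    unfolding expansion_error_def s_def[symmetric] mult.assoc[of 2 "real N" t] using X E D1 D2 by linarith
qed

section \<open>First moments of the random graph\<close>

definition vertex_pairs :: "nat \<Rightarrow> (nat \<times> nat) set" where
  "vertex_pairs N = {(i, j). 1 \<le> i \<and> i \<le> j \<and> j \<le> N}"

lemma finite_vertex_pairs: "finite (vertex_pairs N)"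
  by (rule finite_subset[of _ "{1..N} \<times> {1..N}"]) (auto simp: vertex_pairs_def)

lemma vertex_pairs_eq: "vertex_pairs N = (\<lambda>i. (i, i)) ` {1..N} \<union> edges N"
  by (auto simp: vertex_pairs_def edges_def image_iff)

lemma sum_vertex_pairs: "(\<Sum>(i, j)\<in>vertex_pairs N. f i j) = (\<Sum>i=1..N. f i i) + (\<Sum>(i, j)\<in>edges N. f i j)"
  unfolding vertex_pairs_eq using finite_edges[of N]
  by (subst sum.union_disjoint) (auto simp: edges_def sum.reindex inj_on_def)

lemma random_graph_adjacency: "A \<in> set_pmf (random_graph N t W) \<Longrightarrow> adjacency A"
  by (auto simp: random_graph_def adjacency_def min.commute max.commute)

lemma finite_random_graph: "finite (set_pmf (random_graph N t W))"
proof -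
  have "finite (set_pmf (Pi_pmf (vertex_pairs N) False
         (\<lambda>(i, j). bernoulli_pmf (t * grid_value W N i j))))"
    by (rule finite_subset[OF set_Pi_pmf_subset'[OF finite_vertex_pairs]])
      (intro finite_PiE_dflt finite_vertex_pairs, auto)
  then show ?thesis by (simp add: random_graph_def vertex_pairs_def)
qed

lemma integrable_random_graph [simp]:
  "integrable (measure_pmf (random_graph N t W)) (f :: _ \<Rightarrow> real)"
  by (rule integrable_measure_pmf_finite[OF finite_random_graph])

lemma edge_probability:
  assumes "graphon W" "0 < t" "t < 1" "i \<in> {1..N}" "j \<in> {1..N}"
  shows "0 \<le> t * grid_value W N i j" "t * grid_value W N i j \<le> t"
    "t * grid_value W N i j \<le> 1"
proof -
  have "0 \<le> grid_value W N i j" "grid_value W N i j \<le> 1"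
    using assms by (auto simp: graphon_def)
  then show "0 \<le> t * grid_value W N i j"
    and le: "t * grid_value W N i j \<le> t"
    using assms by (auto simp: mult_left_le)
  show "t * grid_value W N i j \<le> 1" using le assms by linarith
qed

lemma expectation_random_graph_prod:
  assumes W: "graphon W" and t: "0 < t" "t < 1" and E: "E \<subseteq> vertex_pairs N"
    and u: "\<And>e. e \<in> E \<Longrightarrow> 0 \<le> u e 0 \<and> 0 \<le> u e (1::real)"
  defines "p \<equiv> \<lambda>(i, j). t * grid_value W N i j"
  shows "measure_pmf.expectation (random_graph N t W) (\<lambda>A. \<Prod>e\<in>E. u e (A (fst e) (snd e))) =
     (\<Prod>e\<in>E. p e * u e 1 + (1 - p e) * u e (0::real))"
proof -
  define q where "q = (\<lambda>e. bernoulli_pmf (p e))"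
  define v where "v = (\<lambda>e b. if e \<in> E then u e (of_bool b) else 1)"
  have rg: "random_graph N t W = map_pmf (\<lambda>g i j. of_bool (g (min i j, max i j))) (Pi_pmf (vertex_pairs N) False q)"
    by (simp add: random_graph_def vertex_pairs_def q_def p_def case_prod_unfold)
  have "measure_pmf.expectation (random_graph N t W) (\<lambda>A. \<Prod>e\<in>E. u e (A (fst e) (snd e))) =
     measure_pmf.expectation (Pi_pmf (vertex_pairs N) False q) (\<lambda>g. \<Prod>e\<in>E. u e (of_bool (g (min (fst e) (snd e), max (fst e) (snd e)))))"
    by (simp add: rg)
  also have "\<dots> = measure_pmf.expectation (Pi_pmf (vertex_pairs N) False q) (\<lambda>g. \<Prod>e\<in>vertex_pairs N. v e (g e))"
  proof (intro Bochner_Integration.integral_cong refl)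
    fix g :: "nat \<times> nat \<Rightarrow> bool"
    have "(\<Prod>e\<in>E. u e (of_bool (g (min (fst e) (snd e), max (fst e) (snd e))))) = (\<Prod>e\<in>E. v e (g e))"
    proof (intro prod.cong refl)
      fix e assume e: "e \<in> E"
      then have "fst e \<le> snd e" using E by (auto simp: vertex_pairs_def)
      then show "u e (of_bool (g (min (fst e) (snd e), max (fst e) (snd e)))) = v e (g e)"
        using e by (simp add: v_def min_absorb1 max_absorb2)
    qed
    also have "\<dots> = (\<Prod>e\<in>vertex_pairs N. v e (g e))"
      by (rule prod.mono_neutral_left[OF finite_vertex_pairs E]) (simp add: v_def)
    finally show "(\<Prod>e\<in>E. u e (of_bool (g (min (fst e) (snd e), max (fst e) (snd e))))) = (\<Prod>e\<in>vertex_pairs N. v e (g e))" .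
  qed
  also have "\<dots> = (\<Prod>e\<in>vertex_pairs N. measure_pmf.expectation (q e) (v e))"
  proof (rule expectation_prod_Pi_pmf[OF finite_vertex_pairs])
    show "integrable (measure_pmf (q e)) (v e)" for e
      by (rule integrable_measure_pmf_finite) simp
    show "0 \<le> v e b" for e b using u[of e] by (cases b) (auto simp: v_def)
  qed
  also have "\<dots> = (\<Prod>e\<in>vertex_pairs N. p e * v e True + (1 - p e) * v e False)"
  proof (intro prod.cong refl)
    fix e assume "e \<in> vertex_pairs N"
    then have "0 \<le> p e" "p e \<le> 1"
      using edge_probability[OF W t, of "fst e" N "snd e"] t by (auto simp: vertex_pairs_def p_def)
    then show "measure_pmf.expectation (q e) (v e) = p e * v e True + (1 - p e) * v e False"
      by (simp add: q_def)
  qed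
  also have "\<dots> = (\<Prod>e\<in>E. p e * v e True + (1 - p e) * v e False)"
    by (rule prod.mono_neutral_right[OF finite_vertex_pairs E]) (simp add: v_def)
  also have "\<dots> = (\<Prod>e\<in>E. p e * u e 1 + (1 - p e) * u e 0)"
    by (intro prod.cong refl) (simp add: v_def)
  finally show ?thesis .
qed

lemma expectation_edge:
  assumes "graphon W" "0 < t" "t < 1" "(i, j) \<in> vertex_pairs N"
  shows "measure_pmf.expectation (random_graph N t W) (\<lambda>A. A i j) = t * grid_value W N i j"
  using expectation_random_graph_prod[OF assms(1-3), of "{(i, j)}" N "\<lambda>e x. x"] assms(4) by simp

lemma expectation_edge_count_le:
  assumes "graphon W" "0 < t" "t < 1"
  shows "measure_pmf.expectation (random_graph N t W) (edge_count N) \<le> t * (real N)\<^sup>2"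
    and "measure_pmf.expectation (random_graph N t W) (loop_count N) \<le> t * real N"
proof -
  have le: "measure_pmf.expectation (random_graph N t W) (\<lambda>A. A i j) \<le> t" if "(i, j) \<in> vertex_pairs N" for i j
    using expectation_edge[OF assms that] edge_probability[OF assms, of i N j] that by (auto simp: vertex_pairs_def)
  have "measure_pmf.expectation (random_graph N t W) (edge_count N) =
      (\<Sum>e\<in>edges N. measure_pmf.expectation (random_graph N t W) (\<lambda>A. A (fst e) (snd e)))"
    by (simp add: edge_count_def[abs_def] case_prod_unfold)
  also have "\<dots> \<le> (\<Sum>e\<in>edges N. t)"
    using le by (intro sum_mono) (auto simp: vertex_pairs_eq)
  also have "\<dots> \<le> t * (real N)\<^sup>2"
  proof -
    have "card (edges N) \<le> card ({1..N} \<times> {1..N})" by (rule card_mono[OF _ edges_subset]) simp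
    then have "real (card (edges N)) \<le> (real N)\<^sup>2"
      by (simp add: power2_eq_square del: of_nat_mult add: of_nat_mult[symmetric])
    then show ?thesis using assms by (simp add: mult.commute mult_left_mono)
  qed
  finally show "measure_pmf.expectation (random_graph N t W) (edge_count N) \<le> t * (real N)\<^sup>2" .
  have "measure_pmf.expectation (random_graph N t W) (loop_count N) =
      (\<Sum>i=1..N. measure_pmf.expectation (random_graph N t W) (\<lambda>A. A i i))"
    by (simp add: loop_count_def[abs_def])
  also have "\<dots> \<le> (\<Sum>i=1..N. t)"
    using le by (intro sum_mono) (auto simp: vertex_pairs_eq)
  finally show "measure_pmf.expectation (random_graph N t W) (loop_count N) \<le> t * real N"
    by (simp add: mult.commute)
qed

text \<open>
  The sum is a multilinear polynomial in the independent edge indicators, so taking expectations replaces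
  every indicator by its mean.
\<close>

lemma expectation_even_subgraph_sum:
  assumes W: "graphon W" and t: "0 < t" "t < 1" and u: "0 \<le> u" "u \<le> 1"
  shows "measure_pmf.expectation (random_graph N t W) (\<lambda>A. even_subgraph_sum N A u) =
    graph_sum N (edges N) (\<lambda>(i, j). u * (t * grid_value W N i j)) (\<lambda>k. 0)"
proof -
  have sub: "edges N \<subseteq> vertex_pairs N" by (auto simp: vertex_pairs_eq)
  have "measure_pmf.expectation (random_graph N t W) (\<lambda>A. even_subgraph_sum N A u) =
     (1 / 2 ^ N) * (\<Sum>\<sigma>\<in>spins N. spin_monomial N (\<lambda>k. 0) \<sigma> *
       measure_pmf.expectation (random_graph N t W) (\<lambda>A. \<Prod>e\<in>edges N. 1 + u * A (fst e) (snd e) * (\<sigma> (fst e) * \<sigma> (snd e))))"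
    by (simp add: even_subgraph_sum_def graph_sum_def spin_average_def case_prod_unfold)
  also have "\<dots> = (1 / 2 ^ N) * (\<Sum>\<sigma>\<in>spins N. spin_monomial N (\<lambda>k. 0) \<sigma> *
       (\<Prod>e\<in>edges N. 1 + u * (t * grid_value W N (fst e) (snd e)) * (\<sigma> (fst e) * \<sigma> (snd e))))"
  proof (intro arg_cong[where f = "\<lambda>x. (1 / 2 ^ N) * x"] sum.cong refl arg_cong2[where f = "(*)"])
    fix \<sigma> assume \<sigma>: "\<sigma> \<in> spins N"
    have s: "\<sigma> (fst e) * \<sigma> (snd e) = 1 \<or> \<sigma> (fst e) * \<sigma> (snd e) = -1" if "e \<in> edges N" for e
      using spin_cases[OF \<sigma>, of "fst e"] spin_cases[OF \<sigma>, of "snd e"] that by (auto simp: edges_def)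
    have "measure_pmf.expectation (random_graph N t W) (\<lambda>A. \<Prod>e\<in>edges N. 1 + u * A (fst e) (snd e) * (\<sigma> (fst e) * \<sigma> (snd e))) =
      (\<Prod>e\<in>edges N. (case e of (i, j) \<Rightarrow> t * grid_value W N i j) * (1 + u * 1 * (\<sigma> (fst e) * \<sigma> (snd e))) +
        (1 - (case e of (i, j) \<Rightarrow> t * grid_value W N i j)) * (1 + u * 0 * (\<sigma> (fst e) * \<sigma> (snd e))))"
    proof (rule expectation_random_graph_prod[OF W t sub, of "\<lambda>e x. 1 + u * x * (\<sigma> (fst e) * \<sigma> (snd e))"])
      fix e assume "e \<in> edges N"
      then show "0 \<le> 1 + u * 0 * (\<sigma> (fst e) * \<sigma> (snd e)) \<and> 0 \<le> 1 + u * 1 * (\<sigma> (fst e) * \<sigma> (snd e))"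
        using s[of e] u by auto
    qed
    also have "\<dots> = (\<Prod>e\<in>edges N. 1 + u * (t * grid_value W N (fst e) (snd e)) * (\<sigma> (fst e) * \<sigma> (snd e)))"
      by (intro prod.cong refl) (simp add: case_prod_unfold algebra_simps)
    finally show "measure_pmf.expectation (random_graph N t W) (\<lambda>A. \<Prod>e\<in>edges N. 1 + u * A (fst e) (snd e) * (\<sigma> (fst e) * \<sigma> (snd e))) =
      (\<Prod>e\<in>edges N. 1 + u * (t * grid_value W N (fst e) (snd e)) * (\<sigma> (fst e) * \<sigma> (snd e)))" .
  qed
  finally show ?thesis by (simp add: graph_sum_def spin_average_def case_prod_unfold)
qed

lemma prob_le_expectation:
  fixes X :: "'a \<Rightarrow> real"
  assumes "finite (set_pmf M)" "\<And>x. x \<in> set_pmf M \<Longrightarrow> 0 \<le> X x" "c > 0"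
  shows "measure_pmf.prob M {x. c \<le> X x} \<le> measure_pmf.expectation M X / c"
proof -
  have "AE x in M. 0 \<le> X x" using assms(2) by (simp add: AE_measure_pmf_iff)
  from integral_Markov_inequality_measure[OF integrable_measure_pmf_finite[OF assms(1)] _ this assms(3), of UNIV]
  show ?thesis by simp
qed

text \<open>
  Chernoff's bound with parameter 1 for the number \<open>S\<close> of edges and loops with mean
  \<open>\<mu>\<close>: since \<open>exp (-1) \<le> 1 / 2\<close>, the expectation of \<open>exp (- S)\<close>
  is at most \<open>exp (- \<mu> / 2)\<close>. The constant 16 collects the factor 4 lost here, the factor 2
  between ordered and unordered pairs and the factor 2 in the definition of the scaled edge sum.
\<close>

lemma scaled_edge_sum_lower_tail:
  assumes W: "graphon W" and t: "0 < t" "t < 1" and N: "N > 0"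
    and c: "c * (real N)\<^sup>2 \<le> (\<Sum>i=1..N. \<Sum>j=1..N. grid_value W N i j)"
  shows "measure_pmf.prob (random_graph N t W) {A. scaled_edge_sum N t A < c / (16 * t)} \<le> exp (- (c * t * (real N)\<^sup>2 / 8))"
proof -
  let ?G = "random_graph N t W" and ?P = "vertex_pairs N"
  let ?p = "\<lambda>(i, j). t * grid_value W N i j"
  define S :: "(nat \<Rightarrow> nat \<Rightarrow> real) \<Rightarrow> real" where "S = (\<lambda>A. \<Sum>e\<in>?P. A (fst e) (snd e))"
  define \<mu> where "\<mu> = (\<Sum>e\<in>?P. ?p e)"
  have sym: "grid_value W N i j = grid_value W N j i" if "i \<in> {1..N}" "j \<in> {1..N}" for i j
    using W that by (auto simp: graphon_def)
  have Wnn: "0 \<le> grid_value W N i j" if "i \<in> {1..N}" "j \<in> {1..N}" for i j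
    using W that by (auto simp: graphon_def)
  have mu: "c * t * (real N)\<^sup>2 / 2 \<le> \<mu>"
  proof -
    define w where "w = (\<lambda>i j. if i \<in> {1..N} \<and> j \<in> {1..N} then grid_value W N i j else 0)"
    have w0: "0 \<le> w i j" for i j using Wnn by (auto simp: w_def)
    have wsym: "w i j = w j i" for i j using sym by (auto simp: w_def)
    have "(\<Sum>i=1..N. \<Sum>j=1..N. grid_value W N i j) = (\<Sum>i=1..N. \<Sum>j=1..N. w i j)"
      by (intro sum.cong) (auto simp: w_def)
    also have "\<dots> = (\<Sum>i=1..N. w i i) + 2 * (\<Sum>(i, j)\<in>edges N. w i j)"
      using wsym by (rule symmetric_double_sum)
    also have "\<dots> \<le> 2 * (\<Sum>(i, j)\<in>?P. w i j)"
      unfolding sum_vertex_pairs using w0 sum_nonneg[of "{1..N}" "\<lambda>i. w i i"] by simp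
    finally have "c * (real N)\<^sup>2 \<le> 2 * (\<Sum>(i, j)\<in>?P. w i j)" using c by linarith
    then have "t * (c * (real N)\<^sup>2) \<le> t * (2 * (\<Sum>(i, j)\<in>?P. w i j))" using t by (intro mult_left_mono) auto
    moreover have "\<mu> = t * (\<Sum>(i, j)\<in>?P. w i j)"
      unfolding \<mu>_def sum_distrib_left by (intro sum.cong) (auto simp: w_def vertex_pairs_def)
    ultimately show ?thesis by (simp add: mult_ac)
  qed
  have ex: "measure_pmf.expectation ?G (\<lambda>A. exp (- S A)) \<le> exp (- \<mu> / 2)"
  proof -
    have "measure_pmf.expectation ?G (\<lambda>A. exp (- S A)) = measure_pmf.expectation ?G (\<lambda>A. \<Prod>e\<in>?P. exp (- A (fst e) (snd e)))"
      using finite_vertex_pairs by (simp add: S_def sum_negf[symmetric] exp_sum)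
    also have "\<dots> = (\<Prod>e\<in>?P. ?p e * exp (- 1) + (1 - ?p e) * exp (- 0))"
      by (rule expectation_random_graph_prod[OF W t order_refl, of N "\<lambda>e x. exp (- x)"]) simp
    also have "\<dots> \<le> (\<Prod>e\<in>?P. exp (- ?p e / 2))"
    proof (intro prod_mono)
      fix e assume e: "e \<in> ?P"
      have p: "0 \<le> ?p e" "?p e \<le> 1"
        using edge_probability[OF W t, of "fst e" N "snd e"] e t by (auto simp: vertex_pairs_def)
      have "exp 1 \<ge> (2::real)" using exp_ge_add_one_self[of 1] by simp
      then have "exp (- 1) \<le> (1 / 2::real)" by (simp add: exp_minus divide_simps)
      then have "?p e * exp (- 1) \<le> ?p e * (1 / 2)" using p by (intro mult_left_mono)
      then have "?p e * exp (- 1) + (1 - ?p e) * exp (- 0) \<le> 1 + (- ?p e / 2)" by simp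
      also have "\<dots> \<le> exp (- ?p e / 2)" by (rule exp_ge_add_one_self)
      finally show "0 \<le> ?p e * exp (- 1) + (1 - ?p e) * exp (- 0) \<and>
        ?p e * exp (- 1) + (1 - ?p e) * exp (- 0) \<le> exp (- ?p e / 2)" using p by simp
    qed
    also have "\<dots> = exp (- \<mu> / 2)"
      using finite_vertex_pairs by (simp add: \<mu>_def exp_sum[symmetric] sum_negf sum_divide_distrib)
    finally show ?thesis .
  qed
  have "measure_pmf.prob ?G {A. scaled_edge_sum N t A < c / (16 * t)} \<le> measure_pmf.prob ?G {A. exp (- \<mu> / 4) \<le> exp (- S A)}"
  proof (rule measure_pmf.finite_measure_mono_AE)
    show "AE A in ?G. A \<in> {A. scaled_edge_sum N t A < c / (16 * t)} \<longrightarrow> A \<in> {A. exp (- \<mu> / 4) \<le> exp (- S A)}"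
      unfolding AE_measure_pmf_iff
    proof (intro ballI impI)
      fix A assume A: "A \<in> set_pmf ?G" and small: "A \<in> {A. scaled_edge_sum N t A < c / (16 * t)}"
      have adj: "adjacency A" using random_graph_adjacency[OF A] .
      have A0: "0 \<le> A i j" for i j by (rule adjacency_nonneg[OF adj])
      have "S A = loop_count N A + edge_count N A"
        using sum_vertex_pairs[of A N] by (simp add: S_def loop_count_def edge_count_def case_prod_unfold)
      moreover have "0 \<le> edge_count N A" using A0 by (auto simp: edge_count_def intro!: sum_nonneg)
      ultimately have "S A / (2 * (real N)\<^sup>2 * t\<^sup>2) \<le> scaled_edge_sum N t A"
        unfolding scaled_edge_sum_eq[OF adj] using t by (intro divide_right_mono) auto
      then have "S A / (2 * (real N)\<^sup>2 * t\<^sup>2) < c / (16 * t)" using small by simp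
      then have "S A < c / (16 * t) * (2 * (real N)\<^sup>2 * t\<^sup>2)" using t N by (simp add: pos_divide_less_eq)
      also have "\<dots> = c * t * (real N)\<^sup>2 / 8" using t by (simp add: power2_eq_square)
      finally have "S A \<le> \<mu> / 4" using mu by simp
      then show "A \<in> {A. exp (- \<mu> / 4) \<le> exp (- S A)}" by simp
    qed
  qed simp
  also have "\<dots> \<le> measure_pmf.expectation ?G (\<lambda>A. exp (- S A)) / exp (- \<mu> / 4)"
    by (rule prob_le_expectation[OF finite_random_graph]) auto
  also have "\<dots> \<le> exp (- \<mu> / 2) / exp (- \<mu> / 4)" by (intro divide_right_mono ex) auto
  also have "\<dots> = exp (- (\<mu> / 4))" by (simp add: exp_diff[symmetric])
  also have "\<dots> \<le> exp (- (c * t * (real N)\<^sup>2 / 8))" using mu by simp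
  finally show ?thesis .
qed

lemma expectation_scaled_edge_sum_le:
  assumes "graphon W" "0 < t" "t < 1" "N > 0"
  shows "measure_pmf.expectation (random_graph N t W) (scaled_edge_sum N t) \<le> 3 / (2 * t)"
proof -
  let ?G = "random_graph N t W"
  have "measure_pmf.expectation ?G (scaled_edge_sum N t) =
      measure_pmf.expectation ?G (\<lambda>A. (loop_count N A + 2 * edge_count N A) / (2 * (real N)\<^sup>2 * t\<^sup>2))"
    by (intro integral_cong_AE) (auto simp: AE_measure_pmf_iff intro!: scaled_edge_sum_eq random_graph_adjacency)
  also have "\<dots> = (measure_pmf.expectation ?G (loop_count N) + 2 * measure_pmf.expectation ?G (edge_count N)) / (2 * (real N)\<^sup>2 * t\<^sup>2)"
    by simp
  also have "\<dots> \<le> (t * (real N)\<^sup>2 + 2 * (t * (real N)\<^sup>2)) / (2 * (real N)\<^sup>2 * t\<^sup>2)"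
  proof (intro divide_right_mono add_mono mult_left_mono expectation_edge_count_le assms(1-3))
    have "real N \<le> (real N)\<^sup>2" using assms(4) by (simp add: power2_eq_square)
    then have "t * real N \<le> t * (real N)\<^sup>2" using assms by (intro mult_left_mono) auto
    then show "measure_pmf.expectation ?G (loop_count N) \<le> t * (real N)\<^sup>2"
      using expectation_edge_count_le(2)[OF assms(1-3), of N] by linarith
  qed auto
  also have "\<dots> = 3 / (2 * t)" using assms by (simp add: power2_eq_square field_simps)
  finally show ?thesis .
qed

section \<open>Tests in the exponential family\<close>

definition gibbs_weight :: "nat \<Rightarrow> real \<Rightarrow> (nat \<Rightarrow> nat \<Rightarrow> real) \<Rightarrow> real \<Rightarrow> (nat \<Rightarrow> real) \<Rightarrow> real" where
  "gibbs_weight N t A \<beta> \<sigma> = 1 / (2 ^ N * partition_function N t A \<beta>) * exp (- \<beta> * hamiltonian N t A \<sigma>)"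

lemma gibbs_weight_nonneg: "0 \<le> gibbs_weight N t A \<beta> \<sigma>"
  using partition_function_pos[of N t A \<beta>] by (simp add: gibbs_weight_def)

lemma sum_gibbs_weight: "(\<Sum>\<sigma>\<in>spins N. gibbs_weight N t A \<beta> \<sigma>) = 1"
proof -
  have "(\<Sum>\<sigma>\<in>spins N. exp (- \<beta> * hamiltonian N t A \<sigma>)) = 2 ^ N * partition_function N t A \<beta>"
    by (simp add: partition_function_def)
  then show ?thesis
    using partition_function_pos[of N t A \<beta>]
    unfolding gibbs_weight_def sum_distrib_left[symmetric] by simp
qed

lemma measure_ising:
  "measure (ising N t A \<beta>) {\<sigma> \<in> spins N. P \<sigma>} = (\<Sum>\<sigma>\<in>{\<sigma> \<in> spins N. P \<sigma>}. gibbs_weight N t A \<beta> \<sigma>)"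
  unfolding ising_def gibbs_weight_def
  using partition_function_pos[of N t A \<beta>] finite_spins
  by (subst measure_point_measure_finite_if) auto

lemma measure_ising_le_one: "measure (ising N t A \<beta>) {\<sigma> \<in> spins N. P \<sigma>} \<le> 1"
proof -
  have "(\<Sum>\<sigma>\<in>{\<sigma> \<in> spins N. P \<sigma>}. gibbs_weight N t A \<beta> \<sigma>) \<le> (\<Sum>\<sigma>\<in>spins N. gibbs_weight N t A \<beta> \<sigma>)"
    using finite_spins gibbs_weight_nonneg by (intro sum_mono2) auto
  then show ?thesis by (simp add: measure_ising sum_gibbs_weight)
qed

lemma measure_ising_compl:
  "measure (ising N t A \<beta>) {\<sigma> \<in> spins N. \<not> P \<sigma>} = 1 - measure (ising N t A \<beta>) {\<sigma> \<in> spins N. P \<sigma>}"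
proof -
  have "(\<Sum>\<sigma>\<in>spins N. gibbs_weight N t A \<beta> \<sigma>) =
    (\<Sum>\<sigma>\<in>{\<sigma> \<in> spins N. P \<sigma>}. gibbs_weight N t A \<beta> \<sigma>) + (\<Sum>\<sigma>\<in>{\<sigma> \<in> spins N. \<not> P \<sigma>}. gibbs_weight N t A \<beta> \<sigma>)"
    using finite_spins by (subst sum.union_disjoint[symmetric]) (auto intro: sum.cong)
  then show ?thesis by (simp add: measure_ising sum_gibbs_weight)
qed

text \<open>
  The exponential family property: changing the parameter multiplies the weights by an exponential of the
  Hamiltonian.
\<close>

lemma gibbs_weight_tilt:
  "gibbs_weight N t A (\<beta> + l) \<sigma> * (partition_function N t A (\<beta> + l) / partition_function N t A \<beta>)
    = gibbs_weight N t A \<beta> \<sigma> * exp (- l * hamiltonian N t A \<sigma>)"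
proof -
  have "exp (- (\<beta> + l) * hamiltonian N t A \<sigma>) = exp (- \<beta> * hamiltonian N t A \<sigma>) * exp (- l * hamiltonian N t A \<sigma>)"
    by (simp add: exp_add[symmetric] algebra_simps)
  then show ?thesis
    using partition_function_pos[of N t A "\<beta> + l"] by (simp add: gibbs_weight_def)
qed

lemma gibbs_mgf:
  "(\<Sum>\<sigma>\<in>spins N. gibbs_weight N t A \<beta> \<sigma> * exp (- l * hamiltonian N t A \<sigma>))
    = partition_function N t A (\<beta> + l) / partition_function N t A \<beta>"
  by (simp only: gibbs_weight_tilt[symmetric] sum_distrib_right[symmetric] sum_gibbs_weight mult_1_left)

text \<open>
  The right-hand side is the chi-square divergence of the two measures, that is the variance of the likelihood
  ratio, which bounds the squared difference of the probabilities of any event by the Cauchy--Schwarz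
  inequality.
\<close>

lemma ising_difference_square_le:
  "(measure (ising N t A (\<beta> + d)) {\<sigma> \<in> spins N. P \<sigma>} - measure (ising N t A \<beta>) {\<sigma> \<in> spins N. P \<sigma>})\<^sup>2
    \<le> partition_function N t A \<beta> * partition_function N t A (\<beta> + 2 * d) / (partition_function N t A (\<beta> + d))\<^sup>2 - 1"
proof -
  let ?p = "gibbs_weight N t A \<beta>" and ?q = "gibbs_weight N t A (\<beta> + d)" and ?Z = "partition_function N t A"
  let ?H = "hamiltonian N t A" and ?S = "{\<sigma> \<in> spins N. P \<sigma>}"
  \<comment> \<open>the likelihood ratio\<close>
  define L where "L = (\<lambda>\<sigma>. exp (- d * ?H \<sigma>) * (?Z \<beta> / ?Z (\<beta> + d)))"
  have Z: "?Z c > 0" for c by (rule partition_function_pos)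
  have q: "?q \<sigma> = ?p \<sigma> * L \<sigma>" for \<sigma>
  proof -
    have "?q \<sigma> = (?q \<sigma> * (?Z (\<beta> + d) / ?Z \<beta>)) * (?Z \<beta> / ?Z (\<beta> + d))"
      using Z[of \<beta>] Z[of "\<beta> + d"] by simp
    also have "\<dots> = ?p \<sigma> * L \<sigma>" unfolding gibbs_weight_tilt L_def by simp
    finally show ?thesis .
  qed
  have "(measure (ising N t A (\<beta> + d)) ?S - measure (ising N t A \<beta>) ?S)\<^sup>2 = (\<Sum>\<sigma>\<in>?S. sqrt (?p \<sigma>) * (sqrt (?p \<sigma>) * (L \<sigma> - 1)))\<^sup>2"
    unfolding measure_ising sum_subtractf[symmetric] q
    using gibbs_weight_nonneg by (simp add: algebra_simps mult.assoc[symmetric])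
  also have "\<dots> \<le> (\<Sum>\<sigma>\<in>?S. (sqrt (?p \<sigma>))\<^sup>2) * (\<Sum>\<sigma>\<in>?S. (sqrt (?p \<sigma>) * (L \<sigma> - 1))\<^sup>2)"
    by (rule Cauchy_Schwarz_ineq_sum)
  also have "\<dots> = (\<Sum>\<sigma>\<in>?S. ?p \<sigma>) * (\<Sum>\<sigma>\<in>?S. ?p \<sigma> * (L \<sigma> - 1)\<^sup>2)"
    using gibbs_weight_nonneg by (simp add: power_mult_distrib)
  also have "\<dots> \<le> 1 * (\<Sum>\<sigma>\<in>spins N. ?p \<sigma> * (L \<sigma> - 1)\<^sup>2)"
    using gibbs_weight_nonneg finite_spins measure_ising_le_one[of N t A \<beta> P]
    by (intro mult_mono sum_mono2) (auto simp: measure_ising intro!: sum_nonneg mult_nonneg_nonneg)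
  also have "\<dots> = (\<Sum>\<sigma>\<in>spins N. ?p \<sigma> * (L \<sigma>)\<^sup>2) - 2 * (\<Sum>\<sigma>\<in>spins N. ?q \<sigma>) + (\<Sum>\<sigma>\<in>spins N. ?p \<sigma>)"
    unfolding q by (simp add: power2_eq_square algebra_simps sum.distrib sum_subtractf sum_distrib_left)
  also have "\<dots> = (\<Sum>\<sigma>\<in>spins N. ?p \<sigma> * (L \<sigma>)\<^sup>2) - 1" by (simp add: sum_gibbs_weight)
  also have "(\<Sum>\<sigma>\<in>spins N. ?p \<sigma> * (L \<sigma>)\<^sup>2) = (\<Sum>\<sigma>\<in>spins N. ?p \<sigma> * exp (- (2 * d) * ?H \<sigma>)) * (?Z \<beta> / ?Z (\<beta> + d))\<^sup>2"
  proof -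
    have "(exp (- d * ?H \<sigma>))\<^sup>2 = exp (- (2 * d) * ?H \<sigma>)" for \<sigma>
      by (simp add: exp_double[symmetric])
    then show ?thesis
      unfolding sum_distrib_right L_def power_mult_distrib by (simp only: mult.assoc)
  qed
  also have "\<dots> = ?Z \<beta> * ?Z (\<beta> + 2 * d) / (?Z (\<beta> + d))\<^sup>2"
    unfolding gibbs_mgf using Z[of \<beta>] by (simp add: power2_eq_square)
  finally show ?thesis by simp
qed

lemma risk_bdd_above:
  "bdd_above ((\<lambda>\<beta>. measure (ising N t A \<beta>) {\<sigma> \<in> spins N. \<phi> A \<sigma> = 0}) ` B)"
  using measure_ising_le_one by (intro bdd_aboveI[of _ 1]) auto

lemma risk_nonneg:
  assumes "alternatives W \<beta>\<^sub>0 d \<noteq> {}" shows "0 \<le> risk W \<beta>\<^sub>0 t d N \<phi> A"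
proof -
  obtain \<beta> where "\<beta> \<in> alternatives W \<beta>\<^sub>0 d" using assms by blast
  from cSUP_upper[OF this risk_bdd_above, of N t A \<phi>]
  have "0 \<le> (SUP \<beta>\<in>alternatives W \<beta>\<^sub>0 d. measure (ising N t A \<beta>) {\<sigma> \<in> spins N. \<phi> A \<sigma> = 0})"
    by (rule order_trans[OF measure_nonneg])
  then show ?thesis by (simp add: risk_def)
qed

lemma min_risk_bounds:
  assumes "alternatives W \<beta>\<^sub>0 d \<noteq> {}"
  shows "0 \<le> min_risk W \<beta>\<^sub>0 t d N A" "min_risk W \<beta>\<^sub>0 t d N A \<le> 1"
    and "\<phi> \<in> tests N \<Longrightarrow> min_risk W \<beta>\<^sub>0 t d N A \<le> risk W \<beta>\<^sub>0 t d N \<phi> A"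
proof -
  have bdd: "bdd_below ((\<lambda>\<phi>. risk W \<beta>\<^sub>0 t d N \<phi> A) ` tests N)"
    using risk_nonneg[OF assms] by (intro bdd_belowI[of _ 0]) auto
  show le: "min_risk W \<beta>\<^sub>0 t d N A \<le> risk W \<beta>\<^sub>0 t d N \<phi> A" if "\<phi> \<in> tests N" for \<phi>
    unfolding min_risk_def using that by (rule cINF_lower[OF bdd])
  have zero: "(\<lambda>A \<sigma>. 0) \<in> tests N" by (simp add: tests_def)
  then show "0 \<le> min_risk W \<beta>\<^sub>0 t d N A"
    unfolding min_risk_def using risk_nonneg[OF assms] by (intro cINF_greatest) auto
  have "risk W \<beta>\<^sub>0 t d N (\<lambda>A \<sigma>. 0) A \<le> 1"
    using assms measure_ising_le_one[of N t A _ "\<lambda>_. True"] by (auto simp: risk_def intro!: cSUP_least)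
  then show "min_risk W \<beta>\<^sub>0 t d N A \<le> 1" using le[OF zero] by linarith
qed

text \<open>
  The worst case over the alternatives is at least the error at the single alternative \<open>\<beta>\<^sub>0
  + d\<close>, and a test cannot separate two measures whose probabilities differ by at most \<open>k\<close>.
\<close>

lemma min_risk_ge:
  assumes alt: "\<beta>\<^sub>0 + d \<in> alternatives W \<beta>\<^sub>0 d" and k: "0 \<le> k"
    and x: "partition_function N t A \<beta>\<^sub>0 * partition_function N t A (\<beta>\<^sub>0 + 2 * d) / (partition_function N t A (\<beta>\<^sub>0 + d))\<^sup>2 - 1 \<le> k\<^sup>2"
  shows "1 - k \<le> min_risk W \<beta>\<^sub>0 t d N A"
  unfolding min_risk_def
proof (rule cINF_greatest)
  show "tests N \<noteq> {}" by (auto simp: tests_def intro!: exI[of _ "\<lambda>A \<sigma>. 0"])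
  fix \<phi> assume \<phi>: "\<phi> \<in> tests N"
  let ?p = "\<lambda>\<beta>. measure (ising N t A \<beta>) {\<sigma> \<in> spins N. \<phi> A \<sigma> = 1}"
  have "{\<sigma> \<in> spins N. \<phi> A \<sigma> = 0} = {\<sigma> \<in> spins N. \<not> \<phi> A \<sigma> = 1}"
    using \<phi> by (fastforce simp: tests_def)
  then have "measure (ising N t A (\<beta>\<^sub>0 + d)) {\<sigma> \<in> spins N. \<phi> A \<sigma> = 0} = 1 - ?p (\<beta>\<^sub>0 + d)"
    by (simp only: measure_ising_compl)
  then have "1 - ?p (\<beta>\<^sub>0 + d) \<le> (SUP \<beta>\<in>alternatives W \<beta>\<^sub>0 d. measure (ising N t A \<beta>) {\<sigma> \<in> spins N. \<phi> A \<sigma> = 0})"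
    using cSUP_upper[OF alt risk_bdd_above, of N t A \<phi>] by simp
  moreover have "(?p (\<beta>\<^sub>0 + d) - ?p \<beta>\<^sub>0)\<^sup>2 \<le> k\<^sup>2"
    using ising_difference_square_le[of N t A \<beta>\<^sub>0 d "\<lambda>\<sigma>. \<phi> A \<sigma> = 1"] x by linarith
  then have "\<bar>?p (\<beta>\<^sub>0 + d) - ?p \<beta>\<^sub>0\<bar> \<le> \<bar>k\<bar>" by (simp only: abs_le_square_iff)
  ultimately show "1 - k \<le> risk W \<beta>\<^sub>0 t d N \<phi> A" using k unfolding risk_def by linarith
qed

text \<open>
  Let \<open>M l\<close> be the expectation of \<open>exp (l * X)\<close> with \<open>X = - H - a\<close>
  under the parameter \<open>\<beta>\<close>. The probability under \<open>\<beta> + l\<close> is at most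
  \<open>1 / M l\<close>, because the density is \<open>exp (l * X) / M l\<close> and \<open>l * X \<le>
  0\<close> on the event. Since \<open>M\<close> is convex with \<open>M 0 = 1\<close>, a lower bound \<open>m
  \<ge> 1\<close> at \<open>d\<close> persists at all \<open>l\<close> beyond \<open>d\<close>. Thus the
  alternatives closest to the null hypothesis are the worst; \<open>d\<close> may have either sign.
\<close>

lemma ising_tilted_tail:
  assumes d: "d \<noteq> 0" and l: "l / d \<ge> 1" and m: "1 \<le> m"
    "m \<le> partition_function N t A (\<beta> + d) / partition_function N t A \<beta> * exp (- d * a)"
  shows "measure (ising N t A (\<beta> + l)) {\<sigma> \<in> spins N. d * (- hamiltonian N t A \<sigma> - a) \<le> 0} \<le> 1 / m"
proof -
  let ?Z = "partition_function N t A" and ?H = "hamiltonian N t A" and ?w = "gibbs_weight N t A \<beta>"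
  define M where "M = (\<lambda>l. \<Sum>\<sigma>\<in>spins N. ?w \<sigma> * exp (l * (- ?H \<sigma> - a)))"
  have M: "M l = ?Z (\<beta> + l) / ?Z \<beta> * exp (- l * a)" for l
  proof -
    have "M l = (\<Sum>\<sigma>\<in>spins N. ?w \<sigma> * exp (- l * ?H \<sigma>)) * exp (- l * a)"
      unfolding M_def sum_distrib_right by (intro sum.cong refl) (simp add: exp_add[symmetric] algebra_simps)
    then show ?thesis by (simp only: gibbs_mgf)
  qed
  have w0: "0 \<le> ?w \<sigma>" for \<sigma> by (rule gibbs_weight_nonneg)
  define k where "k = d / l"
  have l0: "l \<noteq> 0" using l by auto
  have k: "0 < k" "k \<le> 1" "k * l = d"
  proof -
    define r where "r = l / d"
    have "k = 1 / r" "1 \<le> r" using l by (simp_all add: k_def r_def)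
    then show "0 < k" "k \<le> 1" by simp_all
    show "k * l = d" using l0 by (simp add: k_def)
  qed
  \<comment> \<open>Convexity of \<open>M\<close> between 0 and \<open>l\<close>, at the intermediate point \<open>d = k * l\<close>.\<close>
  have "M d \<le> (\<Sum>\<sigma>\<in>spins N. ?w \<sigma> * ((1 - k) + k * exp (l * (- ?H \<sigma> - a))))"
    unfolding M_def
  proof (intro sum_mono mult_left_mono w0)
    fix \<sigma>
    have "exp ((1 - k) *\<^sub>R 0 + k *\<^sub>R (l * (- ?H \<sigma> - a))) \<le> (1 - k) * exp 0 + k * exp (l * (- ?H \<sigma> - a))"
      using exp_convex k by (intro convex_onD[OF exp_convex]) auto
    then show "exp (d * (- ?H \<sigma> - a)) \<le> 1 - k + k * exp (l * (- ?H \<sigma> - a))"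
      using k(3) by (simp add: mult.assoc[symmetric])
  qed
  also have "\<dots> = (1 - k) + k * M l"
    by (simp add: M_def distrib_left sum.distrib sum_distrib_left[symmetric] sum_distrib_right[symmetric]
        sum_gibbs_weight mult.left_commute[of _ k])
  finally have conv: "M d \<le> (1 - k) + k * M l" .
  have "m \<le> M l"
  proof -
    have "m \<le> (1 - k) + k * M l" using m conv M[of d] by linarith
    then have "k * (m - 1) \<le> k * (M l - 1)"
      using mult_right_mono[OF k(2), of "m - 1"] m by (simp add: algebra_simps)
    then show ?thesis using k by simp
  qed
  have "measure (ising N t A (\<beta> + l)) {\<sigma> \<in> spins N. d * (- ?H \<sigma> - a) \<le> 0} * M l
      = (\<Sum>\<sigma>\<in>{\<sigma> \<in> spins N. d * (- ?H \<sigma> - a) \<le> 0}. ?w \<sigma> * exp (l * (- ?H \<sigma> - a)))"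
  proof -
    have "gibbs_weight N t A (\<beta> + l) \<sigma> * M l = ?w \<sigma> * exp (l * (- ?H \<sigma> - a))" for \<sigma>
    proof -
      have "gibbs_weight N t A (\<beta> + l) \<sigma> * M l = (gibbs_weight N t A (\<beta> + l) \<sigma> * (?Z (\<beta> + l) / ?Z \<beta>)) * exp (- l * a)"
        by (simp add: M)
      also have "\<dots> = ?w \<sigma> * (exp (- l * ?H \<sigma>) * exp (- l * a))" unfolding gibbs_weight_tilt by simp
      also have "\<dots> = ?w \<sigma> * exp (l * (- ?H \<sigma> - a))" by (simp add: exp_add[symmetric] algebra_simps)
      finally show ?thesis .
    qed
    then show ?thesis by (simp add: measure_ising sum_distrib_right)
  qed
  also have "\<dots> \<le> (\<Sum>\<sigma>\<in>{\<sigma> \<in> spins N. d * (- ?H \<sigma> - a) \<le> 0}. ?w \<sigma>)"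
  proof (intro sum_mono mult_left_le w0)
    fix \<sigma> assume "\<sigma> \<in> {\<sigma> \<in> spins N. d * (- ?H \<sigma> - a) \<le> 0}"
    then have "d * (- ?H \<sigma> - a) \<le> 0" by simp
    moreover have "0 \<le> l / d" using l by linarith
    ultimately have "(l / d) * (d * (- ?H \<sigma> - a)) \<le> 0" by (rule mult_nonneg_nonpos[rotated])
    then have "l * (- ?H \<sigma> - a) \<le> 0" using d by simp
    then show "exp (l * (- ?H \<sigma> - a)) \<le> 1" by simp
  qed
  also have "\<dots> \<le> 1" using measure_ising_le_one[of N t A \<beta> "\<lambda>\<sigma>. d * (- ?H \<sigma> - a) \<le> 0"] by (simp only: measure_ising)
  finally have "measure (ising N t A (\<beta> + l)) {\<sigma> \<in> spins N. d * (- ?H \<sigma> - a) \<le> 0} * M l \<le> 1" .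
  then have "measure (ising N t A (\<beta> + l)) {\<sigma> \<in> spins N. d * (- ?H \<sigma> - a) \<le> 0} * m \<le> 1"
    using mult_left_mono[OF \<open>m \<le> M l\<close> measure_nonneg] by (rule order_trans[rotated])
  then show ?thesis using m by (simp add: pos_le_divide_eq)
qed

definition gibbs_pmf :: "nat \<Rightarrow> real \<Rightarrow> (nat \<Rightarrow> nat \<Rightarrow> real) \<Rightarrow> real \<Rightarrow> (nat \<Rightarrow> real) pmf" where
  "gibbs_pmf N t A \<beta> = embed_pmf (\<lambda>\<sigma>. if \<sigma> \<in> spins N then gibbs_weight N t A \<beta> \<sigma> else 0)"

lemma pmf_gibbs: "pmf (gibbs_pmf N t A \<beta>) \<sigma> = (if \<sigma> \<in> spins N then gibbs_weight N t A \<beta> \<sigma> else 0)"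
  unfolding gibbs_pmf_def
proof (rule pmf_embed_pmf)
  show "0 \<le> (if \<sigma> \<in> spins N then gibbs_weight N t A \<beta> \<sigma> else 0)" for \<sigma>
    by (simp add: gibbs_weight_nonneg)
  have "(\<integral>\<^sup>+ \<sigma>. ennreal (if \<sigma> \<in> spins N then gibbs_weight N t A \<beta> \<sigma> else 0) \<partial>count_space UNIV) =
     (\<Sum>\<sigma>\<in>spins N. ennreal (gibbs_weight N t A \<beta> \<sigma>))"
    by (subst nn_integral_count_space'[OF finite_spins[of N]]) (auto intro: sum.cong)
  also have "\<dots> = 1" by (subst sum_ennreal) (simp_all add: gibbs_weight_nonneg sum_gibbs_weight)
  finally show "(\<integral>\<^sup>+ \<sigma>. ennreal (if \<sigma> \<in> spins N then gibbs_weight N t A \<beta> \<sigma> else 0) \<partial>count_space UNIV) = 1" .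
qed

lemma set_gibbs_pmf: "set_pmf (gibbs_pmf N t A \<beta>) \<subseteq> spins N"
  by (auto simp: set_pmf_eq pmf_gibbs)

lemma prob_gibbs: "measure_pmf.prob (gibbs_pmf N t A \<beta>) {\<sigma>. P \<sigma>} = measure (ising N t A \<beta>) {\<sigma> \<in> spins N. P \<sigma>}"
proof -
  have "measure_pmf.prob (gibbs_pmf N t A \<beta>) {\<sigma>. P \<sigma>} = measure_pmf.prob (gibbs_pmf N t A \<beta>) {\<sigma> \<in> spins N. P \<sigma>}"
    using set_gibbs_pmf[of N t A \<beta>] by (intro measure_pmf.finite_measure_eq_AE) (auto simp: AE_measure_pmf_iff)
  also have "\<dots> = (\<Sum>\<sigma>\<in>{\<sigma> \<in> spins N. P \<sigma>}. gibbs_weight N t A \<beta> \<sigma>)"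
    using finite_spins by (subst measure_measure_pmf_finite) (auto simp: pmf_gibbs)
  finally show ?thesis by (simp add: measure_ising)
qed

lemma expectation_gibbs: "measure_pmf.expectation (gibbs_pmf N t A \<beta>) f = (\<Sum>\<sigma>\<in>spins N. gibbs_weight N t A \<beta> \<sigma> * f \<sigma>)"
  using set_gibbs_pmf[of N t A \<beta>]
  by (subst integral_measure_pmf_real[OF finite_spins[of N]]) (auto simp: pmf_gibbs mult.commute)

text \<open>
  In the chi-square divergence the linear terms of the expansion cancel and the quadratic ones leave
  \<open>d\<^sup>2 * V\<close>; three values of \<open>ln Z\<close> enter, at \<open>\<beta>\<^sub>0\<close>,
  \<open>\<beta>\<^sub>0 + d\<close> twice, and \<open>\<beta>\<^sub>0 + 2 * d\<close>.
\<close>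

lemma min_risk_ge_expansion:
  assumes A: "adjacency A" and N: "N > 0" and t: "t > 0" and d: "0 \<le> d" "2 * d \<le> \<beta>\<^sub>0"
    and alt: "\<beta>\<^sub>0 + d \<in> alternatives W \<beta>\<^sub>0 d" and k: "0 \<le> k"
    and x: "d\<^sup>2 * scaled_edge_sum N t A + 3 * expansion_error N t \<beta>\<^sub>0 (2 * d) A \<le> ln (1 + k\<^sup>2)"
  shows "1 - k \<le> min_risk W \<beta>\<^sub>0 t d N A"
proof (rule min_risk_ge[OF alt k])
  let ?Z = "partition_function N t A" and ?V = "scaled_edge_sum N t A" and ?e = "expansion_error N t \<beta>\<^sub>0 (2 * d) A"
  have Z: "?Z c > 0" for c by (rule partition_function_pos)
  have inc: "\<bar>ln (?Z \<beta>) - ln (?Z \<beta>\<^sub>0) - (\<beta>\<^sup>2 - \<beta>\<^sub>0\<^sup>2) / 2 * ?V\<bar> \<le> ?e" if "\<bar>\<beta> - \<beta>\<^sub>0\<bar> \<le> 2 * d" for \<beta>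
    using ln_partition_function_increment[OF A N t _ d(2) that] d(1) by simp
  have i1: "ln (?Z (\<beta>\<^sub>0 + 2 * d)) - ln (?Z \<beta>\<^sub>0) \<le> ((\<beta>\<^sub>0 + 2 * d)\<^sup>2 - \<beta>\<^sub>0\<^sup>2) / 2 * ?V + ?e"
    using inc[of "\<beta>\<^sub>0 + 2 * d"] d by linarith
  have i2: "((\<beta>\<^sub>0 + d)\<^sup>2 - \<beta>\<^sub>0\<^sup>2) / 2 * ?V - ?e \<le> ln (?Z (\<beta>\<^sub>0 + d)) - ln (?Z \<beta>\<^sub>0)"
    using inc[of "\<beta>\<^sub>0 + d"] d by linarith
  have q: "((\<beta>\<^sub>0 + 2 * d)\<^sup>2 - \<beta>\<^sub>0\<^sup>2) / 2 * ?V - 2 * (((\<beta>\<^sub>0 + d)\<^sup>2 - \<beta>\<^sub>0\<^sup>2) / 2 * ?V) = d\<^sup>2 * ?V"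
    by (simp add: power2_eq_square field_simps)
  have "ln (?Z \<beta>\<^sub>0 * ?Z (\<beta>\<^sub>0 + 2 * d) / (?Z (\<beta>\<^sub>0 + d))\<^sup>2) =
      ln (?Z \<beta>\<^sub>0) + ln (?Z (\<beta>\<^sub>0 + 2 * d)) - 2 * ln (?Z (\<beta>\<^sub>0 + d))"
    using Z[of \<beta>\<^sub>0] Z[of "\<beta>\<^sub>0 + d"] Z[of "\<beta>\<^sub>0 + 2 * d"] by (simp add: ln_div ln_mult ln_realpow)
  also have "\<dots> \<le> ln (1 + k\<^sup>2)" using i1 i2 q x by linarith
  finally have "?Z \<beta>\<^sub>0 * ?Z (\<beta>\<^sub>0 + 2 * d) / (?Z (\<beta>\<^sub>0 + d))\<^sup>2 \<le> 1 + k\<^sup>2"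
    using Z[of \<beta>\<^sub>0] Z[of "\<beta>\<^sub>0 + d"] Z[of "\<beta>\<^sub>0 + 2 * d"] by (subst (asm) ln_le_cancel_iff) (auto intro!: add_pos_nonneg)
  then show "?Z \<beta>\<^sub>0 * ?Z (\<beta>\<^sub>0 + 2 * d) / (?Z (\<beta>\<^sub>0 + d))\<^sup>2 - 1 \<le> k\<^sup>2" by simp
qed

lemma hamiltonian_test_accepts_iff:
  "hamiltonian_test \<alpha> \<beta>\<^sub>0 N t A \<sigma> = 0 \<longleftrightarrow>
    \<bar>- hamiltonian N t A \<sigma> - \<beta>\<^sub>0 * scaled_edge_sum N t A\<bar> \<le> normal_z (\<alpha> / 2) * sqrt (scaled_edge_sum N t A)"
  by (auto simp: hamiltonian_test_def c_hat_def d_hat_def)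

text \<open>
  The sign \<open>s\<close> of \<open>\<beta> - \<beta>\<^sub>0\<close> selects the tail: for larger
  parameters acceptance means that minus the Hamiltonian is at most the upper threshold, for smaller ones that
  it is at least the lower one. In both cases the moment generating function at \<open>s * d\<close> has the
  same logarithm \<open>(d * sqrt V)\<^sup>2 / 2 - z * d * sqrt V\<close> up to the expansion error.
\<close>

lemma acceptance_probability_le:
  assumes A: "adjacency A" and N: "N > 0" and t: "t > 0" and d: "0 < d" "d \<le> \<beta>\<^sub>0"
    and L: "0 \<le> L" "L + expansion_error N t \<beta>\<^sub>0 d A \<le> (d * sqrt V)\<^sup>2 / 2 - normal_z (\<alpha> / 2) * (d * sqrt V)"
    and V: "V = scaled_edge_sum N t A" "0 \<le> V"
    and \<beta>: "\<beta> \<in> alternatives W \<beta>\<^sub>0 d"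
  shows "measure (ising N t A \<beta>) {\<sigma> \<in> spins N. hamiltonian_test \<alpha> \<beta>\<^sub>0 N t A \<sigma> = 0} \<le> exp (- L)"
proof -
  let ?Z = "partition_function N t A" and ?z = "normal_z (\<alpha> / 2)" and ?H = "hamiltonian N t A"
  have Z: "?Z c > 0" for c by (rule partition_function_pos)
  define s where "s = (if \<beta>\<^sub>0 \<le> \<beta> then 1 else - 1 :: real)"
  have s: "s = 1 \<or> s = -1" by (simp add: s_def)
  have ss: "s * s = 1" using s by auto
  define a where "a = \<beta>\<^sub>0 * V + s * (?z * sqrt V)"
  have sub: "measure (ising N t A \<beta>) {\<sigma> \<in> spins N. hamiltonian_test \<alpha> \<beta>\<^sub>0 N t A \<sigma> = 0} \<le>
      measure (ising N t A \<beta>) {\<sigma> \<in> spins N. (s * d) * (- ?H \<sigma> - a) \<le> 0}"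
    unfolding measure_ising
  proof (rule sum_mono2)
    show "{\<sigma> \<in> spins N. hamiltonian_test \<alpha> \<beta>\<^sub>0 N t A \<sigma> = 0} \<subseteq> {\<sigma> \<in> spins N. (s * d) * (- ?H \<sigma> - a) \<le> 0}"
    proof (intro Collect_mono impI conjI; elim conjE)
      fix \<sigma> assume "hamiltonian_test \<alpha> \<beta>\<^sub>0 N t A \<sigma> = 0"
      then have "\<bar>- ?H \<sigma> - \<beta>\<^sub>0 * V\<bar> \<le> ?z * sqrt V" by (simp only: hamiltonian_test_accepts_iff V)
      then have "s * (- ?H \<sigma> - a) \<le> 0" using s by (auto simp: a_def)
      then have "d * (s * (- ?H \<sigma> - a)) \<le> 0" using d by (intro mult_nonneg_nonpos[of d]) auto
      then show "(s * d) * (- ?H \<sigma> - a) \<le> 0" by (simp only: mult_ac)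
    qed
  qed (use finite_spins gibbs_weight_nonneg in auto)
  define l where "l = \<beta> - \<beta>\<^sub>0"
  have "measure (ising N t A (\<beta>\<^sub>0 + l)) {\<sigma> \<in> spins N. (s * d) * (- ?H \<sigma> - a) \<le> 0} \<le> 1 / exp L"
  proof (rule ising_tilted_tail)
    show "s * d \<noteq> 0" using s d by auto
    have "\<bar>l\<bar> \<ge> d" using \<beta> by (simp add: alternatives_def l_def)
    then show "1 \<le> l / (s * d)" using d by (auto simp: s_def l_def divide_simps split: if_splits)
    show "1 \<le> exp L" using L by simp
    have inc: "\<bar>ln (?Z (\<beta>\<^sub>0 + s * d)) - ln (?Z \<beta>\<^sub>0) - ((\<beta>\<^sub>0 + s * d)\<^sup>2 - \<beta>\<^sub>0\<^sup>2) / 2 * V\<bar> \<le> expansion_error N t \<beta>\<^sub>0 d A"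
      unfolding V(1) using d s by (intro ln_partition_function_increment[OF A N t]) auto
    have quad: "((\<beta>\<^sub>0 + s * d)\<^sup>2 - \<beta>\<^sub>0\<^sup>2) / 2 * V - s * d * a = (d * sqrt V)\<^sup>2 / 2 - ?z * (d * sqrt V)"
    proof -
      have "((\<beta>\<^sub>0 + s * d)\<^sup>2 - \<beta>\<^sub>0\<^sup>2) / 2 * V - s * d * a = (s * s) * (d\<^sup>2 * V) / 2 - (s * s) * (?z * (d * sqrt V))"
        by (simp add: a_def power2_eq_square algebra_simps add_divide_distrib diff_divide_distrib)
      also have "\<dots> = (d * sqrt V)\<^sup>2 / 2 - ?z * (d * sqrt V)" using V ss by (simp add: power_mult_distrib)
      finally show ?thesis .
    qed
    have "L \<le> ln (?Z (\<beta>\<^sub>0 + s * d)) - ln (?Z \<beta>\<^sub>0) - s * d * a" using inc quad L(2) by linarith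
    then have "exp L \<le> exp (ln (?Z (\<beta>\<^sub>0 + s * d)) - ln (?Z \<beta>\<^sub>0) - s * d * a)" by simp
    also have "\<dots> = ?Z (\<beta>\<^sub>0 + s * d) / ?Z \<beta>\<^sub>0 * exp (- (s * d) * a)"
      using Z by (simp add: exp_diff exp_minus divide_inverse)
    finally show "exp L \<le> ?Z (\<beta>\<^sub>0 + s * d) / ?Z \<beta>\<^sub>0 * exp (- (s * d) * a)" .
  qed
  then show ?thesis using sub by (simp add: l_def exp_minus divide_inverse)
qed

text \<open>
  The moment generating function at \<open>s\<close> of the standardised Hamiltonian is a ratio of partition
  functions at \<open>\<beta>\<^sub>0 + s / sqrt V\<close> and \<open>\<beta>\<^sub>0\<close>. The condition
  \<open>R \<le> h * sqrt V\<close> keeps these parameters in the window for all \<open>\<bar>s\<bar> \<le>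
  R\<close>. The thresholds of the test are the normal quantiles in this scale.
\<close>

lemma rejection_probability_near_level:
  assumes \<alpha>: "0 < \<alpha>" "\<alpha> < 1" and \<epsilon>: "\<epsilon> > 0"
  shows "\<exists>e>0. \<exists>R>0. \<forall>N t A \<beta>\<^sub>0 h. adjacency A \<longrightarrow> N > 0 \<longrightarrow> t > 0 \<longrightarrow> 0 \<le> h \<longrightarrow> h \<le> \<beta>\<^sub>0 \<longrightarrow>
    expansion_error N t \<beta>\<^sub>0 h A \<le> e \<longrightarrow> 0 < scaled_edge_sum N t A \<longrightarrow> R \<le> h * sqrt (scaled_edge_sum N t A) \<longrightarrow>
    \<bar>measure (ising N t A \<beta>\<^sub>0) {\<sigma> \<in> spins N. hamiltonian_test \<alpha> \<beta>\<^sub>0 N t A \<sigma> = 1} - \<alpha>\<bar> \<le> \<epsilon>"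
proof -
  let ?z = "normal_z (\<alpha> / 2)"
  obtain e R where e: "e > 0" and R: "R > 0" and stab: "\<And>P :: real pmf. finite (set_pmf P) \<Longrightarrow>
    (\<And>s. \<bar>s\<bar> \<le> R \<Longrightarrow> \<bar>measure_pmf.expectation P (\<lambda>x. exp (s * x)) - exp (s\<^sup>2 / 2)\<bar> \<le> e) \<Longrightarrow>
    \<bar>measure_pmf.prob P ({..<- ?z} \<union> {?z<..}) - \<alpha>\<bar> \<le> \<epsilon>"
    using two_sided_level_stability[OF \<alpha> \<epsilon>] by blast
  \<comment> \<open>With this tolerance for the logarithm, an error factor \<open>exp e' - 1\<close> costs at most \<open>e\<close> at \<open>s = R\<close>, where the limit is largest.\<close>
  define e' where "e' = ln (1 + e * exp (- R\<^sup>2 / 2))"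
  have e': "e' > 0" using e by (simp add: e'_def ln_gt_zero)
  show ?thesis
  proof (rule exI[of _ e'], rule conjI[OF e'], rule exI[of _ R], rule conjI[OF R], intro allI impI)
    fix N t A \<beta>\<^sub>0 h
    assume A: "adjacency A" and N: "(N::nat) > 0" and t: "(t::real) > 0" and h: "0 \<le> h" "h \<le> \<beta>\<^sub>0"
      and err: "expansion_error N t \<beta>\<^sub>0 h A \<le> e'" and V0: "0 < scaled_edge_sum N t A" and hR: "R \<le> h * sqrt (scaled_edge_sum N t A)"
    define V where "V = scaled_edge_sum N t A"
    define v where "v = sqrt V"
    have v: "v > 0" "v * v = V" using V0 by (auto simp: v_def V_def)
    let ?Z = "partition_function N t A" and ?H = "hamiltonian N t A"
    have Z: "?Z c > 0" for c by (rule partition_function_pos)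
    define T where "T = (\<lambda>\<sigma>. (- ?H \<sigma> - \<beta>\<^sub>0 * V) / v)"
    define P where "P = map_pmf T (gibbs_pmf N t A \<beta>\<^sub>0)"
    have fin: "finite (set_pmf P)"
      using finite_subset[OF set_gibbs_pmf finite_spins] by (simp add: P_def)
    have mgf: "measure_pmf.expectation P (\<lambda>x. exp (s * x)) = ?Z (\<beta>\<^sub>0 + s / v) / ?Z \<beta>\<^sub>0 * exp (- (s * \<beta>\<^sub>0 * v))" for s
    proof -
      have "measure_pmf.expectation P (\<lambda>x. exp (s * x)) = (\<Sum>\<sigma>\<in>spins N. gibbs_weight N t A \<beta>\<^sub>0 \<sigma> * exp (s * T \<sigma>))"
        by (simp add: P_def expectation_gibbs)
      also have "\<dots> = (\<Sum>\<sigma>\<in>spins N. gibbs_weight N t A \<beta>\<^sub>0 \<sigma> * exp (- (s / v) * ?H \<sigma>)) * exp (- (s * \<beta>\<^sub>0 * v))"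
        unfolding sum_distrib_right
      proof (intro sum.cong refl)
        fix \<sigma>
        have "s * T \<sigma> = - (s / v) * ?H \<sigma> + - (s * \<beta>\<^sub>0 * v)"
          using v by (simp add: T_def v(2)[symmetric] field_simps)
        then show "gibbs_weight N t A \<beta>\<^sub>0 \<sigma> * exp (s * T \<sigma>) = gibbs_weight N t A \<beta>\<^sub>0 \<sigma> * exp (- (s / v) * ?H \<sigma>) * exp (- (s * \<beta>\<^sub>0 * v))"
          by (simp only: exp_add mult.assoc)
      qed
      finally show ?thesis by (simp only: gibbs_mgf)
    qed
    have close: "\<bar>measure_pmf.expectation P (\<lambda>x. exp (s * x)) - exp (s\<^sup>2 / 2)\<bar> \<le> e" if s: "\<bar>s\<bar> \<le> R" for s
    proof -
      define r where "r = ln (?Z (\<beta>\<^sub>0 + s / v)) - ln (?Z \<beta>\<^sub>0) - ((\<beta>\<^sub>0 + s / v)\<^sup>2 - \<beta>\<^sub>0\<^sup>2) / 2 * V"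
      have "\<bar>s / v\<bar> \<le> h" using s hR v by (simp add: abs_divide pos_divide_le_eq v_def V_def)
      then have "\<bar>r\<bar> \<le> expansion_error N t \<beta>\<^sub>0 h A"
        unfolding r_def V_def by (intro ln_partition_function_increment[OF A N t h]) simp
      then have r: "\<bar>r\<bar> \<le> e'" using err by linarith
      have "((\<beta>\<^sub>0 + s / v)\<^sup>2 - \<beta>\<^sub>0\<^sup>2) / 2 * V = s * \<beta>\<^sub>0 * v + s\<^sup>2 / 2"
        using v by (simp add: v(2)[symmetric] power2_eq_square field_simps)
      then have "ln (?Z (\<beta>\<^sub>0 + s / v)) - ln (?Z \<beta>\<^sub>0) + - (s * \<beta>\<^sub>0 * v) = s\<^sup>2 / 2 + r"
        unfolding r_def by linarith
      then have "exp (ln (?Z (\<beta>\<^sub>0 + s / v)) - ln (?Z \<beta>\<^sub>0) + - (s * \<beta>\<^sub>0 * v)) = exp (s\<^sup>2 / 2) * exp r"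
        by (simp only: exp_add)
      then have "measure_pmf.expectation P (\<lambda>x. exp (s * x)) = exp (s\<^sup>2 / 2) * exp r"
        unfolding mgf exp_add exp_diff using Z by simp
      then have "\<bar>measure_pmf.expectation P (\<lambda>x. exp (s * x)) - exp (s\<^sup>2 / 2)\<bar> = exp (s\<^sup>2 / 2) * \<bar>exp r - 1\<bar>"
      proof -
        have "exp (s\<^sup>2 / 2) * exp r - exp (s\<^sup>2 / 2) = exp (s\<^sup>2 / 2) * (exp r - 1)" by (simp add: right_diff_distrib)
        then show ?thesis using \<open>measure_pmf.expectation P (\<lambda>x. exp (s * x)) = exp (s\<^sup>2 / 2) * exp r\<close>
          by (simp only: abs_mult abs_exp_cancel)
      qed
      also have "\<dots> \<le> exp (R\<^sup>2 / 2) * (exp e' - 1)"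
      proof (intro mult_mono)
        have "s\<^sup>2 \<le> R\<^sup>2" using s R by (simp add: abs_le_square_iff[symmetric])
        then show "exp (s\<^sup>2 / 2) \<le> exp (R\<^sup>2 / 2)" by simp
        have "exp r \<le> exp e'" "exp (- e') \<le> exp r" using r by auto
        moreover have "2 \<le> exp e' + exp (- e')"
          using exp_ge_add_one_self[of e'] exp_ge_add_one_self[of "- e'"] by linarith
        ultimately show "\<bar>exp r - 1\<bar> \<le> exp e' - 1" by linarith
      qed auto
      also have "\<dots> = e"
      proof -
        have "exp e' = 1 + e * exp (- R\<^sup>2 / 2)" using e by (simp add: e'_def add_pos_pos)
        then show ?thesis by (simp add: exp_minus field_simps)
      qed
      finally show ?thesis .
    qed
    have "measure_pmf.prob P ({..<- ?z} \<union> {?z<..}) =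
        measure (ising N t A \<beta>\<^sub>0) {\<sigma> \<in> spins N. T \<sigma> \<in> {..<- ?z} \<union> {?z<..}}"
      by (simp only: P_def measure_map_pmf vimage_def prob_gibbs)
    also have "{\<sigma> \<in> spins N. T \<sigma> \<in> {..<- ?z} \<union> {?z<..}} = {\<sigma> \<in> spins N. hamiltonian_test \<alpha> \<beta>\<^sub>0 N t A \<sigma> = 1}"
    proof (intro Collect_cong conj_cong refl)
      fix \<sigma>
      have "T \<sigma> < - ?z \<longleftrightarrow> ?H \<sigma> > d_hat \<alpha> \<beta>\<^sub>0 N t A"
        using v by (auto simp: T_def d_hat_def V_def[symmetric] v_def[symmetric] pos_divide_less_eq)
      moreover have "?z < T \<sigma> \<longleftrightarrow> ?H \<sigma> < c_hat \<alpha> \<beta>\<^sub>0 N t A"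
        using v by (auto simp: T_def c_hat_def V_def[symmetric] v_def[symmetric] pos_less_divide_eq)
      ultimately show "T \<sigma> \<in> {..<- ?z} \<union> {?z<..} \<longleftrightarrow> hamiltonian_test \<alpha> \<beta>\<^sub>0 N t A \<sigma> = 1"
        by (auto simp: hamiltonian_test_def)
    qed
    finally show "\<bar>measure (ising N t A \<beta>\<^sub>0) {\<sigma> \<in> spins N. hamiltonian_test \<alpha> \<beta>\<^sub>0 N t A \<sigma> = 1} - \<alpha>\<bar> \<le> \<epsilon>"
      using stab[OF fin close] by simp
  qed
qed

section \<open>Asymptotics along the sequence of graphs\<close>

lemma graph_sum_cong:
  assumes "\<And>e. e \<in> E \<Longrightarrow> a e = b e"
  shows "graph_sum N E a m = graph_sum N E b m"
  using assms by (simp add: graph_sum_def cong: prod.cong)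

text \<open>
  Uniform in \<open>N\<close> apart from the two explicit terms in \<open>N\<close> and \<open>t\<close>. For
  the even subgraph sum the parameter of the complete graph is \<open>N * t * tanh (\<beta> / (N *
  t))\<close>, which lies below \<open>\<beta>\<close> and is 1-Lipschitz in \<open>\<beta>\<close>.
\<close>

lemma expectation_expansion_error_le:
  assumes W: "graphon W" and t: "0 < t" "t < 1" and N: "N > 0" and h: "0 \<le> h" "h \<le> \<beta>\<^sub>0"
    and op: "\<And>v. (\<Sum>i=1..N. (\<Sum>j=1..N. grid_value W N i j / real N * v j)\<^sup>2) \<le> \<rho>\<^sup>2 * (\<Sum>j=1..N. (v j)\<^sup>2)"
    and \<rho>: "0 \<le> \<rho>" and b: "\<beta>\<^sub>0 + h \<le> b" "b * \<rho> < 1"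
    and n: "n > 0" "2 * b * (b / (1 - b * \<rho>)) \<le> real n"
  shows "measure_pmf.expectation (random_graph N t W) (expansion_error N t \<beta>\<^sub>0 h)
    \<le> h * (1 / 2 + 3 * \<beta>\<^sub>0 / (4 * (real N * t)) + (2 * \<beta>\<^sub>0) ^ 3 / ((real N)\<^sup>2 * t ^ 3) + 2 * (b / (1 - b * \<rho>) * 2 ^ n))"
proof -
  let ?G = "random_graph N t W"
  \<comment> \<open>A graphon is symmetric and nonnegative on the unit square only, so the weights are set to 0 outside the index range.\<close>
  define w where "w = (\<lambda>i j. if i \<in> {1..N} \<and> j \<in> {1..N} then grid_value W N i j / real N else 0)"
  define s where "s = real N * t"
  have s: "s > 0" using N t by (simp add: s_def)
  have W01: "0 \<le> grid_value W N i j" "grid_value W N i j \<le> 1"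
    and Wsym: "grid_value W N i j = grid_value W N j i"
    if "i \<in> {1..N}" "j \<in> {1..N}" for i j
    using W that by (auto simp: graphon_def)
  define F where "F = (\<lambda>x. graph_sum N (edges N) (\<lambda>(i, j). x * w i j) (\<lambda>k. 0))"
  have EX: "measure_pmf.expectation ?G (\<lambda>A. even_subgraph_sum N A (tanh (c / s))) = F (s * tanh (c / s))" if "0 \<le> c" for c
  proof -
    have "0 \<le> tanh (c / s)" "tanh (c / s) \<le> 1"
      using that s tanh_real_lt_1[of "c / s"] by auto
    then show ?thesis
      unfolding expectation_even_subgraph_sum[OF W t \<open>0 \<le> tanh (c / s)\<close> \<open>tanh (c / s) \<le> 1\<close>] F_def
      using N by (intro graph_sum_cong) (auto simp: w_def s_def edges_def)
  qed
  have b0: "0 \<le> b" using h b by linarith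
  have Fdiff: "F (s * tanh ((\<beta>\<^sub>0 + h) / s)) - F (s * tanh ((\<beta>\<^sub>0 - h) / s)) \<le> 2 * h * (b / (1 - b * \<rho>) * 2 ^ n)"
  proof -
    have le: "(\<beta>\<^sub>0 - h) / s \<le> (\<beta>\<^sub>0 + h) / s" using h s by (intro divide_right_mono) auto
    have x: "0 \<le> s * tanh ((\<beta>\<^sub>0 - h) / s)" using h s by simp
    have xy: "s * tanh ((\<beta>\<^sub>0 - h) / s) \<le> s * tanh ((\<beta>\<^sub>0 + h) / s)" using le s by simp
    have "s * tanh ((\<beta>\<^sub>0 + h) / s) \<le> s * ((\<beta>\<^sub>0 + h) / s)"
      using h s by (intro mult_left_mono tanh_bounds) auto
    then have y: "s * tanh ((\<beta>\<^sub>0 + h) / s) \<le> b" using b s by simp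
    have "F (s * tanh ((\<beta>\<^sub>0 + h) / s)) - F (s * tanh ((\<beta>\<^sub>0 - h) / s)) \<le>
        (s * tanh ((\<beta>\<^sub>0 + h) / s) - s * tanh ((\<beta>\<^sub>0 - h) / s)) * (b / (1 - b * \<rho>) * 2 ^ n)"
      unfolding F_def
    proof (rule high_temperature_bound[OF _ _ _ _ \<rho> b0 b(2) n x xy y])
      show "w i j = w j i" for i j using Wsym by (auto simp: w_def)
      show "0 \<le> w i j" for i j using W01 by (auto simp: w_def)
      have "(\<Sum>i=1..N. \<Sum>j=1..N. (w i j)\<^sup>2) \<le> (\<Sum>i=1..N. \<Sum>j=1..N. (1 / real N)\<^sup>2)"
        using W01 by (intro sum_mono power_mono) (auto simp: w_def divide_right_mono)
      also have "\<dots> = 1" using N by (simp add: power2_eq_square)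
      finally show "(\<Sum>i=1..N. \<Sum>j=1..N. (w i j)\<^sup>2) \<le> 1" .
      fix v
      have "(\<Sum>i=1..N. (\<Sum>k=1..N. w i k * v k)\<^sup>2) = (\<Sum>i=1..N. (\<Sum>j=1..N. grid_value W N i j / real N * v j)\<^sup>2)"
        by (intro sum.cong refl arg_cong[where f = "\<lambda>x. x\<^sup>2"]) (auto simp: w_def)
      then show "(\<Sum>i=1..N. (\<Sum>k=1..N. w i k * v k)\<^sup>2) \<le> \<rho>\<^sup>2 * (\<Sum>k=1..N. (v k)\<^sup>2)" using op[of v] by simp
    qed
    also have "\<dots> \<le> 2 * h * (b / (1 - b * \<rho>) * 2 ^ n)"
    proof (rule mult_right_mono)
      have "s * (tanh ((\<beta>\<^sub>0 + h) / s) - tanh ((\<beta>\<^sub>0 - h) / s)) \<le> s * ((\<beta>\<^sub>0 + h) / s - (\<beta>\<^sub>0 - h) / s)"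
        using s le by (intro mult_left_mono tanh_diff_le) auto
      also have "\<dots> = 2 * h" using s by (simp add: diff_divide_distrib[symmetric])
      finally show "s * tanh ((\<beta>\<^sub>0 + h) / s) - s * tanh ((\<beta>\<^sub>0 - h) / s) \<le> 2 * h" by (simp add: right_diff_distrib)
      show "0 \<le> b / (1 - b * \<rho>) * 2 ^ n" using b0 b by simp
    qed
    finally show ?thesis .
  qed
  have "measure_pmf.expectation ?G (expansion_error N t \<beta>\<^sub>0 h) =
     h / (2 * s) * measure_pmf.expectation ?G (loop_count N)
     + 3 * \<beta>\<^sub>0 * h / (4 * s\<^sup>2) * measure_pmf.expectation ?G (loop_count N)
     + h * (2 * \<beta>\<^sub>0) ^ 3 / s ^ 4 * measure_pmf.expectation ?G (edge_count N)
     + (F (s * tanh ((\<beta>\<^sub>0 + h) / s)) - F (s * tanh ((\<beta>\<^sub>0 - h) / s)))"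
    using h EX[of "\<beta>\<^sub>0 + h"] EX[of "\<beta>\<^sub>0 - h"]
    by (simp add: expansion_error_def[abs_def] s_def[symmetric] mult.assoc)
  also have "\<dots> \<le> h / (2 * s) * (t * real N) + 3 * \<beta>\<^sub>0 * h / (4 * s\<^sup>2) * (t * real N)
     + h * (2 * \<beta>\<^sub>0) ^ 3 / s ^ 4 * (t * (real N)\<^sup>2) + 2 * h * (b / (1 - b * \<rho>) * 2 ^ n)"
    using h s by (intro add_mono mult_left_mono expectation_edge_count_le[OF W t] Fdiff) auto
  also have "h / (2 * s) * (t * real N) = h * (1 / 2)" using N t by (simp add: s_def)
  also have "3 * \<beta>\<^sub>0 * h / (4 * s\<^sup>2) * (t * real N) = h * (3 * \<beta>\<^sub>0 / (4 * (real N * t)))"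
    using s N t by (simp add: s_def power2_eq_square field_simps)
  also have "h * (2 * \<beta>\<^sub>0) ^ 3 / s ^ 4 * (t * (real N)\<^sup>2) = h * ((2 * \<beta>\<^sub>0) ^ 3 / ((real N)\<^sup>2 * t ^ 3))"
  proof -
    have "s ^ 4 = ((real N)\<^sup>2 * t ^ 3) * (t * (real N)\<^sup>2)" by (simp add: s_def eval_nat_numeral)
    then show ?thesis using N t by simp
  qed
  finally show ?thesis by (simp add: distrib_left mult.assoc)
qed

lemma edge_density_growth:
  fixes \<theta> :: "nat \<Rightarrow> real"
  assumes C: "C > 0" "eventually (\<lambda>N. real N powr (2 / 3) * \<theta> N \<ge> C) sequentially"
  shows "filterlim (\<lambda>N. real N * \<theta> N) at_top sequentially"
    and "eventually (\<lambda>N. (real N)\<^sup>2 * \<theta> N ^ 3 \<ge> C ^ 3) sequentially"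
proof -
  have "filterlim (\<lambda>N. real N powr (1 / 3)) at_top sequentially" by real_asymp
  then have "filterlim (\<lambda>N. C * real N powr (1 / 3)) at_top sequentially"
    by (rule filterlim_tendsto_pos_mult_at_top[OF tendsto_const C(1)])
  moreover have "eventually (\<lambda>N. C * real N powr (1 / 3) \<le> real N * \<theta> N) sequentially"
    using C(2) eventually_gt_at_top[of 0]
  proof eventually_elim
    case (elim N)
    have "C * real N powr (1 / 3) \<le> (real N powr (2 / 3) * \<theta> N) * real N powr (1 / 3)"
      using elim by (intro mult_right_mono) auto
    also have "\<dots> = (real N powr (2 / 3) * real N powr (1 / 3)) * \<theta> N" by (simp only: mult_ac)
    also have "real N powr (2 / 3) * real N powr (1 / 3) = real N"
      using elim by (simp add: powr_add[symmetric])
    finally show ?case .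
  qed
  ultimately show "filterlim (\<lambda>N. real N * \<theta> N) at_top sequentially"
    by (rule filterlim_at_top_mono)
  show "eventually (\<lambda>N. (real N)\<^sup>2 * \<theta> N ^ 3 \<ge> C ^ 3) sequentially"
    using C(2) eventually_gt_at_top[of 0]
  proof eventually_elim
    case (elim N)
    have "C ^ 3 \<le> (real N powr (2 / 3) * \<theta> N) ^ 3" using elim C(1) by (intro power_mono) auto
    also have "\<dots> = (real N powr (2 / 3)) ^ 3 * \<theta> N ^ 3" by (rule power_mult_distrib)
    also have "(real N powr (2 / 3)) ^ 3 = (real N)\<^sup>2"
      using elim by (simp add: powr_power)
    finally show ?case .
  qed
qed

lemma expansion_error_nonneg:
  assumes "adjacency A" "N > 0" "t > 0" "0 \<le> h" "h \<le> \<beta>\<^sub>0"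
  shows "0 \<le> expansion_error N t \<beta>\<^sub>0 h A"
  using ln_partition_function_increment[OF assms, of \<beta>\<^sub>0] assms(4) by simp

text \<open>
  The constants are chosen strictly between the null hypothesis and the critical point: \<open>\<beta>\<^sub>0
  < b < 1 / op_norm W\<close> and \<open>op_norm W < \<rho> < 1 / b\<close>, so that \<open>b * \<rho> <
  1\<close> and the window around \<open>\<beta>\<^sub>0\<close> eventually lies below \<open>b\<close>. The
  expectation is then at most a constant times \<open>h\<close>, and Markov's inequality applies.
\<close>

lemma expansion_error_vanishes:
  fixes \<theta> h :: "nat \<Rightarrow> real"
  assumes W: "graphon W" and R: "riemann_integrable (\<lambda>(x, y). W x y) (0, 0) (1, 1)"
    and \<theta>: "\<And>N. N \<ge> 1 \<Longrightarrow> 0 < \<theta> N \<and> \<theta> N < 1"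
    and C: "C > 0" "eventually (\<lambda>N. real N powr (2 / 3) * \<theta> N \<ge> C) sequentially"
    and \<beta>: "0 < \<beta>\<^sub>0" "\<beta>\<^sub>0 < 1 / op_norm W"
    and h: "\<And>N. N \<ge> 1 \<Longrightarrow> 0 \<le> h N" "h \<longlonglongrightarrow> 0" and e: "e > 0"
  shows "(\<lambda>N. measure_pmf.prob (random_graph N (\<theta> N) W) {A. e \<le> expansion_error N (\<theta> N) \<beta>\<^sub>0 (h N) A}) \<longlonglongrightarrow> 0"
proof -
  define L where "L = op_norm W"
  have L: "L > 0"
  proof (rule ccontr)
    assume "\<not> L > 0"
    then have "1 / L \<le> 0" by (simp add: divide_nonneg_nonpos)
    then show False using \<beta> unfolding L_def by linarith
  qed
  define b where "b = (\<beta>\<^sub>0 + 1 / L) / 2"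
  have b: "\<beta>\<^sub>0 < b" "b < 1 / L" "0 < b" using \<beta> by (auto simp: b_def L_def)
  define \<rho> where "\<rho> = (L + 1 / b) / 2"
  have bL: "b * L < 1" using b L by (simp add: pos_less_divide_eq)
  then have "L < 1 / b" using b by (simp add: pos_less_divide_eq mult.commute)
  then have \<rho>: "L < \<rho>" "0 \<le> \<rho>" using L by (auto simp: \<rho>_def)
  have b\<rho>: "b * \<rho> < 1" using bL b by (simp add: \<rho>_def distrib_left)
  obtain n0 where n0: "\<And>N v. N \<ge> n0 \<Longrightarrow> (\<Sum>i=1..N. (\<Sum>j=1..N. grid_value W N i j / real N * v j)\<^sup>2)
    \<le> \<rho>\<^sup>2 * (\<Sum>j=1..N. (v j)\<^sup>2)"
    using graphon_matrix_norm[OF W R, of "\<rho> - L"] \<rho> by (auto simp: L_def)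
  obtain m where m: "2 * b * (b / (1 - b * \<rho>)) \<le> real m" using real_arch_simple by blast
  define n where "n = Suc m"
  have n: "n > 0" "2 * b * (b / (1 - b * \<rho>)) \<le> real n" using m by (auto simp: n_def)
  define K where "K = 1 / 2 + 3 * \<beta>\<^sub>0 / 4 + (2 * \<beta>\<^sub>0) ^ 3 / C ^ 3 + 2 * (b / (1 - b * \<rho>) * 2 ^ n)"
  note growth = edge_density_growth[OF C]
  have "eventually (\<lambda>N. h N < min \<beta>\<^sub>0 (b - \<beta>\<^sub>0)) sequentially"
    using h(2) \<beta> b by (intro order_tendstoD(2)[of h 0]) auto
  then have bound: "eventually (\<lambda>N. measure_pmf.prob (random_graph N (\<theta> N) W) {A. e \<le> expansion_error N (\<theta> N) \<beta>\<^sub>0 (h N) A} \<le> h N * K / e) sequentially"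
    using growth(2) growth(1)[unfolded filterlim_at_top, rule_format, of 1] eventually_ge_at_top[of n0] eventually_ge_at_top[of 1]
  proof eventually_elim
    case (elim N)
    have t: "0 < \<theta> N" "\<theta> N < 1" and N: "N > 0" using \<theta>[of N] elim by auto
    have hN: "0 \<le> h N" "h N \<le> \<beta>\<^sub>0" using h(1)[of N] elim by auto
    have "measure_pmf.prob (random_graph N (\<theta> N) W) {A. e \<le> expansion_error N (\<theta> N) \<beta>\<^sub>0 (h N) A}
      \<le> measure_pmf.expectation (random_graph N (\<theta> N) W) (expansion_error N (\<theta> N) \<beta>\<^sub>0 (h N)) / e"
      using expansion_error_nonneg[OF random_graph_adjacency N t(1) hN] e
      by (intro prob_le_expectation finite_random_graph)
    also have "\<dots> \<le> h N * (1 / 2 + 3 * \<beta>\<^sub>0 / (4 * (real N * \<theta> N)) + (2 * \<beta>\<^sub>0) ^ 3 / ((real N)\<^sup>2 * \<theta> N ^ 3) + 2 * (b / (1 - b * \<rho>) * 2 ^ n)) / e"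
      using e elim n0 by (intro divide_right_mono expectation_expansion_error_le[OF W t N hN _ \<rho>(2) _ b\<rho> n]) auto
    also have "\<dots> \<le> h N * K / e"
    proof (intro divide_right_mono mult_left_mono hN)
      have "3 * \<beta>\<^sub>0 / (4 * (real N * \<theta> N)) \<le> 3 * \<beta>\<^sub>0 / 4" using elim \<beta> by (intro divide_left_mono) auto
      moreover have "(2 * \<beta>\<^sub>0) ^ 3 / ((real N)\<^sup>2 * \<theta> N ^ 3) \<le> (2 * \<beta>\<^sub>0) ^ 3 / C ^ 3"
        using elim \<beta> C N t by (intro divide_left_mono) auto
      ultimately show "1 / 2 + 3 * \<beta>\<^sub>0 / (4 * (real N * \<theta> N)) + (2 * \<beta>\<^sub>0) ^ 3 / ((real N)\<^sup>2 * \<theta> N ^ 3) + 2 * (b / (1 - b * \<rho>) * 2 ^ n) \<le> K"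
        unfolding K_def by linarith
      show "0 \<le> e" using e by simp
    qed
    finally show ?case .
  qed
  have "(\<lambda>N. h N * K / e) \<longlonglongrightarrow> 0 * K / e" using e by (intro tendsto_intros h) auto
  then have lim: "(\<lambda>N. h N * K / e) \<longlonglongrightarrow> 0" by simp
  show ?thesis
    by (rule tendsto_sandwich[OF _ bound tendsto_const lim]) simp
qed

lemma scaled_edge_sum_lower_bound:
  fixes \<theta> :: "nat \<Rightarrow> real"
  assumes W: "graphon W" and R: "riemann_integrable (\<lambda>(x, y). W x y) (0, 0) (1, 1)"
    and pos: "(LINT p|lebesgue_on ({0..1} \<times> {0..1}). (case p of (x, y) \<Rightarrow> W x y)) > 0"
    and \<theta>: "\<And>N. N \<ge> 1 \<Longrightarrow> 0 < \<theta> N \<and> \<theta> N < 1"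
    and C: "C > 0" "eventually (\<lambda>N. real N powr (2 / 3) * \<theta> N \<ge> C) sequentially"
  shows "\<exists>c>0. (\<lambda>N. measure_pmf.prob (random_graph N (\<theta> N) W) {A. scaled_edge_sum N (\<theta> N) A < c / \<theta> N}) \<longlonglongrightarrow> 0"
proof -
  obtain c n0 where c: "c > 0" and n0: "\<And>N. N \<ge> n0 \<Longrightarrow> c * (real N)\<^sup>2 \<le> (\<Sum>i=1..N. \<Sum>j=1..N. grid_value W N i j)"
    using graphon_density[OF W R pos] by blast
  have "filterlim (\<lambda>N. c / 8 * (real N * \<theta> N)) at_top sequentially"
    using c by (intro filterlim_tendsto_pos_mult_at_top[OF tendsto_const] edge_density_growth[OF C]) auto
  then have "filterlim (\<lambda>N. - (c / 8 * (real N * \<theta> N))) at_bot sequentially"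
    by (simp add: filterlim_uminus_at_top)
  then have lim: "(\<lambda>N. exp (- (c / 8 * (real N * \<theta> N)))) \<longlonglongrightarrow> 0"
    by (rule filterlim_compose[OF exp_at_bot])
  have "eventually (\<lambda>N. measure_pmf.prob (random_graph N (\<theta> N) W) {A. scaled_edge_sum N (\<theta> N) A < c / 16 / \<theta> N}
      \<le> exp (- (c / 8 * (real N * \<theta> N)))) sequentially"
    using eventually_ge_at_top[of n0] eventually_ge_at_top[of 1]
  proof eventually_elim
    case (elim N)
    have t: "0 < \<theta> N" "\<theta> N < 1" and N: "N > 0" using \<theta>[of N] elim by auto
    have "measure_pmf.prob (random_graph N (\<theta> N) W) {A. scaled_edge_sum N (\<theta> N) A < c / 16 / \<theta> N}
       \<le> exp (- (c * \<theta> N * (real N)\<^sup>2 / 8))"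
      using scaled_edge_sum_lower_tail[OF W t N n0[OF elim(1)]] by simp
    also have "\<dots> \<le> exp (- (c / 8 * (real N * \<theta> N)))"
    proof -
      have "real N * 1 \<le> real N * real N" using N by (intro mult_left_mono) auto
      then have "c / 8 * \<theta> N * real N \<le> c / 8 * \<theta> N * (real N)\<^sup>2"
        using c t by (intro mult_left_mono) (auto simp: power2_eq_square)
      then show ?thesis by (simp add: mult_ac)
    qed
    finally show ?case .
  qed
  then have "(\<lambda>N. measure_pmf.prob (random_graph N (\<theta> N) W) {A. scaled_edge_sum N (\<theta> N) A < c / 16 / \<theta> N}) \<longlonglongrightarrow> 0"
    by (intro tendsto_sandwich[OF _ _ tendsto_const lim]) auto
  then show ?thesis using c by (intro exI[of _ "c / 16"]) simp
qed

text \<open>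
  Suited to the estimates below, which hold for every graph outside exceptional sets of vanishing probability.
\<close>

lemma converges_in_probI:
  assumes "\<And>\<epsilon>. \<epsilon> > 0 \<Longrightarrow> \<exists>B. (\<lambda>N. measure_pmf.prob (M N) (B N)) \<longlonglongrightarrow> 0 \<and>
    eventually (\<lambda>N. \<forall>\<omega>\<in>set_pmf (M N) - B N. \<bar>X N \<omega> - c\<bar> \<le> \<epsilon>) sequentially"
  shows "converges_in_prob M X c"
  unfolding converges_in_prob_def
proof (intro allI impI)
  fix \<epsilon> :: real assume "\<epsilon> > 0"
  then obtain B where B: "(\<lambda>N. measure_pmf.prob (M N) (B N)) \<longlonglongrightarrow> 0"
    and ev: "eventually (\<lambda>N. \<forall>\<omega>\<in>set_pmf (M N) - B N. \<bar>X N \<omega> - c\<bar> \<le> \<epsilon>) sequentially"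
    using assms by blast
  have "eventually (\<lambda>N. measure_pmf.prob (M N) {\<omega>. \<bar>X N \<omega> - c\<bar> > \<epsilon>} \<le> measure_pmf.prob (M N) (B N)) sequentially"
    using ev
  proof eventually_elim
    case (elim N)
    show ?case
    proof (rule measure_pmf.finite_measure_mono_AE)
      show "AE \<omega> in M N. \<omega> \<in> {\<omega>. \<bar>X N \<omega> - c\<bar> > \<epsilon>} \<longrightarrow> \<omega> \<in> B N"
        unfolding AE_measure_pmf_iff
      proof (intro ballI impI)
        fix \<omega> assume "\<omega> \<in> set_pmf (M N)" "\<omega> \<in> {\<omega>. \<bar>X N \<omega> - c\<bar> > \<epsilon>}"
        then show "\<omega> \<in> B N" using elim by (cases "\<omega> \<in> B N") force+
      qed
    qed simp
  qed
  then show "(\<lambda>N. measure_pmf.prob (M N) {\<omega>. \<bar>X N \<omega> - c\<bar> > \<epsilon>}) \<longlonglongrightarrow> 0"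
    by (intro tendsto_sandwich[OF _ _ tendsto_const B]) auto
qed

lemma prob_union_tendsto_zero:
  assumes "(\<lambda>N. measure_pmf.prob (M N) (A N)) \<longlonglongrightarrow> 0" "(\<lambda>N. measure_pmf.prob (M N) (B N)) \<longlonglongrightarrow> 0"
  shows "(\<lambda>N. measure_pmf.prob (M N) (A N \<union> B N)) \<longlonglongrightarrow> 0"
proof (rule tendsto_sandwich[OF _ _ tendsto_const])
  show "eventually (\<lambda>N. measure_pmf.prob (M N) (A N \<union> B N) \<le> measure_pmf.prob (M N) (A N) + measure_pmf.prob (M N) (B N)) sequentially"
    by (intro always_eventually allI measure_Un_le) auto
  show "(\<lambda>N. measure_pmf.prob (M N) (A N) + measure_pmf.prob (M N) (B N)) \<longlonglongrightarrow> 0"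
    using tendsto_add[OF assms] by simp
qed auto

section \<open>Convergence of the risks\<close>

lemma scaled_edge_sum_nonneg:
  assumes "adjacency A" shows "0 \<le> scaled_edge_sum N t A"
proof -
  have "0 \<le> A i j" for i j by (rule adjacency_nonneg[OF assms])
  then show ?thesis unfolding scaled_edge_sum_def by (intro mult_nonneg_nonneg sum_nonneg) auto
qed

lemma min_risk_tendsto_one:
  fixes \<theta> \<delta> :: "nat \<Rightarrow> real"
  assumes W: "graphon W" and R: "riemann_integrable (\<lambda>(x, y). W x y) (0, 0) (1, 1)"
    and \<theta>: "\<And>N. N \<ge> 1 \<Longrightarrow> 0 < \<theta> N \<and> \<theta> N < 1"
    and C: "C > 0" "eventually (\<lambda>N. real N powr (2 / 3) * \<theta> N \<ge> C) sequentially"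
    and \<beta>: "0 < \<beta>\<^sub>0" "\<beta>\<^sub>0 < 1 / op_norm W"
    and \<delta>: "\<And>N. N \<ge> 1 \<Longrightarrow> 0 < \<delta> N" "\<delta> \<longlonglongrightarrow> 0"
    and small: "(\<lambda>N. \<delta> N / sqrt (\<theta> N)) \<longlonglongrightarrow> 0"
  shows "converges_in_prob (\<lambda>N. random_graph N (\<theta> N) W) (\<lambda>N. min_risk W \<beta>\<^sub>0 (\<theta> N) (\<delta> N) N) 1"
proof (rule converges_in_probI)
  fix \<epsilon> :: real assume \<epsilon>: "\<epsilon> > 0"
  define k where "k = ln (1 + \<epsilon>\<^sup>2)"
  have "0 < \<epsilon>\<^sup>2" using \<epsilon> by simp
  then have k: "k > 0" unfolding k_def by (intro ln_gt_zero) linarith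
  define B1 where "B1 = (\<lambda>N. {A. k / 6 \<le> expansion_error N (\<theta> N) \<beta>\<^sub>0 (2 * \<delta> N) A})"
  define B2 where "B2 = (\<lambda>N. {A. k / (2 * (\<delta> N)\<^sup>2) \<le> scaled_edge_sum N (\<theta> N) A})"
  have "(\<lambda>N. 2 * \<delta> N) \<longlonglongrightarrow> 2 * 0" by (intro tendsto_intros \<delta>)
  then have "(\<lambda>N. measure_pmf.prob (random_graph N (\<theta> N) W) (B1 N)) \<longlonglongrightarrow> 0"
    unfolding B1_def using k \<delta>(1) less_imp_le
    by (intro expansion_error_vanishes[OF W R \<theta> C \<beta>]) auto
  moreover have "(\<lambda>N. measure_pmf.prob (random_graph N (\<theta> N) W) (B2 N)) \<longlonglongrightarrow> 0"
  proof (rule tendsto_sandwich[OF _ _ tendsto_const])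
    have "(\<lambda>N. 3 / k * (\<delta> N / sqrt (\<theta> N))\<^sup>2) \<longlonglongrightarrow> 3 / k * 0\<^sup>2" by (intro tendsto_intros small)
    then show "(\<lambda>N. 3 / k * (\<delta> N / sqrt (\<theta> N))\<^sup>2) \<longlonglongrightarrow> 0" by simp
    show "eventually (\<lambda>N. measure_pmf.prob (random_graph N (\<theta> N) W) (B2 N) \<le> 3 / k * (\<delta> N / sqrt (\<theta> N))\<^sup>2) sequentially"
      using eventually_ge_at_top[of 1]
    proof eventually_elim
      case (elim N)
      have t: "0 < \<theta> N" "\<theta> N < 1" and d: "0 < \<delta> N" and N: "N > 0" using \<theta> \<delta>(1) elim by auto
      have pos: "0 < k / (2 * (\<delta> N)\<^sup>2)" using k d by simp
      have "measure_pmf.prob (random_graph N (\<theta> N) W) (B2 N) \<le>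
          measure_pmf.expectation (random_graph N (\<theta> N) W) (scaled_edge_sum N (\<theta> N)) / (k / (2 * (\<delta> N)\<^sup>2))"
        unfolding B2_def using pos
        by (intro prob_le_expectation finite_random_graph scaled_edge_sum_nonneg random_graph_adjacency)
      also have "\<dots> \<le> 3 / (2 * \<theta> N) / (k / (2 * (\<delta> N)\<^sup>2))"
        using pos by (intro divide_right_mono expectation_scaled_edge_sum_le[OF W t N]) auto
      also have "\<dots> = 3 / k * (\<delta> N / sqrt (\<theta> N))\<^sup>2"
        using t k d by (simp add: power_divide field_simps)
      finally show ?case .
    qed
  qed auto
  ultimately have "(\<lambda>N. measure_pmf.prob (random_graph N (\<theta> N) W) (B1 N \<union> B2 N)) \<longlonglongrightarrow> 0"
    by (rule prob_union_tendsto_zero)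
  moreover have "eventually (\<lambda>N. \<forall>A\<in>set_pmf (random_graph N (\<theta> N) W) - (B1 N \<union> B2 N).
      \<bar>min_risk W \<beta>\<^sub>0 (\<theta> N) (\<delta> N) N A - 1\<bar> \<le> \<epsilon>) sequentially"
  proof -
    have "eventually (\<lambda>N. \<delta> N < min (\<beta>\<^sub>0 / 2) (1 / op_norm W - \<beta>\<^sub>0)) sequentially"
      using \<delta>(2) \<beta> by (intro order_tendstoD(2)[of \<delta> 0]) auto
    then show ?thesis using eventually_ge_at_top[of 1]
    proof eventually_elim
      case (elim N)
      have t: "0 < \<theta> N" and d: "0 < \<delta> N" and N: "N > 0" using \<theta> \<delta>(1) elim by auto
      have alt: "\<beta>\<^sub>0 + \<delta> N \<in> alternatives W \<beta>\<^sub>0 (\<delta> N)"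
        using elim d \<beta> by (simp add: alternatives_def)
      show ?case
      proof
        fix A assume "A \<in> set_pmf (random_graph N (\<theta> N) W) - (B1 N \<union> B2 N)"
        then have A: "adjacency A" and err: "expansion_error N (\<theta> N) \<beta>\<^sub>0 (2 * \<delta> N) A < k / 6"
          and V: "scaled_edge_sum N (\<theta> N) A < k / (2 * (\<delta> N)\<^sup>2)"
          by (auto simp: B1_def B2_def not_le intro: random_graph_adjacency)
        have "(\<delta> N)\<^sup>2 * scaled_edge_sum N (\<theta> N) A \<le> (\<delta> N)\<^sup>2 * (k / (2 * (\<delta> N)\<^sup>2))"
          using V by (intro mult_left_mono) auto
        also have "\<dots> = k / 2" using d by simp
        finally have "1 - \<epsilon> \<le> min_risk W \<beta>\<^sub>0 (\<theta> N) (\<delta> N) N A"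
          using err elim d \<epsilon> by (intro min_risk_ge_expansion[OF A N t _ _ alt]) (auto simp: k_def)
        moreover have "min_risk W \<beta>\<^sub>0 (\<theta> N) (\<delta> N) N A \<le> 1"
          using alt by (intro min_risk_bounds) auto
        ultimately show "\<bar>min_risk W \<beta>\<^sub>0 (\<theta> N) (\<delta> N) N A - 1\<bar> \<le> \<epsilon>" using \<epsilon> by linarith
      qed
    qed
  qed
  ultimately show "\<exists>B. (\<lambda>N. measure_pmf.prob (random_graph N (\<theta> N) W) (B N)) \<longlonglongrightarrow> 0 \<and>
    eventually (\<lambda>N. \<forall>\<omega>\<in>set_pmf (random_graph N (\<theta> N) W) - B N. \<bar>min_risk W \<beta>\<^sub>0 (\<theta> N) (\<delta> N) N \<omega> - 1\<bar> \<le> \<epsilon>) sequentially"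
    by (intro exI[of _ "\<lambda>N. B1 N \<union> B2 N"] conjI)
qed

text \<open>
  Two windows are used. For the level, a window of radius proportional to \<open>sqrt \<theta>\<close>, which
  contains all the parameters that enter the moment generating function; for the power, the window of radius
  \<open>\<delta>\<close>, at whose ends \<open>\<delta> * sqrt V\<close> tends to infinity.
\<close>

lemma hamiltonian_test_risk_tendsto:
  fixes \<theta> \<delta> :: "nat \<Rightarrow> real"
  assumes W: "graphon W" and R: "riemann_integrable (\<lambda>(x, y). W x y) (0, 0) (1, 1)"
    and pos: "(LINT p|lebesgue_on ({0..1} \<times> {0..1}). (case p of (x, y) \<Rightarrow> W x y)) > 0"
    and \<theta>: "\<And>N. N \<ge> 1 \<Longrightarrow> 0 < \<theta> N \<and> \<theta> N < 1" "\<theta> \<longlonglongrightarrow> 0"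
    and C: "C > 0" "eventually (\<lambda>N. real N powr (2 / 3) * \<theta> N \<ge> C) sequentially"
    and \<beta>: "0 < \<beta>\<^sub>0" "\<beta>\<^sub>0 < 1 / op_norm W"
    and \<delta>: "\<And>N. N \<ge> 1 \<Longrightarrow> 0 < \<delta> N" "\<delta> \<longlonglongrightarrow> 0"
    and large: "(\<lambda>N. sqrt (\<theta> N) / \<delta> N) \<longlonglongrightarrow> 0"
    and \<alpha>: "0 < \<alpha>" "\<alpha> < 1"
  shows "converges_in_prob (\<lambda>N. random_graph N (\<theta> N) W)
    (\<lambda>N. risk W \<beta>\<^sub>0 (\<theta> N) (\<delta> N) N (hamiltonian_test \<alpha> \<beta>\<^sub>0 N (\<theta> N))) \<alpha>"
proof (rule converges_in_probI)
  fix \<epsilon> :: real assume \<epsilon>: "\<epsilon> > 0"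
  let ?z = "normal_z (\<alpha> / 2)"
  have z: "0 \<le> ?z" by (rule normal_z_two_sided(2)[OF \<alpha>])
  have "\<epsilon> / 2 > 0" using \<epsilon> by simp
  from rejection_probability_near_level[OF \<alpha> this]
  obtain e r where e: "e > 0" and r: "r > 0" and level: "\<forall>N t A \<beta>\<^sub>0 h. adjacency A \<longrightarrow> N > 0 \<longrightarrow> t > 0 \<longrightarrow> 0 \<le> h \<longrightarrow> h \<le> \<beta>\<^sub>0 \<longrightarrow>
    expansion_error N t \<beta>\<^sub>0 h A \<le> e \<longrightarrow> 0 < scaled_edge_sum N t A \<longrightarrow> r \<le> h * sqrt (scaled_edge_sum N t A) \<longrightarrow>
    \<bar>measure (ising N t A \<beta>\<^sub>0) {\<sigma> \<in> spins N. hamiltonian_test \<alpha> \<beta>\<^sub>0 N t A \<sigma> = 1} - \<alpha>\<bar> \<le> \<epsilon> / 2"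
    by (elim exE conjE) (rule that)
  define L where "L = max 0 (ln (2 / \<epsilon>))"
  have L: "0 \<le> L" "exp (- L) \<le> \<epsilon> / 2"
  proof -
    have "exp (- L) \<le> exp (- ln (2 / \<epsilon>))" by (simp add: L_def)
    also have "\<dots> = \<epsilon> / 2" using \<epsilon> by (simp add: exp_minus)
    finally show "exp (- L) \<le> \<epsilon> / 2" .
  qed (simp add: L_def)
  obtain c where c: "c > 0" and cV: "(\<lambda>N. measure_pmf.prob (random_graph N (\<theta> N) W) {A. scaled_edge_sum N (\<theta> N) A < c / \<theta> N}) \<longlonglongrightarrow> 0"
    using scaled_edge_sum_lower_bound[OF W R pos \<theta>(1) C] by blast
  define h where "h = (\<lambda>N. r * sqrt (\<theta> N / c))"
  have h0: "0 \<le> h N" if "N \<ge> 1" for N using \<theta>(1)[OF that] r c by (simp add: h_def)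
  have "(\<lambda>N. r * sqrt (\<theta> N / c)) \<longlonglongrightarrow> r * sqrt (0 / c)" using c by (intro tendsto_intros \<theta>) auto
  then have hlim: "h \<longlonglongrightarrow> 0" by (simp add: h_def)
  define B1 where "B1 = (\<lambda>N. {A. e \<le> expansion_error N (\<theta> N) \<beta>\<^sub>0 (h N) A})"
  define B2 where "B2 = (\<lambda>N. {A. 1 \<le> expansion_error N (\<theta> N) \<beta>\<^sub>0 (\<delta> N) A})"
  define B3 where "B3 = (\<lambda>N. {A. scaled_edge_sum N (\<theta> N) A < c / \<theta> N})"
  have "(\<lambda>N. measure_pmf.prob (random_graph N (\<theta> N) W) (B1 N \<union> (B2 N \<union> B3 N))) \<longlonglongrightarrow> 0"
  proof (intro prob_union_tendsto_zero)
    show "(\<lambda>N. measure_pmf.prob (random_graph N (\<theta> N) W) (B1 N)) \<longlonglongrightarrow> 0"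
      unfolding B1_def by (rule expansion_error_vanishes[OF W R \<theta>(1) C \<beta> h0 hlim e])
    show "(\<lambda>N. measure_pmf.prob (random_graph N (\<theta> N) W) (B2 N)) \<longlonglongrightarrow> 0"
      unfolding B2_def by (rule expansion_error_vanishes[OF W R \<theta>(1) C \<beta> less_imp_le[OF \<delta>(1)] \<delta>(2)]) auto
    show "(\<lambda>N. measure_pmf.prob (random_graph N (\<theta> N) W) (B3 N)) \<longlonglongrightarrow> 0"
      unfolding B3_def by (rule cV)
  qed
  moreover have "eventually (\<lambda>N. \<forall>A\<in>set_pmf (random_graph N (\<theta> N) W) - (B1 N \<union> (B2 N \<union> B3 N)).
      \<bar>risk W \<beta>\<^sub>0 (\<theta> N) (\<delta> N) N (hamiltonian_test \<alpha> \<beta>\<^sub>0 N (\<theta> N)) A - \<alpha>\<bar> \<le> \<epsilon>) sequentially"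
  proof -
    \<comment> \<open>Beyond \<open>y\<close> the exponent \<open>u\<^sup>2 / 2 - z * u = u * (u / 2 - z)\<close> is at least \<open>L + 1\<close>; the 1 absorbs the expansion error.\<close>
    define y where "y = 2 * (?z + L + 1)"
    have "eventually (\<lambda>N. sqrt (\<theta> N) / \<delta> N < sqrt c / y) sequentially"
      using large c z L by (intro order_tendstoD(2)[OF large]) (auto simp: y_def)
    moreover have "eventually (\<lambda>N. \<delta> N < min \<beta>\<^sub>0 (1 / op_norm W - \<beta>\<^sub>0)) sequentially"
      using \<delta>(2) \<beta> by (intro order_tendstoD(2)[of \<delta> 0]) auto
    moreover have "eventually (\<lambda>N. h N < \<beta>\<^sub>0) sequentially"
      using hlim \<beta>(1) by (rule order_tendstoD(2))
    ultimately show ?thesis using eventually_ge_at_top[of 1]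
    proof eventually_elim
      case (elim N)
      have t: "0 < \<theta> N" and d: "0 < \<delta> N" and N: "N > 0" using \<theta> \<delta>(1) elim by auto
      have alt: "\<beta>\<^sub>0 + \<delta> N \<in> alternatives W \<beta>\<^sub>0 (\<delta> N)"
        using elim d \<beta> by (simp add: alternatives_def)
      have y: "y \<ge> 2" using z L by (simp add: y_def)
      show ?case
      proof
        fix A assume "A \<in> set_pmf (random_graph N (\<theta> N) W) - (B1 N \<union> (B2 N \<union> B3 N))"
        then have A: "adjacency A" and err1: "expansion_error N (\<theta> N) \<beta>\<^sub>0 (h N) A \<le> e"
          and err2: "expansion_error N (\<theta> N) \<beta>\<^sub>0 (\<delta> N) A \<le> 1"
          and V: "c / \<theta> N \<le> scaled_edge_sum N (\<theta> N) A"
          by (auto simp: B1_def B2_def B3_def not_le intro: random_graph_adjacency)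
        define V where "V = scaled_edge_sum N (\<theta> N) A"
        have ct: "0 < c / \<theta> N" using c t by simp
        have V0: "0 < V" using V ct unfolding V_def by linarith
        have sV: "sqrt (c / \<theta> N) \<le> sqrt V" using V by (simp add: V_def)
        have "r = h N * sqrt (c / \<theta> N)" using c t by (simp add: h_def real_sqrt_divide)
        also have "\<dots> \<le> h N * sqrt V" using h0[OF elim(4)] sV by (intro mult_left_mono)
        finally have hr: "r \<le> h N * sqrt V" .
        have lev: "\<bar>measure (ising N (\<theta> N) A \<beta>\<^sub>0) {\<sigma> \<in> spins N. hamiltonian_test \<alpha> \<beta>\<^sub>0 N (\<theta> N) A \<sigma> = 1} - \<alpha>\<bar> \<le> \<epsilon> / 2"
          using elim err1 V0 hr h0[OF elim(4)] by (intro level[rule_format, OF A N t, of "h N"]) (auto simp: V_def)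
        have "sqrt (\<theta> N) * y \<le> sqrt c * \<delta> N" using elim(1) d y by (simp add: field_simps)
        then have "y \<le> \<delta> N * sqrt (c / \<theta> N)" using t by (simp add: real_sqrt_divide field_simps)
        also have "\<dots> \<le> \<delta> N * sqrt V" using d sV by (intro mult_left_mono) auto
        finally have yV: "y \<le> \<delta> N * sqrt V" .
        define u where "u = \<delta> N * sqrt V"
        have "1 * (L + 1) \<le> u * (u / 2 - ?z)"
          using yV z L y by (intro mult_mono) (auto simp: u_def y_def)
        also have "\<dots> = u\<^sup>2 / 2 - ?z * u" by (simp add: power2_eq_square algebra_simps)
        finally have main: "L + expansion_error N (\<theta> N) \<beta>\<^sub>0 (\<delta> N) A \<le> (\<delta> N * sqrt V)\<^sup>2 / 2 - ?z * (\<delta> N * sqrt V)"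
          using err2 by (simp add: u_def)
        have acc: "measure (ising N (\<theta> N) A \<beta>) {\<sigma> \<in> spins N. hamiltonian_test \<alpha> \<beta>\<^sub>0 N (\<theta> N) A \<sigma> = 0} \<le> exp (- L)"
          if "\<beta> \<in> alternatives W \<beta>\<^sub>0 (\<delta> N)" for \<beta>
          using elim V0 by (intro acceptance_probability_le[OF A N t d _ L(1) main V_def _ that]) auto
        let ?S = "SUP \<beta>\<in>alternatives W \<beta>\<^sub>0 (\<delta> N). measure (ising N (\<theta> N) A \<beta>) {\<sigma> \<in> spins N. hamiltonian_test \<alpha> \<beta>\<^sub>0 N (\<theta> N) A \<sigma> = 0}"
        have "?S \<le> exp (- L)" using alt acc by (intro cSUP_least) auto
        moreover have "0 \<le> ?S"
          using cSUP_upper[OF alt risk_bdd_above, of N "\<theta> N" A "hamiltonian_test \<alpha> \<beta>\<^sub>0 N (\<theta> N)"]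
          by (rule order_trans[OF measure_nonneg])
        ultimately show "\<bar>risk W \<beta>\<^sub>0 (\<theta> N) (\<delta> N) N (hamiltonian_test \<alpha> \<beta>\<^sub>0 N (\<theta> N)) A - \<alpha>\<bar> \<le> \<epsilon>"
          using lev L(2) unfolding risk_def by linarith
      qed
    qed
  qed
  ultimately show "\<exists>B. (\<lambda>N. measure_pmf.prob (random_graph N (\<theta> N) W) (B N)) \<longlonglongrightarrow> 0 \<and>
    eventually (\<lambda>N. \<forall>\<omega>\<in>set_pmf (random_graph N (\<theta> N) W) - B N.
      \<bar>risk W \<beta>\<^sub>0 (\<theta> N) (\<delta> N) N (hamiltonian_test \<alpha> \<beta>\<^sub>0 N (\<theta> N)) \<omega> - \<alpha>\<bar> \<le> \<epsilon>) sequentially"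
    by (intro exI[of _ "\<lambda>N. B1 N \<union> (B2 N \<union> B3 N)"] conjI)
qed

text \<open>
  The level is free, so the risk of the test with a small \<open>\<alpha>\<close> bounds the minimal risk.
\<close>

lemma min_risk_tendsto_zero:
  assumes risk: "\<And>\<alpha>. 0 < \<alpha> \<Longrightarrow> \<alpha> < 1 \<Longrightarrow> converges_in_prob G (\<lambda>N. risk W \<beta>\<^sub>0 (\<theta> N) (\<delta> N) N (hamiltonian_test \<alpha> \<beta>\<^sub>0 N (\<theta> N))) \<alpha>"
    and alt: "eventually (\<lambda>N. alternatives W \<beta>\<^sub>0 (\<delta> N) \<noteq> {}) sequentially"
  shows "converges_in_prob G (\<lambda>N. min_risk W \<beta>\<^sub>0 (\<theta> N) (\<delta> N) N) 0"
proof (rule converges_in_probI)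
  fix \<epsilon> :: real assume \<epsilon>: "\<epsilon> > 0"
  define \<alpha> where "\<alpha> = min (\<epsilon> / 2) (1 / 2)"
  have \<alpha>: "0 < \<alpha>" "\<alpha> < 1" "\<alpha> \<le> \<epsilon> / 2" using \<epsilon> by (auto simp: \<alpha>_def)
  define B where "B = (\<lambda>N. {A. \<bar>risk W \<beta>\<^sub>0 (\<theta> N) (\<delta> N) N (hamiltonian_test \<alpha> \<beta>\<^sub>0 N (\<theta> N)) A - \<alpha>\<bar> > \<epsilon> / 2})"
  have "(\<lambda>N. measure_pmf.prob (G N) (B N)) \<longlonglongrightarrow> 0"
    using risk[OF \<alpha>(1,2)] half_gt_zero[OF \<epsilon>] unfolding converges_in_prob_def B_def by blast
  moreover have "eventually (\<lambda>N. \<forall>A\<in>set_pmf (G N) - B N. \<bar>min_risk W \<beta>\<^sub>0 (\<theta> N) (\<delta> N) N A - 0\<bar> \<le> \<epsilon>) sequentially"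
    using alt
  proof eventually_elim
    case (elim N)
    have test: "hamiltonian_test \<alpha> \<beta>\<^sub>0 N (\<theta> N) \<in> tests N" by (auto simp: tests_def hamiltonian_test_def)
    show ?case
    proof
      fix A assume "A \<in> set_pmf (G N) - B N"
      then have "\<bar>risk W \<beta>\<^sub>0 (\<theta> N) (\<delta> N) N (hamiltonian_test \<alpha> \<beta>\<^sub>0 N (\<theta> N)) A - \<alpha>\<bar> \<le> \<epsilon> / 2" by (simp add: B_def)
      then show "\<bar>min_risk W \<beta>\<^sub>0 (\<theta> N) (\<delta> N) N A - 0\<bar> \<le> \<epsilon>"
        using min_risk_bounds(1)[OF elim, of "\<theta> N" N A] min_risk_bounds(3)[OF elim test, of "\<theta> N" A] \<alpha>(3) by linarith
    qed
  qed
  ultimately show "\<exists>B. (\<lambda>N. measure_pmf.prob (G N) (B N)) \<longlonglongrightarrow> 0 \<and>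
    eventually (\<lambda>N. \<forall>\<omega>\<in>set_pmf (G N) - B N. \<bar>min_risk W \<beta>\<^sub>0 (\<theta> N) (\<delta> N) N \<omega> - 0\<bar> \<le> \<epsilon>) sequentially"
    by (intro exI[of _ B] conjI)
qed

theorem theorem3p5:
  fixes W :: "real \<Rightarrow> real \<Rightarrow> real"
    and \<theta> \<delta> :: "nat \<Rightarrow> real"
    and \<beta>\<^sub>0 :: real
  assumes "graphon W"
    and "riemann_integrable (\<lambda>(x, y). W x y) (0, 0) (1, 1)"
    and "riemann_integrable (\<lambda>x. W x x) 0 1"
    and "(LINT p|lebesgue_on ({0..1} \<times> {0..1}). (case p of (x, y) \<Rightarrow> W x y)) > 0"
    and "\<And>N. N \<ge> 1 \<Longrightarrow> 0 < \<theta> N \<and> \<theta> N < 1"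
    and "\<exists>C>0. \<forall>\<^sub>F N in sequentially. real N powr (2 / 3) * \<theta> N \<ge> C"
    and "\<theta> \<longlonglongrightarrow> 0"
    and "0 < \<beta>\<^sub>0" and "\<beta>\<^sub>0 < 1 / op_norm W"
    and "\<And>N. N \<ge> 1 \<Longrightarrow> \<delta> N > 0"
    and "\<delta> \<longlonglongrightarrow> 0"
  shows "((\<lambda>N. \<delta> N / sqrt (\<theta> N)) \<longlonglongrightarrow> 0 \<longrightarrow>
            converges_in_prob (\<lambda>N. random_graph N (\<theta> N) W)
              (\<lambda>N. min_risk W \<beta>\<^sub>0 (\<theta> N) (\<delta> N) N) 1) \<and>
         ((\<lambda>N. sqrt (\<theta> N) / \<delta> N) \<longlonglongrightarrow> 0 \<longrightarrow>
            (\<forall>\<alpha>\<in>{0<..<1}.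
               converges_in_prob (\<lambda>N. random_graph N (\<theta> N) W)
                 (\<lambda>N. risk W \<beta>\<^sub>0 (\<theta> N) (\<delta> N) N (hamiltonian_test \<alpha> \<beta>\<^sub>0 N (\<theta> N))) \<alpha>) \<and>
            converges_in_prob (\<lambda>N. random_graph N (\<theta> N) W)
              (\<lambda>N. min_risk W \<beta>\<^sub>0 (\<theta> N) (\<delta> N) N) 0)"
proof -
  obtain C where C: "C > 0" "eventually (\<lambda>N. real N powr (2 / 3) * \<theta> N \<ge> C) sequentially"
    using assms(6) by blast
  have "eventually (\<lambda>N. \<delta> N < 1 / op_norm W - \<beta>\<^sub>0) sequentially"
    using assms(9,11) by (intro order_tendstoD(2)[of \<delta> 0]) auto
  then have alt: "eventually (\<lambda>N. alternatives W \<beta>\<^sub>0 (\<delta> N) \<noteq> {}) sequentially"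
    using eventually_ge_at_top[of 1]
  proof eventually_elim
    case (elim N)
    then have "\<beta>\<^sub>0 + \<delta> N \<in> alternatives W \<beta>\<^sub>0 (\<delta> N)"
      using assms(8) assms(10)[of N] by (simp add: alternatives_def)
    then show ?case by blast
  qed
  have "converges_in_prob (\<lambda>N. random_graph N (\<theta> N) W)
      (\<lambda>N. risk W \<beta>\<^sub>0 (\<theta> N) (\<delta> N) N (hamiltonian_test \<alpha> \<beta>\<^sub>0 N (\<theta> N))) \<alpha>"
    if "(\<lambda>N. sqrt (\<theta> N) / \<delta> N) \<longlonglongrightarrow> 0" "0 < \<alpha>" "\<alpha> < 1" for \<alpha>
    by (rule hamiltonian_test_risk_tendsto[OF assms(1,2,4,5,7) C assms(8-11) that])
  then show ?thesis
    using min_risk_tendsto_one[OF assms(1,2,5) C assms(8-11)] min_risk_tendsto_zero[OF _ alt]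
    by (auto simp: greaterThanLessThan_iff)
qed

end
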